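(* Let $n\ge1$ be an integer and let $\Lambda\subset\mathbb{R}^2$ be a lattice. Then $\Gamma_\Lambda$ is a sampling sequence for $\mathbf{F}^n(\mathbb{C})$ if and only if $D(\Lambda)>n$.
   Context: The polyanalytic Fock space $\mathbf{F}^n(\mathbb{C})$ is the space of functions $F(z)=\sum_{k=0}^{n-1}\bar z^k\varphi_k(z)$ with $\varphi_k$ entire on $\mathbb{C}$ and $\|F\|^2=\int_{\mathbb{C}}|F(z)|^2e^{-\pi|z|^2}dz<\infty$ (equivalently, functions with $\partial_{\bar z}^nF=0$ and finite such norm). A lattice is $\Lambda=A\mathbb{Z}^2$ with $A$ an invertible real $2\times2$ matrix; its density is $D(\Lambda)=|\det A|^{-1}$. $\Gamma_\Lambda=\{x+i\omega\in\mathbb{C}:(x,\omega)\in\Lambda\}$. $\Gamma$ is a sampling sequence for $\mathbf{F}^n(\mathbb{C})$ if there are $A,B>0$ with $A\|F\|^2\le\sum_{z\in\Gamma}|F(z)|^2e^{-\pi|z|^2}\le B\|F\|^2$ for every $F\in\mathbf{F}^n(\mathbb{C})$. *)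

theory Defs
  imports "HOL-Analysis.Analysis"
begin

definition fock_norm2 :: "(complex \<Rightarrow> complex) \<Rightarrow> ennreal" where
  "fock_norm2 F = (\<integral>\<^sup>+ z. ennreal ((norm (F z))\<^sup>2 * exp (- pi * (norm z)\<^sup>2)) \<partial>lborel)"

definition polyFock :: "nat \<Rightarrow> (complex \<Rightarrow> complex) set" where
  "polyFock n = {F. (\<exists>\<phi>::nat \<Rightarrow> complex \<Rightarrow> complex.
                       (\<forall>k<n. \<phi> k holomorphic_on UNIV) \<and>
                       (\<forall>z. F z = (\<Sum>k<n. (cnj z) ^ k * \<phi> k z)))
                   \<and> fock_norm2 F < \<infinity>}"

definition sampling_sequence :: "complex set \<Rightarrow> nat \<Rightarrow> bool" where
  "sampling_sequence \<Gamma> n \<longleftrightarrow>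
     (\<exists>a b :: real. a > 0 \<and> b > 0 \<and>
        (\<forall>F \<in> polyFock n.
           ennreal a * fock_norm2 F
             \<le> (\<Sum>\<^sub>\<infinity> z\<in>\<Gamma>. ennreal ((norm (F z))\<^sup>2 * exp (- pi * (norm z)\<^sup>2)))
         \<and> (\<Sum>\<^sub>\<infinity> z\<in>\<Gamma>. ennreal ((norm (F z))\<^sup>2 * exp (- pi * (norm z)\<^sup>2)))
             \<le> ennreal b * fock_norm2 F))"

definition lattice_of :: "real^2^2 \<Rightarrow> (real^2) set" where
  "lattice_of A = {A *v v | v. \<forall>i. v $ i \<in> \<int>}"

definition lattice_density :: "real^2^2 \<Rightarrow> real" where
  "lattice_density A = 1 / \<bar>det A\<bar>"

definition Gamma_of :: "(real^2) set \<Rightarrow> complex set" where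
  "Gamma_of L = (\<lambda>v. Complex (v $ 1) (v $ 2)) ` L"

end

theory Submission
  imports Defs "HOL-Complex_Analysis.Complex_Analysis" "HOL-Probability.Distributions"
    "Jordan_Normal_Form.Determinant"
begin

text \<open>The upper sampling inequality is a Bessel inequality, which follows from a local mean value
  estimate and holds for every lattice. Only the lower inequality depends on the density.

  Let the density exceed \<open>n\<close>. Then powers of a theta function give an entire function \<open>g\<close> of Gaussian
  growth strictly below critical that vanishes to order \<open>n\<close> at the nonzero points of the adjoint
  lattice and to order \<open>n - 1\<close> at the origin. For \<open>F\<close> of order \<open>n\<close>, the Fourier coefficients of the
  periodisation of \<open>F * g * exp (- pi * \<bar>z\<bar>\<^sup>2)\<close> vanish except for the constant one, which is a multiple of
  the top holomorphic coefficient of \<open>F\<close> at the origin. So the samples control this coefficient,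
  by covariance at every point, and one concludes by induction on \<open>n\<close>.

  Conversely, suppose the lower inequality holds. It persists when the lattice is contracted, by averaging
  over Gaussian localisations of \<open>F\<close>, so it is enough to refute it at density exactly \<open>n\<close>. There the
  quasi-periodic functions of the first \<open>n\<close> Landau levels contain a nonzero \<open>H\<close> vanishing on the lattice,
  because the determinant of the vanishing conditions has nonzero winding around a cell. The dilates
  \<open>H (r * z)\<close>, with \<open>r\<close> tending to \<open>1\<close> from below, have bounded sampling sums, so \<open>H\<close> itself has finite
  norm and violates the inequality.\<close>

text \<open>The threshold comes from growth. With D the cell area of the lattice, the adjoint
  lattice has cell area 1 / D, and its theta function grows like exp (pi * D * |z|^2 / 2). The n-th
  power and \<open>F\<close> together grow like exp (pi * (n * D + 1) * |z|^2 / 2), which the weight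
  exp (- pi * |z|^2) beats exactly when n * D < 1. The orders n and n - 1 come from rotation
  invariance: recentred at a zero of \<open>g\<close>, a Fourier coefficient is a Gaussian integral
  of terms cnj u ^ l times entire functions with l < n. A factor u ^ n kills all of them, a factor u
  ^ (n - 1) spares only l = n - 1.

  The obstacle in the converse is that the quasi-periodic candidates have periodic weighted modulus,
  which by itself suggests infinite norm. Their dilates do lie in the space, with norms that could
  blow up like 1 / (1 - r^2); the zeros make the sample sums smaller by one power of 1 - r^2, and
  the assumed inequality transfers this gain to the norms. A cell of area n * D = 1 contains n
  lattice points, as many as there are Landau levels, so the critical determinant is square.\<close>

subsection \<open>Lebesgue measure on the complex plane\<close>

lemma lborel_complex: "(lborel :: complex measure) = distr (lborel \<Otimes>\<^sub>M lborel) borel (\<lambda>(x, y). Complex x y)"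
proof (rule lborel_eqI)
  have m[measurable]: "(\<lambda>(x::real, y). Complex x y) \<in> borel_measurable (borel \<Otimes>\<^sub>M borel)"
    unfolding borel_prod by (intro borel_measurable_continuous_onI)
      (auto simp: case_prod_unfold Complex_eq intro!: continuous_intros)
  have m2[measurable]: "(\<lambda>(x::real, y). Complex x y) \<in> borel_measurable (lborel \<Otimes>\<^sub>M lborel)"
    by (subst measurable_cong_sets[OF sets_pair_measure_cong[OF sets_lborel sets_lborel] refl]) (rule m)
  fix l u :: complex assume le: "\<And>b. b \<in> Basis \<Longrightarrow> l \<bullet> b \<le> u \<bullet> b"
  from le[of 1] le[of \<i>] have le': "Re l \<le> Re u" "Im l \<le> Im u" by (auto simp: Basis_complex_def)
  have "(\<lambda>(x, y). Complex x y) -` box l u \<inter> space (lborel \<Otimes>\<^sub>M lborel) = {Re l<..<Re u} \<times> {Im l<..<Im u}"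
    by (auto simp: box_def Basis_complex_def space_pair_measure)
  then show "emeasure (distr (lborel \<Otimes>\<^sub>M lborel) borel (\<lambda>(x, y). Complex x y)) (box l u) = (\<Prod>b\<in>Basis. (u - l) \<bullet> b)"
    using le' by (subst emeasure_distr) (auto simp: lborel.emeasure_pair_measure_Times ennreal_mult Basis_complex_def)
qed simp

lemma nn_integral_complex:
  assumes [measurable]: "f \<in> borel_measurable borel"
  shows "(\<integral>\<^sup>+z. f z \<partial>lborel) = (\<integral>\<^sup>+x. \<integral>\<^sup>+y. f (Complex x y) \<partial>lborel \<partial>lborel)"
    and "(\<integral>\<^sup>+z. f z \<partial>lborel) = (\<integral>\<^sup>+y. \<integral>\<^sup>+x. f (Complex x y) \<partial>lborel \<partial>lborel)"
proof -
  have m[measurable]: "(\<lambda>(x::real, y). Complex x y) \<in> borel_measurable (borel \<Otimes>\<^sub>M borel)"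
    unfolding borel_prod by (intro borel_measurable_continuous_onI)
      (auto simp: case_prod_unfold Complex_eq intro!: continuous_intros)
  have m2[measurable]: "(\<lambda>(x::real, y). Complex x y) \<in> borel_measurable (lborel \<Otimes>\<^sub>M lborel)"
    by (subst measurable_cong_sets[OF sets_pair_measure_cong[OF sets_lborel sets_lborel] refl]) (rule m)
  have "(\<integral>\<^sup>+z. f z \<partial>lborel) = (\<integral>\<^sup>+z. f (Complex (fst z) (snd z)) \<partial>(lborel \<Otimes>\<^sub>M lborel))"
    by (subst lborel_complex, subst nn_integral_distr) (auto simp: case_prod_unfold)
  then have *: "(\<integral>\<^sup>+z. f z \<partial>lborel) = (\<integral>\<^sup>+(x,y). f (Complex x y) \<partial>(lborel \<Otimes>\<^sub>M lborel))"
    by (simp add: case_prod_unfold)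
  have m3: "(\<lambda>(x,y). f (Complex x y)) \<in> borel_measurable (lborel \<Otimes>\<^sub>M lborel)"
    using measurable_compose[OF m2 assms] by (simp add: case_prod_unfold)
  show "(\<integral>\<^sup>+z. f z \<partial>lborel) = (\<integral>\<^sup>+x. \<integral>\<^sup>+y. f (Complex x y) \<partial>lborel \<partial>lborel)"
    using lborel.nn_integral_fst[OF m3] * by simp
  show "(\<integral>\<^sup>+z. f z \<partial>lborel) = (\<integral>\<^sup>+y. \<integral>\<^sup>+x. f (Complex x y) \<partial>lborel \<partial>lborel)"
    using lborel_pair.nn_integral_snd[OF m3] * by simp
qed

lemma measurable_Complex[measurable (raw)]:
  assumes "f \<in> borel_measurable M" "g \<in> borel_measurable M"
  shows "(\<lambda>x. Complex (f x) (g x)) \<in> borel_measurable M"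
  using assms unfolding Complex_eq by measurable

text \<open>Lines parallel to the direction of the shear are only translated, so Fubini with that
  coordinate innermost reduces the claim to translation invariance on the real line.\<close>

lemma nn_integral_shear:
  fixes a :: real
  assumes [measurable]: "f \<in> borel_measurable borel"
  shows "(\<integral>\<^sup>+z. f (z + of_real (a * Im z)) \<partial>lborel) = (\<integral>\<^sup>+z. f z \<partial>lborel)"
    and "(\<integral>\<^sup>+z. f (z + \<i> * of_real (a * Re z)) \<partial>lborel) = (\<integral>\<^sup>+z. f z \<partial>lborel)"
proof -
  have 1: "Complex x y + of_real (a * Im (Complex x y)) = Complex (a * y + 1 * x) y" for x y
    by (simp add: complex_eq_iff)
  have 2: "Complex x y + \<i> * of_real (a * Re (Complex x y)) = Complex x (a * x + 1 * y)" for x y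
    by (simp add: complex_eq_iff)
  show "(\<integral>\<^sup>+z. f (z + of_real (a * Im z)) \<partial>lborel) = (\<integral>\<^sup>+z. f z \<partial>lborel)"
    apply (subst (1 2) nn_integral_complex(2))
      apply measurable
    apply (subst 1)
    apply (rule nn_integral_cong)
    subgoal for y using nn_integral_real_affine[of "\<lambda>x. f (Complex x y)" 1 "a * y"] by simp
    done
  show "(\<integral>\<^sup>+z. f (z + \<i> * of_real (a * Re z)) \<partial>lborel) = (\<integral>\<^sup>+z. f z \<partial>lborel)"
    apply (subst (1 2) nn_integral_complex(1))
      apply measurable
    apply (subst 2)
    apply (rule nn_integral_cong)
    subgoal for x using nn_integral_real_affine[of "\<lambda>y. f (Complex x y)" 1 "a * x"] by simp
    done
qed

text \<open>A non-real rotation is a product of three shears, each of which preserves the integral.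
  The real units 1 and -1 are products of two non-real rotations.\<close>

lemma nn_integral_rotate:
  assumes [measurable]: "f \<in> borel_measurable borel" and \<zeta>: "norm \<zeta> = 1"
  shows "(\<integral>\<^sup>+z. f (\<zeta> * z) \<partial>lborel) = (\<integral>\<^sup>+z. f z \<partial>(lborel :: complex measure))"
proof -
  have *: "(\<integral>\<^sup>+z. f (\<zeta> * z) \<partial>lborel) = (\<integral>\<^sup>+z. f z \<partial>(lborel :: complex measure))"
    if \<zeta>: "norm \<zeta> = 1" and s: "Im \<zeta> \<noteq> 0" and [measurable]: "f \<in> borel_measurable borel" for \<zeta> f
  proof -
    define s where "s = Im \<zeta>"
    define c where "c = Re \<zeta>"
    \<comment> \<open>Minus the tangent of half the angle: the horizontal shear by \<open>a\<close>,
      the vertical shear by \<open>s\<close> and again the horizontal shear by \<open>a\<close>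
      compose to the rotation.\<close>
    define a where "a = (c - 1) / s"
    define S where "S z = z + of_real (a * Im z)" for z
    define S' where "S' z = z + \<i> * of_real (s * Re z)" for z
    have sc: "s^2 + c^2 = 1" using \<zeta> unfolding s_def c_def cmod_def by (simp add: add.commute)
    have s0: "s \<noteq> 0" using s s_def by simp
    have 1: "a * s = c - 1" using s0 by (simp add: a_def)
    have 2: "a * (1 + c) = - s"
      using s0 sc by (simp add: a_def field_simps power2_eq_square)
    have r: "\<zeta> * z = S (S' (S z))" for z
    proof -
      have "Re (S (S' (S z))) = Re z * (1 + a * s) + Im z * (a * (1 + (1 + a * s)))"
        by (simp add: S_def S'_def algebra_simps)
      moreover have "Im (S (S' (S z))) = s * Re z + (1 + a * s) * Im z"
        by (simp add: S_def S'_def algebra_simps)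
      moreover have "1 + a * s = c" "a * (1 + c) = - s" using 1 2 by auto
      ultimately have "Re (S (S' (S z))) = Re z * c + Im z * (- s)" "Im (S (S' (S z))) = s * Re z + c * Im z"
        by metis+
      then show ?thesis
        by (simp add: complex_eq_iff s_def[symmetric] c_def[symmetric])
    qed
    have m[measurable]: "S \<in> borel_measurable borel" "S' \<in> borel_measurable borel"
      unfolding S_def S'_def by measurable
    have "(\<integral>\<^sup>+z. f (\<zeta> * z) \<partial>lborel) = (\<integral>\<^sup>+z. f (S (S' (S z))) \<partial>lborel)" by (simp add: r)
    also have "\<dots> = (\<integral>\<^sup>+z. f (S (S' z)) \<partial>lborel)"
      using nn_integral_shear(1)[of "\<lambda>z. f (S (S' z))" a] by (simp add: S_def)
    also have "\<dots> = (\<integral>\<^sup>+z. f (S z) \<partial>lborel)"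
      using nn_integral_shear(2)[of "\<lambda>z. f (S z)" s] by (simp add: S'_def)
    also have "\<dots> = (\<integral>\<^sup>+z. f z \<partial>lborel)"
      using nn_integral_shear(1)[of "\<lambda>z. f z" a] by (simp add: S_def)
    finally show ?thesis .
  qed
  show ?thesis
  proof (cases "Im \<zeta> = 0")
    case True
    have "(\<integral>\<^sup>+z. f (\<zeta> * z) \<partial>lborel) = (\<integral>\<^sup>+z. f (\<zeta> * ((-\<i>) * (\<i> * z))) \<partial>lborel)" by simp
    also have "\<dots> = (\<integral>\<^sup>+z. f ((\<zeta> * (-\<i>)) * z) \<partial>lborel)"
      using *[of "\<i>" "\<lambda>z. f (\<zeta> * ((-\<i>) * z))"] by (simp add: mult.assoc)
    also have "\<dots> = (\<integral>\<^sup>+z. f z \<partial>lborel)"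
      using \<zeta> True by (intro *) (auto simp: norm_mult cmod_def)
    finally show ?thesis .
  qed (use * \<zeta> assms in auto)
qed

lemma lborel_distr_rotate:
  assumes "norm \<zeta> = 1" shows "distr lborel borel ((*) \<zeta>) = (lborel :: complex measure)"
proof (rule measure_eqI)
  fix A :: "complex set" assume "A \<in> sets (distr lborel borel ((*) \<zeta>))"
  then have [measurable]: "A \<in> sets borel" by simp
  have "emeasure (distr lborel borel ((*) \<zeta>)) A = (\<integral>\<^sup>+z. indicator A z \<partial>distr lborel borel ((*) \<zeta>))"
    by (subst nn_integral_indicator) auto
  also have "\<dots> = (\<integral>\<^sup>+z. indicator A (\<zeta> * z) \<partial>lborel)" by (subst nn_integral_distr) auto
  also have "\<dots> = emeasure lborel A" by (subst nn_integral_rotate) (use assms in auto)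
  finally show "emeasure (distr lborel borel ((*) \<zeta>)) A = emeasure lborel A" .
qed simp

lemma integral_rotate:
  fixes f :: "complex \<Rightarrow> 'b::{banach,second_countable_topology}"
  assumes "norm \<zeta> = 1"
  shows "(LINT z|lborel. f (\<zeta> * z)) = (LINT z|lborel. f z)"
proof (cases "f \<in> borel_measurable borel")
  case True
  then have "(LINT z|distr lborel borel ((*) \<zeta>). f z) = (LINT z|lborel. f (\<zeta> * z))"
    by (subst integral_distr) auto
  then show ?thesis using lborel_distr_rotate[OF assms] by simp
next
  \<comment> \<open>Measurability is equivalent before and after the rotation; without it both
    Bochner integrals take the default value 0.\<close>
  case False
  have "(\<lambda>z. f (\<zeta> * z)) \<notin> borel_measurable borel"
  proof
    assume "(\<lambda>z. f (\<zeta> * z)) \<in> borel_measurable borel"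
    then have "(\<lambda>z. f (\<zeta> * (inverse \<zeta> * z))) \<in> borel_measurable borel"
      by (rule measurable_compose[rotated]) measurable
    moreover have "\<zeta> * (inverse \<zeta> * z) = z" for z using assms by (cases "\<zeta> = 0") (auto simp: mult.assoc[symmetric])
    ultimately show False using False by simp
  qed
  then have "\<not> integrable lborel (\<lambda>z. f (\<zeta> * z))" "\<not> integrable lborel f"
    using False borel_measurable_integrable by fastforce+
  then show ?thesis by (simp add: not_integrable_integral_eq)
qed

lemma nn_integral_translate:
  fixes a :: "'a::euclidean_space"
  assumes "f \<in> borel_measurable borel"
  shows "(\<integral>\<^sup>+z. f (z + a) \<partial>lborel) = (\<integral>\<^sup>+z. f z \<partial>lborel)"
proof -
  have "(\<integral>\<^sup>+z. f z \<partial>lborel) = (\<integral>\<^sup>+z. f z \<partial>distr lborel borel ((+) a))" by (simp add: lborel_distr_plus)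
  also have "\<dots> = (\<integral>\<^sup>+z. f (z + a) \<partial>lborel)"
    using assms by (subst nn_integral_distr) (auto simp: add.commute)
  finally show ?thesis by simp
qed

lemma nn_integral_dilate:
  fixes f :: "complex \<Rightarrow> ennreal"
  assumes "f \<in> borel_measurable borel" and "t > 0"
  shows "(\<integral>\<^sup>+z. f z \<partial>lborel) = ennreal (t^2) * (\<integral>\<^sup>+z. f (of_real t * z) \<partial>lborel)"
proof -
  have "(\<integral>\<^sup>+z. f z \<partial>lborel) = (\<integral>\<^sup>+z. f z \<partial>density (distr lborel borel (\<lambda>x. 0 + t *\<^sub>R x)) (\<lambda>_. \<bar>t\<bar>^DIM(complex)))"
    using lborel_affine[of t "0::complex"] assms(2) by simp
  also have "\<dots> = ennreal (t^2) * (\<integral>\<^sup>+z. f (of_real t * z) \<partial>lborel)"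
    using assms by (simp add: nn_integral_density nn_integral_distr nn_integral_cmult scaleR_conv_of_real ennreal_power)
  finally show ?thesis .
qed

lemma integral_translate:
  fixes f :: "complex \<Rightarrow> 'b::{banach,second_countable_topology}"
  assumes "f \<in> borel_measurable borel"
  shows "(LINT z|lborel. f (z + a)) = (LINT z|lborel. f z)"
proof -
  have "(LINT z|lborel. f z) = (LINT z|distr lborel borel ((+) a). f z)" by (simp add: lborel_distr_plus)
  also have "\<dots> = (LINT z|lborel. f (z + a))"
    using assms by (subst integral_distr) (auto simp: add.commute)
  finally show ?thesis by simp
qed

section \<open>Planar Gaussian integrals\<close>

definition gauss_mass :: ennreal where
  "gauss_mass = (\<integral>\<^sup>+z. ennreal (exp (- pi * (norm (z::complex))\<^sup>2)) \<partial>lborel)"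

lemma gauss_mass_finite: "gauss_mass < \<infinity>"
proof -
  let ?I = "\<integral>\<^sup>+x. ennreal (exp (- pi * x\<^sup>2)) \<partial>lborel"
  \<comment> \<open>With variance 1 / (2 * pi) the normalised normal density is exactly exp (- pi *
    x^2).\<close>
  define \<sigma> where "\<sigma> = sqrt (1 / (2 * pi))"
  have s2: "\<sigma>\<^sup>2 = 1 / (2 * pi)" unfolding \<sigma>_def by (subst real_sqrt_pow2) auto
  have "(\<lambda>x. exp (- pi * x\<^sup>2)) = normal_density 0 \<sigma>"
    by (rule ext) (simp add: normal_density_def s2 field_simps)
  moreover have "integrable lborel (normal_density 0 \<sigma>)"
    by (rule integrable_normal_density) (simp add: \<sigma>_def)
  ultimately have "integrable lborel (\<lambda>x. exp (- pi * x\<^sup>2))" by simp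
  then have fin: "?I < \<infinity>" by (subst (asm) integrable_iff_bounded) simp
  have "gauss_mass = (\<integral>\<^sup>+x. \<integral>\<^sup>+y. ennreal (exp (- pi * x\<^sup>2)) * ennreal (exp (- pi * y\<^sup>2)) \<partial>lborel \<partial>lborel)"
    unfolding gauss_mass_def
    by (subst nn_integral_complex(1))
       (auto simp: cmod_power2 ennreal_mult[symmetric] mult_exp_exp[symmetric] algebra_simps exp_diff exp_minus field_simps exp_add intro!: nn_integral_cong)
  also have "\<dots> = ?I * ?I"
    by (simp add: nn_integral_cmult nn_integral_multc)
  also have "\<dots> < \<infinity>" using fin by (simp add: ennreal_mult_less_top)
  finally show ?thesis .
qed

lemma nn_integral_gauss:
  assumes "t > 0"
  shows "(\<integral>\<^sup>+z. ennreal (exp (- t * (norm (z - a :: complex))\<^sup>2)) \<partial>lborel) = ennreal (pi / t) * gauss_mass"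
proof -
  have m: "(\<lambda>z. ennreal (exp (- t * (norm (z :: complex))\<^sup>2))) \<in> borel_measurable borel" by measurable
  have "(\<integral>\<^sup>+z. ennreal (exp (- t * (norm (z - a :: complex))\<^sup>2)) \<partial>lborel) = (\<integral>\<^sup>+z. ennreal (exp (- t * (norm (z :: complex))\<^sup>2)) \<partial>lborel)"
    using nn_integral_translate[OF m, of "-a"] by simp
  also have "\<dots> = ennreal ((sqrt (pi / t))^2) * (\<integral>\<^sup>+z. ennreal (exp (- t * (norm (of_real (sqrt (pi / t)) * z :: complex))\<^sup>2)) \<partial>lborel)"
    using assms by (intro nn_integral_dilate m) auto
  also have "\<dots> = ennreal (pi / t) * gauss_mass"
    using assms by (simp add: gauss_mass_def norm_mult power_mult_distrib)
  finally show ?thesis .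
qed

lemma gauss_mass_pos: "gauss_mass > 0"
proof -
  have "gauss_mass \<noteq> 0"
  proof
    assume "gauss_mass = 0"
    then have "AE z in (lborel::complex measure). ennreal (exp (- pi * (norm z)\<^sup>2)) = 0"
      unfolding gauss_mass_def by (subst (asm) nn_integral_0_iff_AE) auto
    then have "AE z in (lborel::complex measure). False" by eventually_elim (simp add: ennreal_eq_0_iff not_le)
    then have "emeasure (lborel::complex measure) UNIV = 0" using AE_iff_null[of lborel "\<lambda>_::complex. False"] by auto
    then show False by simp
  qed
  then show ?thesis by (simp add: zero_less_iff_neq_zero)
qed

subsection \<open>Radial kernels\<close>

lemma borel_measurable_cnj[measurable (raw)]:
  "f \<in> borel_measurable M \<Longrightarrow> (\<lambda>x. cnj (f x)) \<in> borel_measurable M"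
  by (rule borel_measurable_continuous_on[of cnj]) (auto intro: continuous_intros)

lemma integrable_ball_bounded:
  fixes f :: "complex \<Rightarrow> 'b::{banach,second_countable_topology}"
  assumes m: "f \<in> borel_measurable borel" and b: "\<And>u. norm u \<le> R \<Longrightarrow> norm (f u) \<le> B"
    and z: "\<And>u. norm u > R \<Longrightarrow> f u = 0"
  shows "integrable lborel f"
proof (rule integrableI_bounded_set[where A="cball 0 R" and B=B])
  show "emeasure lborel (cball (0::complex) R) < \<infinity>"
    by (rule emeasure_bounded_finite) simp
qed (use assms in \<open>auto simp: not_le\<close>)

text \<open>Rotation by the angle pi / d with d = |l - m| preserves the measure and multiplies the
  integrand by -1, so the integral equals its own negative.\<close>

lemma radial_moment_zero:
  fixes r :: "real \<Rightarrow> real"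
  assumes "l \<noteq> m"
  shows "(LINT u|lborel. of_real (r (norm u)) * cnj u ^ l * (u::complex) ^ m) = 0"
proof -
  define f :: "complex \<Rightarrow> complex" where "f u = of_real (r (norm u)) * cnj u ^ l * u ^ m" for u
  define d where "d = (if l < m then m - l else l - m)"
  have d: "d > 0" using assms by (auto simp: d_def)
  define \<zeta> where "\<zeta> = cis (pi / d)"
  have z1: "norm \<zeta> = 1" by (simp add: \<zeta>_def)
  have zc: "cnj \<zeta> * \<zeta> = 1" using z1 complex_norm_square[of \<zeta>] by (simp add: mult.commute)
  have zd: "\<zeta> ^ d = -1" using d unfolding \<zeta>_def by (subst Complex.DeMoivre) simp
  then have zd': "cnj \<zeta> ^ d = -1" by (metis complex_cnj_minus complex_cnj_one complex_cnj_power)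
  have z: "cnj \<zeta> ^ l * \<zeta> ^ m = -1"
  proof (cases "l < m")
    case True
    then have "\<zeta> ^ m = \<zeta> ^ l * \<zeta> ^ d" by (simp add: d_def flip: power_add)
    then have "cnj \<zeta> ^ l * \<zeta> ^ m = (cnj \<zeta> * \<zeta>) ^ l * \<zeta> ^ d" by (simp add: power_mult_distrib)
    then show ?thesis by (simp add: zc zd)
  next
    case False
    then have "cnj \<zeta> ^ l = cnj \<zeta> ^ m * cnj \<zeta> ^ d" by (simp add: d_def flip: power_add)
    then have "cnj \<zeta> ^ l * \<zeta> ^ m = (cnj \<zeta> * \<zeta>) ^ m * cnj \<zeta> ^ d" by (simp add: power_mult_distrib)
    then show ?thesis by (simp add: zc zd')
  qed
  have "f (\<zeta> * u) = - f u" for u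
  proof -
    have "f (\<zeta> * u) = (cnj \<zeta> ^ l * \<zeta> ^ m) * f u"
      by (simp add: f_def norm_mult z1 power_mult_distrib)
    then show ?thesis by (simp add: z)
  qed
  then have "(LINT u|lborel. f u) = (LINT u|lborel. - f u)"
    using integral_rotate[OF z1, of f] by simp
  then show ?thesis unfolding f_def[symmetric] by simp
qed

text \<open>Integrate the power series of \<phi> term by term: every monomial except u ^ l pairs to
  zero with cnj u ^ l. The bounded support of the kernel makes the interchange absolutely
  convergent.\<close>

lemma radial_integral:
  fixes r :: "real \<Rightarrow> real" and \<phi> :: "complex \<Rightarrow> complex"
  assumes rm[measurable]: "r \<in> borel_measurable borel" and B: "\<And>x. \<bar>r x\<bar> \<le> B" and R: "\<And>x. x > R \<Longrightarrow> r x = 0"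
    and "R > 0" and \<phi>: "\<phi> holomorphic_on UNIV"
  shows "integrable lborel (\<lambda>u. of_real (r (norm u)) * cnj u ^ l * \<phi> u)"
    and "(LINT u|lborel. of_real (r (norm u)) * cnj u ^ l * \<phi> u)
       = (deriv ^^ l) \<phi> 0 / fact l * of_real (LINT u|lborel. r (norm (u::complex)) * norm u ^ (2 * l))"
proof -
  have B0: "B \<ge> 0" using B[of 0] by linarith
  have cm[measurable]: "\<phi> \<in> borel_measurable borel"
    using \<phi> by (intro borel_measurable_continuous_onI holomorphic_on_imp_continuous_on)
  define a where "a m = (deriv ^^ m) \<phi> 0 / fact m" for m
  define f where "f m u = of_real (r (norm u)) * cnj u ^ l * (a m * u ^ m)" for m and u :: complex
  have ps: "(\<lambda>m. a m * u ^ m) sums \<phi> u" for u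
    using holomorphic_power_series[of \<phi> 0 "norm u + 1" u] \<phi> by (auto simp: a_def intro: holomorphic_on_subset)
  \<comment> \<open>Absolute convergence at radius R is read off from convergence at the point 2 *
    R.\<close>
  have sR: "summable (\<lambda>m. norm (a m) * R ^ m)"
    using powser_insidea[OF sums_summable[OF ps[of "of_real (2 * R)"]], of "of_real R"] \<open>R > 0\<close>
    by (simp add: norm_mult norm_power)
  have fb: "norm (f m u) \<le> B * R ^ l * (norm (a m) * R ^ m)" for m u
  proof (cases "norm u \<le> R")
    case True
    have "norm (f m u) = \<bar>r (norm u)\<bar> * norm u ^ l * (norm (a m) * norm u ^ m)"
      by (simp add: f_def norm_mult norm_power)
    also have "\<dots> \<le> B * R ^ l * (norm (a m) * R ^ m)"
      using True B B0 \<open>R > 0\<close> by (intro mult_mono power_mono) auto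
    finally show ?thesis .
  next
    case False
    then have "f m u = 0" by (simp add: f_def R)
    then show ?thesis using B0 \<open>R > 0\<close> by simp
  qed
  have fm[measurable]: "f m \<in> borel_measurable borel" for m
    unfolding f_def[abs_def] by measurable
  have fi: "integrable lborel (f m)" for m
    by (rule integrable_ball_bounded[where R=R, OF fm fb]) (simp add: f_def R)
  have fs: "(\<lambda>m. f m u) sums (of_real (r (norm u)) * cnj u ^ l * \<phi> u)" for u
    unfolding f_def by (intro sums_mult ps)
  have s1: "summable (\<lambda>m. norm (f m u))" for u
    by (rule summable_comparison_test'[OF summable_mult[OF sR, of "B * R ^ l"]]) (use fb in auto)
  define V where "V = measure lborel (cball (0::complex) R)"
  have nb: "(LINT u|lborel. norm (f m u)) \<le> V * (B * R ^ l * (norm (a m) * R ^ m))" for m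
  proof -
    have "(LINT u|lborel. norm (f m u)) \<le> (LINT u|lborel. indicator (cball (0::complex) R) u * (B * R ^ l * (norm (a m) * R ^ m)))"
    proof (rule Bochner_Integration.integral_mono)
      show "integrable lborel (\<lambda>u. indicator (cball 0 R) u * (B * R ^ l * (norm (a m) * R ^ m)) :: real)"
        by (intro integrable_mult_left) (auto intro!: integrable_real_indicator emeasure_bounded_finite simp: less_top[symmetric])
      show "norm (f m u) \<le> indicator (cball 0 R) u * (B * R ^ l * (norm (a m) * R ^ m))" for u
        using fb[of m u] by (auto simp: indicator_def f_def R)
    qed (use fi in auto)
    also have "\<dots> = V * (B * R ^ l * (norm (a m) * R ^ m))" by (simp add: V_def)
    finally show ?thesis .
  qed
  have s2: "summable (\<lambda>m. LINT u|lborel. norm (f m u))"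
    by (rule summable_comparison_test'[OF summable_mult[OF summable_mult[OF sR, of "B * R ^ l"], of V]])
       (use nb in auto)
  have eq: "(\<lambda>u. of_real (r (norm u)) * cnj u ^ l * \<phi> u) = (\<lambda>u. \<Sum>m. f m u)"
    using fs by (auto simp: sums_iff)
  show "integrable lborel (\<lambda>u. of_real (r (norm u)) * cnj u ^ l * \<phi> u)"
    unfolding eq by (rule integrable_suminf[OF fi _ s2]) (use s1 in auto)
  have "(LINT u|lborel. of_real (r (norm u)) * cnj u ^ l * \<phi> u) = (\<Sum>m. LINT u|lborel. f m u)"
    unfolding eq by (rule integral_suminf[OF fi _ s2]) (use s1 in auto)
  also have "\<dots> = (\<Sum>m\<in>{l}. LINT u|lborel. f m u)"
  proof (rule suminf_finite)
    fix m assume "m \<notin> {l}"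
    then have "(LINT u|lborel. a m * (of_real (r (norm u)) * cnj u ^ l * u ^ m)) = 0"
      using radial_moment_zero[of l m r] by simp
    then show "(LINT u|lborel. f m u) = 0" by (simp add: f_def[abs_def] mult_ac)
  qed simp
  also have "\<dots> = (LINT u|lborel. a l * of_real (r (norm (u::complex)) * norm u ^ (2 * l)))"
  proof -
    have "cnj u ^ l * u ^ l = of_real (norm u ^ (2 * l))" for u
    proof -
      have "cnj u * u = of_real ((norm u)\<^sup>2)" by (metis complex_norm_square mult.commute of_real_power)
      then show ?thesis by (metis power_mult power_mult_distrib of_real_power)
    qed
    then have "f l u = a l * of_real (r (norm u) * norm u ^ (2 * l))" for u
      by (simp add: f_def mult_ac)
    then show ?thesis by simp
  qed
  also have "\<dots> = a l * of_real (LINT u|lborel. r (norm (u::complex)) * norm u ^ (2 * l))"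
    by (subst integral_mult_right_zero, subst integral_complex_of_real) simp
  finally show "(LINT u|lborel. of_real (r (norm u)) * cnj u ^ l * \<phi> u)
       = (deriv ^^ l) \<phi> 0 / fact l * of_real (LINT u|lborel. r (norm (u::complex)) * norm u ^ (2 * l))"
    by (simp add: a_def)
qed

text \<open>A radial kernel that reproduces the value at the origin of polyanalytic functions of order \<open>n\<close>
  is obtained by Richardson extrapolation from the normalised indicator of a disc.\<close>

lemma reproducing_radial_kernel:
  assumes "\<delta> > 0"
  shows "\<exists>r B. r \<in> borel_measurable borel \<and> (\<forall>x. \<bar>r x\<bar> \<le> (B::real)) \<and> (\<forall>x>\<delta>. r x = 0) \<and>
    (\<forall>l<n. (LINT u|lborel. r (norm (u::complex)) * norm u ^ (2 * l)) = (if l = 0 then 1 else 0))"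
proof (induction n)
  case 0
  show ?case by (intro exI[of _ "\<lambda>_. 0"] exI[of _ 0]) auto
next
  case (Suc n)
  show ?case
  proof (cases "n = 0")
    case True
    define V where "V = measure lborel (cball (0::complex) \<delta>)"
    have "V > 0" unfolding V_def using assms
      by (metis content_cball_pos)
    have "(LINT u|lborel. (if norm (u::complex) \<le> \<delta> then 1 / V else 0)) = (LINT u|lborel. indicator (cball (0::complex) \<delta>) u * (1 / V))"
      by (intro Bochner_Integration.integral_cong) (auto simp: indicator_def)
    also have "\<dots> = 1" using \<open>V > 0\<close> by (simp add: V_def[symmetric])
    finally show ?thesis using True \<open>V > 0\<close>
      by (intro exI[of _ "\<lambda>x. if x \<le> \<delta> then 1 / V else 0"] exI[of _ "1 / V"]) auto
  next
    case False
    from Suc obtain r B where rm[measurable]: "r \<in> borel_measurable borel" and B: "\<forall>x. \<bar>r x\<bar> \<le> B"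
      and z: "\<forall>x>\<delta>. r x = 0"
      and o: "\<And>l. l < n \<Longrightarrow> (LINT u|lborel. r (norm (u::complex)) * norm u ^ (2 * l)) = (if l = 0 then 1 else 0)"
      by blast
    \<comment> \<open>The kernel 4 * r (2 * x) has the moments of \<open>r\<close> divided by 4 ^ l.
      Weighting it by 4 ^ n against \<open>r\<close> and dividing by K - 1 cancels the moment l = n,
      keeps mass one and leaves the vanishing moments at zero. For n = 0 this would divide by zero,
      which is why the recursion starts from the disc.\<close>
    define K :: real where "K = 4 ^ n"
    have K: "K > 1" using False by (simp add: K_def)
    define r' where "r' x = (K * (4 * r (2 * x)) - r x) / (K - 1)" for x
    define I where "I l = (LINT u|lborel. r (norm (u::complex)) * norm u ^ (2 * l))" for l
    have int: "integrable lborel (\<lambda>u. r (norm (u::complex)) * norm u ^ (2 * l))" for l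
    proof (rule integrable_ball_bounded[where R=\<delta> and B="B * \<delta> ^ (2*l)"])
      show "norm (r (norm u) * norm u ^ (2 * l)) \<le> B * \<delta> ^ (2*l)" if "norm (u::complex) \<le> \<delta>" for u
        using that B assms by (auto simp: abs_mult intro!: mult_mono power_mono order_trans[OF abs_ge_zero B[rule_format, of 0]])
    qed (use z in auto)
    have int2: "integrable lborel (\<lambda>u. r (norm (2 * u::complex)) * norm u ^ (2 * l))" for l
    proof (rule integrable_ball_bounded[where R=\<delta> and B="B * \<delta> ^ (2*l)"])
      show "norm (r (norm (2*u)) * norm u ^ (2 * l)) \<le> B * \<delta> ^ (2*l)" if "norm (u::complex) \<le> \<delta>" for u
        using that B assms by (auto simp: abs_mult intro!: mult_mono power_mono order_trans[OF abs_ge_zero B[rule_format, of 0]])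
    qed (use z assms in \<open>auto simp: norm_mult\<close>)
    have I2: "(LINT u|lborel. r (norm (2 * u::complex)) * norm u ^ (2 * l)) = I l / (4 * 4 ^ l)" for l
    proof -
      have "I l = (LINT u|density (distr lborel borel (\<lambda>x. 0 + 2 *\<^sub>R x)) (\<lambda>_. ennreal (\<bar>2\<bar>^DIM(complex))). r (norm (u::complex)) * norm u ^ (2 * l))"
        using lborel_affine[of 2 "0::complex"] by (simp add: I_def)
      also have "\<dots> = 4 * (LINT u|lborel. r (norm (2 * u::complex)) * norm (2 * u) ^ (2 * l))"
        by (subst integral_density) (auto simp: integral_distr scaleR_conv_of_real)
      also have "(\<lambda>u. r (norm (2 * u::complex)) * norm (2 * u) ^ (2 * l)) = (\<lambda>u. 4 ^ l * (r (norm (2 * u::complex)) * norm u ^ (2 * l)))"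
        by (auto simp: norm_mult power_mult_distrib power_mult)
      finally show ?thesis by simp
    qed
    have "(LINT u|lborel. r' (norm (u::complex)) * norm u ^ (2 * l)) = (if l = 0 then 1 else 0)" if "l < Suc n" for l
    proof -
      have "(LINT u|lborel. r' (norm (u::complex)) * norm u ^ (2 * l)) =
        (LINT u|lborel. (4 * K / (K - 1)) * (r (norm (2 * u::complex)) * norm u ^ (2 * l)) - 1 / (K - 1) * (r (norm (u::complex)) * norm u ^ (2 * l)))"
        using K by (intro Bochner_Integration.integral_cong refl) (simp add: r'_def norm_mult divide_simps, simp add: algebra_simps)
      also have "\<dots> = (4 * K / (K - 1)) * (I l / (4 * 4 ^ l)) - 1 / (K - 1) * I l"
        
        using int int2 I2 by (simp add: I_def)
      also have "\<dots> = I l * (K / 4 ^ l - 1) / (K - 1)" using K by (simp add: divide_simps) (simp add: algebra_simps)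
      also have "\<dots> = (if l = 0 then 1 else 0)"
      proof (cases "l = n")
        case True
        then show ?thesis using False by (simp add: K_def)
      next
        case ne: False
        then have "l < n" using that by simp
        then show ?thesis using o K by (auto simp: I_def)
      qed
      finally show ?thesis .
    qed
    moreover have "r' \<in> borel_measurable borel" unfolding r'_def[abs_def] by measurable
    moreover have "\<bar>r' x\<bar> \<le> (K * (4 * B) + B) / (K - 1)" for x
    proof -
      have "\<bar>K * (4 * r (2 * x)) - r x\<bar> \<le> K * (4 * \<bar>r (2 * x)\<bar>) + \<bar>r x\<bar>"
        using K by (auto simp: abs_mult intro!: order_trans[OF abs_triangle_ineq4])
      also have "\<dots> \<le> K * (4 * B) + B" using B K by (intro add_mono mult_left_mono) auto
      finally show ?thesis using K by (simp add: r'_def divide_right_mono)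
    qed
    moreover have "r' x = 0" if "x > \<delta>" for x using that z assms by (simp add: r'_def)
    ultimately show ?thesis by blast
  qed
qed

subsection \<open>Polyanalytic functions\<close>

text \<open>The coefficients are an explicit argument because the proof follows the top one,
  \<open>\<phi> (n - 1)\<close>, through translations and subtractions.\<close>

definition polyrep :: "nat \<Rightarrow> (nat \<Rightarrow> complex \<Rightarrow> complex) \<Rightarrow> (complex \<Rightarrow> complex) \<Rightarrow> bool" where
  "polyrep n \<phi> F \<longleftrightarrow> (\<forall>k<n. \<phi> k holomorphic_on UNIV) \<and> (\<forall>z. F z = (\<Sum>k<n. cnj z ^ k * \<phi> k z))"

definition fmod :: "(complex \<Rightarrow> complex) \<Rightarrow> complex \<Rightarrow> real" where
  "fmod F z = norm (F z) * exp (- pi * (norm z)\<^sup>2 / 2)"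

text \<open>The Weyl translation of Bargmann-Fock space. The exponential compensates the change of
  the Gaussian weight, so weighted moduli are merely translated; being holomorphic in z, it respects
  the polyanalytic order.\<close>

definition fshift :: "complex \<Rightarrow> (complex \<Rightarrow> complex) \<Rightarrow> complex \<Rightarrow> complex" where
  "fshift a F z = exp (- of_real pi * cnj a * z - of_real (pi * (norm a)\<^sup>2 / 2)) * F (z + a)"

lemma polyFock_iff: "F \<in> polyFock n \<longleftrightarrow> (\<exists>\<phi>. polyrep n \<phi> F) \<and> fock_norm2 F < \<infinity>"
  by (auto simp: polyFock_def polyrep_def)

lemma fmod_nonneg [simp]: "fmod F z \<ge> 0"
  by (simp add: fmod_def)

lemma fmod_sq: "(norm (F z))\<^sup>2 * exp (- pi * (norm z)\<^sup>2) = (fmod F z)\<^sup>2"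
  by (simp add: fmod_def power_mult_distrib exp_double[symmetric])

lemma fock_norm2_fmod: "fock_norm2 F = (\<integral>\<^sup>+z. ennreal ((fmod F z)\<^sup>2) \<partial>lborel)"
  unfolding fock_norm2_def fmod_sq ..

lemma norm_add_sq_complex: "(norm (z + a))\<^sup>2 = (norm z)\<^sup>2 + (norm a)\<^sup>2 + 2 * Re (cnj a * z)"
  by (simp add: cmod_power2) (simp add: power2_eq_square algebra_simps)

lemma fmod_fshift: "fmod (fshift a F) z = fmod F (z + a)"
proof -
  have "fmod (fshift a F) z = norm (F (z + a)) * (exp (- pi * Re (cnj a * z) - pi * (norm a)\<^sup>2 / 2) * exp (- pi * (norm z)\<^sup>2 / 2))"
    by (simp add: fmod_def fshift_def norm_mult mult_ac algebra_simps)
  also have "exp (- pi * Re (cnj a * z) - pi * (norm a)\<^sup>2 / 2) * exp (- pi * (norm z)\<^sup>2 / 2) = exp (- pi * (norm (z + a))\<^sup>2 / 2)"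
    unfolding norm_add_sq_complex mult_exp_exp by (simp add: field_simps)
  finally show ?thesis by (simp add: fmod_def)
qed

lemma polyrep_continuous:
  assumes "polyrep n \<phi> F" shows "continuous_on UNIV F"
proof -
  have "F = (\<lambda>z. \<Sum>k<n. cnj z ^ k * \<phi> k z)" using assms by (auto simp: polyrep_def)
  moreover have "continuous_on UNIV (\<phi> k)" if "k < n" for k
    using assms that by (auto simp: polyrep_def intro: holomorphic_on_imp_continuous_on)
  ultimately show ?thesis by (auto intro!: continuous_intros)
qed

lemma continuous_fmod:
  assumes "continuous_on UNIV F" shows "continuous_on UNIV (fmod F)"
  unfolding fmod_def using assms by (auto intro!: continuous_intros)

lemma measurable_cball [measurable]: "cball (z::'a::metric_space) r \<in> sets borel"
  by simp

lemma borel_measurable_fmod [measurable]: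
  "F \<in> borel_measurable borel \<Longrightarrow> fmod F \<in> borel_measurable borel"
  unfolding fmod_def[abs_def]
  by (intro borel_measurable_times borel_measurable_norm borel_measurable_continuous_onI[of "\<lambda>z. exp (_ z)"]) (auto intro!: continuous_intros)

text \<open>Expanding (cnj z + cnj a) ^ k binomially feeds a coefficient only into equal or lower
  powers of cnj z. Nothing is added to the top coefficient, which therefore transforms on its
  own.\<close>

lemma polyrep_fshift:
  assumes F: "polyrep n \<phi> F"
  shows "\<exists>\<psi>. polyrep n \<psi> (fshift a F) \<and> (n > 0 \<longrightarrow> \<psi> (n - 1) = fshift a (\<phi> (n - 1)))"
proof -
  define e where "e z = exp (- of_real pi * cnj a * z - of_real (pi * (norm a)\<^sup>2 / 2))" for z
  define \<psi> where "\<psi> j z = e z * (\<Sum>k\<in>{j..<n}. of_nat (k choose j) * cnj a ^ (k - j) * \<phi> k (z + a))" for j z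
  have hol: "(\<lambda>z. \<phi> k (z + a)) holomorphic_on UNIV" if "k < n" for k
  proof -
    have "\<phi> k holomorphic_on UNIV" using F that by (simp add: polyrep_def)
    then have "(\<phi> k \<circ> (\<lambda>z. z + a)) holomorphic_on UNIV"
      by (intro holomorphic_on_compose_gen[where t=UNIV]) (auto intro!: holomorphic_intros)
    then show ?thesis by (simp add: o_def)
  qed
  have "\<psi> j holomorphic_on UNIV" for j
    unfolding \<psi>_def[abs_def] e_def using hol by (auto intro!: holomorphic_intros)
  moreover have "fshift a F z = (\<Sum>j<n. cnj z ^ j * \<psi> j z)" for z
  proof -
    have "fshift a F z = e z * (\<Sum>k<n. (cnj z + cnj a) ^ k * \<phi> k (z + a))"
      using F by (simp add: fshift_def e_def polyrep_def)
    also have "(\<Sum>k<n. (cnj z + cnj a) ^ k * \<phi> k (z + a)) =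
       (\<Sum>k<n. \<Sum>j\<le>k. cnj z ^ j * (of_nat (k choose j) * cnj a ^ (k - j) * \<phi> k (z + a)))"
      by (simp add: binomial_ring sum_distrib_right sum_distrib_left mult_ac)
    also have "\<dots> = (\<Sum>k\<in>{0..<n}. \<Sum>j\<in>{0..k}. cnj z ^ j * (of_nat (k choose j) * cnj a ^ (k - j) * \<phi> k (z + a)))"
      by (simp add: atLeast0LessThan atLeast0AtMost)
    also have "\<dots> = (\<Sum>j\<in>{0..<n}. \<Sum>k\<in>{j..<n}. cnj z ^ j * (of_nat (k choose j) * cnj a ^ (k - j) * \<phi> k (z + a)))"
      by (subst (1 2) sum.Sigma) (auto intro!: sum.reindex_bij_witness[where i="\<lambda>(x,y). (y,x)" and j="\<lambda>(x,y). (y,x)"])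
    finally show ?thesis
      by (simp add: \<psi>_def sum_distrib_left atLeast0LessThan mult_ac)
  qed
  moreover have "\<psi> (n - 1) = fshift a (\<phi> (n - 1))" if "n > 0"
  proof -
    have "{n - Suc 0..<n} = {n - 1}" using that by auto
    then show ?thesis by (auto simp: \<psi>_def fshift_def e_def)
  qed
  ultimately have "polyrep n \<psi> (fshift a F) \<and> (n > 0 \<longrightarrow> \<psi> (n - 1) = fshift a (\<phi> (n - 1)))"
    unfolding polyrep_def by blast
  then show ?thesis by (rule exI[of _ \<psi>])
qed

text \<open>Unlike for holomorphic functions, the mean value over a disc has to be replaced by
  the average against a kernel annihilating \<open>\<bar>z\<bar>\<^sup>2, \<dots>, \<bar>z\<bar>\<^sup>2\<^sup>n\<^sup>-\<^sup>2\<close>.\<close>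

lemma polyrep_local_estimate:
  assumes "\<delta> > 0"
  shows "\<exists>C>0. \<forall>F \<phi> z. polyrep n \<phi> F \<longrightarrow>
    ennreal ((fmod F z)\<^sup>2) \<le> ennreal C * (\<integral>\<^sup>+w. ennreal ((fmod F w)\<^sup>2) * indicator (cball z \<delta>) w \<partial>lborel)"
proof -
  obtain r B where rm[measurable]: "r \<in> borel_measurable borel" and B: "\<And>x. \<bar>r x\<bar> \<le> (B::real)"
    and z: "\<And>x. x > \<delta> \<Longrightarrow> r x = 0"
    and o: "\<And>l. l < n \<Longrightarrow> (LINT u|lborel. r (norm (u::complex)) * norm u ^ (2 * l)) = (if l = 0 then 1 else 0)"
    using reproducing_radial_kernel[OF assms, of n] by blast
  define V where "V = measure lborel (cball (0::complex) \<delta>)"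
  have V: "emeasure lborel (cball (0::complex) \<delta>) = ennreal V"
    unfolding V_def by (intro emeasure_eq_ennreal_measure) (use emeasure_bounded_finite[of "cball (0::complex) \<delta>"] in auto)
  have V0: "V \<ge> 0" by (simp add: V_def)
  have B0: "B \<ge> 0" using B[of 0] by linarith
  define C where "C = B\<^sup>2 * V * exp (pi * \<delta>\<^sup>2) + 1"
  have C: "C > 0" using V0 by (auto simp: C_def intro!: add_nonneg_pos mult_nonneg_nonneg)
  \<comment> \<open>By covariance under \<open>fshift\<close> it is enough to estimate at the
    origin.\<close>
  have main: "ennreal ((fmod F 0)\<^sup>2) \<le> ennreal C * (\<integral>\<^sup>+w. ennreal ((fmod F w)\<^sup>2) * indicator (cball 0 \<delta>) w \<partial>lborel)"
    if F: "polyrep n \<phi> F" for F \<phi>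
  proof -
    have Fm[measurable]: "F \<in> borel_measurable borel"
      using polyrep_continuous[OF F] by (rule borel_measurable_continuous_onI)
    have hol: "\<phi> k holomorphic_on UNIV" if "k < n" for k using F that by (simp add: polyrep_def)
    have Fz: "F z = (\<Sum>k<n. cnj z ^ k * \<phi> k z)" for z using F by (simp add: polyrep_def)
    note ri = radial_integral[OF rm B z assms hol]
    have "(LINT u|lborel. of_real (r (norm u)) * F u) = (LINT u|lborel. (\<Sum>k<n. of_real (r (norm u)) * cnj u ^ k * \<phi> k u))"
      by (simp add: Fz sum_distrib_left mult.assoc)
    also have "\<dots> = (\<Sum>k<n. LINT u|lborel. of_real (r (norm u)) * cnj u ^ k * \<phi> k u)"
      by (rule Bochner_Integration.integral_sum) (use ri(1) in auto)
    also have "\<dots> = (\<Sum>k<n. (deriv ^^ k) (\<phi> k) 0 / fact k * of_real (if k = 0 then 1 else 0))"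
      by (intro sum.cong refl) (use ri(2) o in auto)
    also have "\<dots> = F 0"
      by (simp add: Fz power_0_left if_distrib[of "\<lambda>x. x * _"] if_distrib[of complex_of_real] if_distrib[of "\<lambda>x. _ * x"] sum.delta cong: if_cong)
    finally have rep: "(LINT u|lborel. of_real (r (norm u)) * F u) = F 0" .
    have "ennreal (fmod F 0) = ennreal (norm (LINT u|lborel. of_real (r (norm u)) * F u))"
      by (simp add: rep fmod_def)
    also have "\<dots> \<le> (\<integral>\<^sup>+u. ennreal (norm (of_real (r (norm u)) * F u)) \<partial>lborel)"
    proof (rule integral_norm_bound_ennreal)
      show "integrable lborel (\<lambda>u. of_real (r (norm u)) * F u)"
        unfolding Fz sum_distrib_left mult.assoc[symmetric] by (rule Bochner_Integration.integrable_sum) (use ri(1) in auto)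
    qed
    \<comment> \<open>The indicator of the disc is written twice so that Cauchy-Schwarz can split
      off one copy while the other factor stays supported in the disc.\<close>
    also have "\<dots> \<le> (\<integral>\<^sup>+u. (ennreal B * (ennreal (norm (F u)) * indicator (cball 0 \<delta>) u)) * indicator (cball 0 \<delta>) u \<partial>lborel)"
    proof (rule nn_integral_mono)
      fix u :: complex
      show "ennreal (norm (of_real (r (norm u)) * F u)) \<le> (ennreal B * (ennreal (norm (F u)) * indicator (cball 0 \<delta>) u)) * indicator (cball 0 \<delta>) u"
        using B[of "norm u"] z[of "norm u"] B0
        by (auto simp: indicator_def norm_mult ennreal_mult[symmetric] intro!: ennreal_leI mult_right_mono)
    qed
    finally have 1: "ennreal (fmod F 0) \<le> \<dots>" .
    have "ennreal ((fmod F 0)\<^sup>2) = (ennreal (fmod F 0))\<^sup>2" by (simp add: ennreal_power)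
    also have "\<dots> \<le> (\<integral>\<^sup>+u. (ennreal B * (ennreal (norm (F u)) * indicator (cball 0 \<delta>) u)) * indicator (cball 0 \<delta>) u \<partial>lborel)\<^sup>2"
      using 1 by (rule power_mono) simp
    also have "\<dots> \<le> (\<integral>\<^sup>+u. (ennreal B * (ennreal (norm (F u)) * indicator (cball 0 \<delta>) u))\<^sup>2 \<partial>lborel) * (\<integral>\<^sup>+u. (indicator (cball (0::complex) \<delta>) u)\<^sup>2 \<partial>lborel)"
      by (rule Cauchy_Schwarz_nn_integral) measurable
    also have "(\<integral>\<^sup>+u. (indicator (cball (0::complex) \<delta>) u)\<^sup>2 \<partial>lborel) = ennreal V"
    proof -
      have "(\<lambda>u. (indicator (cball (0::complex) \<delta>) u)\<^sup>2 :: ennreal) = indicator (cball (0::complex) \<delta>)"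
        by (auto simp: indicator_def)
      then show ?thesis by (simp add: V)
    qed
    also have "(\<integral>\<^sup>+u. (ennreal B * (ennreal (norm (F u)) * indicator (cball 0 \<delta>) u))\<^sup>2 \<partial>lborel)
        \<le> (\<integral>\<^sup>+u. ennreal (B\<^sup>2 * exp (pi * \<delta>\<^sup>2)) * (ennreal ((fmod F u)\<^sup>2) * indicator (cball 0 \<delta>) u) \<partial>lborel)"
    proof (rule nn_integral_mono)
      fix u :: complex
      show "(ennreal B * (ennreal (norm (F u)) * indicator (cball 0 \<delta>) u))\<^sup>2
        \<le> ennreal (B\<^sup>2 * exp (pi * \<delta>\<^sup>2)) * (ennreal ((fmod F u)\<^sup>2) * indicator (cball 0 \<delta>) u)"
      proof (cases "norm u \<le> \<delta>")
        case True
        have "exp (pi * (norm u)\<^sup>2) \<le> exp (pi * \<delta>\<^sup>2)"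
          using True by (auto intro!: power_mono)
        then have "(norm (F u))\<^sup>2 * exp (- pi * (norm u)\<^sup>2) * exp (pi * (norm u)\<^sup>2) \<le> (norm (F u))\<^sup>2 * exp (- pi * (norm u)\<^sup>2) * exp (pi * \<delta>\<^sup>2)"
          by (intro mult_left_mono) auto
        then have "(norm (F u))\<^sup>2 \<le> exp (pi * \<delta>\<^sup>2) * (fmod F u)\<^sup>2"
          by (simp add: fmod_sq[symmetric] exp_minus field_simps)
        then have "(B * norm (F u))\<^sup>2 \<le> B\<^sup>2 * exp (pi * \<delta>\<^sup>2) * (fmod F u)\<^sup>2"
          by (simp add: power_mult_distrib mult_left_mono mult.assoc)
        then show ?thesis using True B0
          by (simp add: ennreal_mult[symmetric] ennreal_power ennreal_leI)
      qed auto
    qed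
    also have "\<dots> = ennreal (B\<^sup>2 * exp (pi * \<delta>\<^sup>2)) * (\<integral>\<^sup>+w. ennreal ((fmod F w)\<^sup>2) * indicator (cball 0 \<delta>) w \<partial>lborel)"
      by (rule nn_integral_cmult) measurable
    finally have "ennreal ((fmod F 0)\<^sup>2) \<le> ennreal (B\<^sup>2 * exp (pi * \<delta>\<^sup>2)) * (\<integral>\<^sup>+w. ennreal ((fmod F w)\<^sup>2) * indicator (cball 0 \<delta>) w \<partial>lborel) * ennreal V"
      by (simp add: mult_right_mono)
    also have "\<dots> = ennreal (B\<^sup>2 * V * exp (pi * \<delta>\<^sup>2)) * (\<integral>\<^sup>+w. ennreal ((fmod F w)\<^sup>2) * indicator (cball 0 \<delta>) w \<partial>lborel)"
      using V0 by (simp add: ennreal_mult mult_ac)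
    also have "\<dots> \<le> ennreal C * (\<integral>\<^sup>+w. ennreal ((fmod F w)\<^sup>2) * indicator (cball 0 \<delta>) w \<partial>lborel)"
      by (intro mult_right_mono ennreal_leI) (auto simp: C_def)
    finally show ?thesis .
  qed
  have "ennreal ((fmod F z)\<^sup>2) \<le> ennreal C * (\<integral>\<^sup>+w. ennreal ((fmod F w)\<^sup>2) * indicator (cball z \<delta>) w \<partial>lborel)"
    if F: "polyrep n \<phi> F" for F \<phi> z
  proof -
    have Fm[measurable]: "F \<in> borel_measurable borel"
      using polyrep_continuous[OF F] by (rule borel_measurable_continuous_onI)
    obtain \<psi> where "polyrep n \<psi> (fshift z F)" using polyrep_fshift[OF F] by blast
    from main[OF this] have "ennreal ((fmod F z)\<^sup>2) \<le> ennreal C * (\<integral>\<^sup>+w. ennreal ((fmod F (w + z))\<^sup>2) * indicator (cball 0 \<delta>) w \<partial>lborel)"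
      by (simp add: fmod_fshift)
    also have "(\<integral>\<^sup>+w. ennreal ((fmod F (w + z))\<^sup>2) * indicator (cball 0 \<delta>) w \<partial>lborel)
      = (\<integral>\<^sup>+w. ennreal ((fmod F (w + z))\<^sup>2) * indicator (cball z \<delta>) (w + z) \<partial>lborel)"
      by (intro nn_integral_cong) (auto simp: indicator_def dist_norm norm_minus_commute)
    also have "\<dots> = (\<integral>\<^sup>+w. ennreal ((fmod F w)\<^sup>2) * indicator (cball z \<delta>) w \<partial>lborel)"
      by (rule nn_integral_translate) measurable
    finally show ?thesis .
  qed
  with C show ?thesis by blast
qed

subsection \<open>Lattices and the Bessel inequality\<close>

text \<open>Turns the unordered sums in the definition of sampling into integrals against counting
  measure, where Tonelli and Cauchy-Schwarz apply. One inequality compares finite partial sums, the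
  other enumerates an infinite set.\<close>

lemma infsum_ennreal_eq_nn_integral:
  fixes f :: "'a \<Rightarrow> ennreal"
  assumes "countable A"
  shows "infsum f A = (\<integral>\<^sup>+x. f x \<partial>count_space A)"
proof -
  have inf: "infsum f A = (SUP F\<in>{F. finite F \<and> F \<subseteq> A}. sum f F)"
    by (rule nonneg_infsum_complete) simp
  have fin: "sum f F = (\<integral>\<^sup>+x. f x \<partial>count_space F)" if "finite F" for F
    using that by (simp add: nn_integral_count_space_finite)
  have "sum f F \<le> (\<integral>\<^sup>+x. f x \<partial>count_space A)" if "finite F" "F \<subseteq> A" for F
  proof -
    have "sum f F = (\<integral>\<^sup>+x. f x * indicator F x \<partial>count_space A)"
      using that by (subst fin) (auto simp: nn_integral_count_space_indicator mult.assoc intro!: nn_integral_cong split: split_indicator)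
    also have "\<dots> \<le> (\<integral>\<^sup>+x. f x \<partial>count_space A)" by (intro nn_integral_mono) (auto split: split_indicator)
    finally show ?thesis .
  qed
  then have 1: "infsum f A \<le> (\<integral>\<^sup>+x. f x \<partial>count_space A)"
    unfolding inf by (auto intro!: SUP_least)
  have 2: "(\<integral>\<^sup>+x. f x \<partial>count_space A) \<le> infsum f A"
  proof (cases "finite A")
    case True
    then show ?thesis using fin[OF True] by simp
  next
    case False
    then obtain e :: "nat \<Rightarrow> 'a" where e: "bij_betw e UNIV A"
      using assms by (metis countableE_infinite bij_betw_inv_into)
    have "(\<integral>\<^sup>+x. f x \<partial>count_space A) = (\<integral>\<^sup>+k. f (e k) \<partial>count_space UNIV)"
      by (rule nn_integral_bij_count_space[OF e, symmetric])
    also have "\<dots> = (SUP N. \<Sum>k<N. f (e k))"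
      by (simp add: nn_integral_count_space_nat suminf_eq_SUP)
    also have "\<dots> \<le> infsum f A"
    proof (rule SUP_least)
      fix N
      have "(\<Sum>k<N. f (e k)) = sum f (e ` {..<N})"
        using e by (subst sum.reindex) (auto simp: bij_betw_def inj_on_def)
      also have "\<dots> \<le> infsum f A"
        unfolding inf using e by (intro SUP_upper) (auto simp: bij_betw_def)
      finally show "(\<Sum>k<N. f (e k)) \<le> infsum f A" .
    qed
    finally show ?thesis .
  qed
  from 1 2 show ?thesis by (rule antisym)
qed

definition lat :: "complex \<Rightarrow> complex \<Rightarrow> complex set" where
  "lat a b = {of_int p * a + of_int q * b | p q. True}"

lemma lat_countable: "countable (lat a b)"
proof -
  have "lat a b = (\<lambda>(p, q). of_int p * a + of_int q * b) ` UNIV" by (auto simp: lat_def)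
  then show ?thesis by simp
qed

lemma latI: "of_int p * a + of_int q * b \<in> lat a b"
  by (auto simp: lat_def)

lemma latE:
  assumes "z \<in> lat a b" obtains p q :: int where "z = of_int p * a + of_int q * b"
  using assms by (auto simp: lat_def)

lemma lat_0 [simp]: "0 \<in> lat a b" and lat_gen [simp]: "a \<in> lat a b" "b \<in> lat a b"
  using latI[of 0 a 0 b] latI[of 1 a 0 b] latI[of 0 a 1 b] by simp_all

lemma lat_add: "x \<in> lat a b \<Longrightarrow> y \<in> lat a b \<Longrightarrow> x + y \<in> lat a b"
proof (elim latE)
  fix p q p' q' :: int assume "x = of_int p * a + of_int q * b" "y = of_int p' * a + of_int q' * b"
  then show ?thesis using latI[of "p + p'" a "q + q'" b] by (simp add: algebra_simps)
qed

lemma lat_uminus: "x \<in> lat a b \<Longrightarrow> - x \<in> lat a b"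
proof (elim latE)
  fix p q :: int assume "x = of_int p * a + of_int q * b"
  then show ?thesis using latI[of "-p" a "-q" b] by (simp add: algebra_simps)
qed

lemma lat_diff: "x \<in> lat a b \<Longrightarrow> y \<in> lat a b \<Longrightarrow> x - y \<in> lat a b"
  using lat_add[of x a b "- y"] lat_uminus[of y a b] by simp

text \<open>Multiplying by cnj a or cnj b and taking the imaginary part isolates one real
  coordinate, since cnj a * a and cnj b * b are real.\<close>

lemma coords_bound:
  fixes s t :: real
  shows "(norm a + norm b) * norm (of_real s * a + of_real t * b) \<ge> \<bar>Im (cnj a * b)\<bar> * (\<bar>s\<bar> + \<bar>t\<bar>)"
proof -
  let ?z = "of_real s * a + of_real t * b"
  have "Im (cnj a * ?z) = t * Im (cnj a * b)" by (simp add: algebra_simps)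
  then have "\<bar>t\<bar> * \<bar>Im (cnj a * b)\<bar> \<le> norm a * norm ?z"
    using abs_Im_le_cmod[of "cnj a * ?z"] by (simp add: norm_mult abs_mult)
  moreover have "Im (cnj b * ?z) = - s * Im (cnj a * b)" by (simp add: algebra_simps)
  then have "\<bar>s\<bar> * \<bar>Im (cnj a * b)\<bar> \<le> norm b * norm ?z"
    using abs_Im_le_cmod[of "cnj b * ?z"] by (simp add: norm_mult abs_mult)
  ultimately show ?thesis by (simp add: algebra_simps)
qed

lemma lat_separated:
  assumes "Im (cnj a * b) \<noteq> 0"
  shows "\<exists>\<delta>>0. \<forall>x\<in>lat a b. \<forall>y\<in>lat a b. x \<noteq> y \<longrightarrow> dist x y > 2 * \<delta>"
proof (intro exI conjI ballI impI)
  define D where "D = \<bar>Im (cnj a * b)\<bar>"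
  define N where "N = norm a + norm b"
  have D: "D > 0" using assms by (simp add: D_def)
  have "a \<noteq> 0" using assms by auto
  then have N: "N > 0" by (simp add: N_def add_pos_nonneg)
  \<comment> \<open>The factor 3 leaves room for a strict inequality, which makes the closed balls
    of radius \<delta> around lattice points disjoint.\<close>
  show "D / (3 * N) > 0" using D N by simp
  fix x y assume "x \<in> lat a b" "y \<in> lat a b" and ne: "x \<noteq> y"
  then obtain p q :: int where pq: "x - y = of_int p * a + of_int q * b" using lat_diff by (metis latE)
  with ne have "p \<noteq> 0 \<or> q \<noteq> 0" by auto
  then have "1 \<le> \<bar>real_of_int p\<bar> + \<bar>real_of_int q\<bar>" by linarith
  then have "D \<le> D * (\<bar>real_of_int p\<bar> + \<bar>real_of_int q\<bar>)" using D by simp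
  also have "\<dots> \<le> N * norm (x - y)"
    using coords_bound[of a b "real_of_int p" "real_of_int q"] by (simp add: pq D_def N_def)
  finally show "dist x y > 2 * (D / (3 * N))" using D N by (simp add: dist_norm field_simps)
qed

text \<open>The balls are disjoint, so after exchanging sum and integral every point is counted at
  most once.\<close>

lemma separated_balls_nn_integral_le:
  assumes S: "countable S" and sep: "\<And>x y. x \<in> S \<Longrightarrow> y \<in> S \<Longrightarrow> x \<noteq> y \<Longrightarrow> dist x y > 2 * \<delta>"
    and [measurable]: "H \<in> borel_measurable borel"
  shows "(\<integral>\<^sup>+x. (\<integral>\<^sup>+w. H w * indicator (cball x \<delta>) w \<partial>lborel) \<partial>count_space S) \<le> (\<integral>\<^sup>+w. H w \<partial>(lborel :: 'a::euclidean_space measure))"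
proof -
  have "(\<integral>\<^sup>+x. (\<integral>\<^sup>+w. H w * indicator (cball x \<delta>) w \<partial>lborel) \<partial>count_space S) =
    (\<integral>\<^sup>+w. (\<integral>\<^sup>+x. H w * indicator (cball x \<delta>) w \<partial>count_space S) \<partial>lborel)"
    by (rule nn_integral_count_space_nn_integral[symmetric]) (use S in auto)
  also have "\<dots> \<le> (\<integral>\<^sup>+w. H w \<partial>lborel)"
  proof (rule nn_integral_mono)
    fix w
    have "(\<integral>\<^sup>+x. H w * indicator (cball x \<delta>) w \<partial>count_space S) = H w * (\<integral>\<^sup>+x. indicator (cball x \<delta>) w \<partial>count_space S)"
      by (rule nn_integral_cmult) simp
    also have "(\<integral>\<^sup>+x. indicator (cball x \<delta>) w \<partial>count_space S) \<le> (1::ennreal)"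
    proof (cases "\<exists>x\<in>S. w \<in> cball x \<delta>")
      case True
      then obtain x where x: "x \<in> S" "dist x w \<le> \<delta>" by auto
      have "y = x" if "y \<in> S" "dist y w \<le> \<delta>" for y
        using sep[of x y] x that dist_triangle2[of x y w] by (smt (verit))
      then have "(\<integral>\<^sup>+y. indicator (cball y \<delta>) w \<partial>count_space S) \<le> (\<integral>\<^sup>+y. indicator {x} y \<partial>count_space S)"
        by (intro nn_integral_mono) (auto split: split_indicator)
      also have "\<dots> \<le> 1" using x by (subst nn_integral_indicator) auto
      finally show ?thesis .
    next
      case False
      then have "(\<integral>\<^sup>+y. indicator (cball y \<delta>) w \<partial>count_space S) = (\<integral>\<^sup>+y. 0 \<partial>count_space S)"
        by (intro nn_integral_cong) (auto split: split_indicator)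
      then show ?thesis by simp
    qed
    then have "H w * (\<integral>\<^sup>+x. indicator (cball x \<delta>) w \<partial>count_space S) \<le> H w * 1" by (rule mult_left_mono) simp
    finally show "(\<integral>\<^sup>+x. H w * indicator (cball x \<delta>) w \<partial>count_space S) \<le> H w" by simp
  qed
  finally show ?thesis .
qed

lemma lat_bessel:
  assumes "Im (cnj a * b) \<noteq> 0"
  shows "\<exists>C>0. \<forall>F \<phi>. polyrep n \<phi> F \<longrightarrow>
    (\<integral>\<^sup>+x. ennreal ((fmod F x)\<^sup>2) \<partial>count_space (lat a b)) \<le> ennreal C * fock_norm2 F"
proof -
  obtain \<delta> where \<delta>: "\<delta> > 0" "\<forall>x\<in>lat a b. \<forall>y\<in>lat a b. x \<noteq> y \<longrightarrow> dist x y > 2 * \<delta>"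
    using lat_separated[OF assms] by blast
  obtain C where C: "C > 0" and le: "\<And>F \<phi> z. polyrep n \<phi> F \<Longrightarrow>
    ennreal ((fmod F z)\<^sup>2) \<le> ennreal C * (\<integral>\<^sup>+w. ennreal ((fmod F w)\<^sup>2) * indicator (cball z \<delta>) w \<partial>lborel)"
    using polyrep_local_estimate[OF \<delta>(1), of n] by blast
  have "(\<integral>\<^sup>+x. ennreal ((fmod F x)\<^sup>2) \<partial>count_space (lat a b)) \<le> ennreal C * fock_norm2 F" if F: "polyrep n \<phi> F" for F \<phi>
  proof -
    have [measurable]: "F \<in> borel_measurable borel"
      using polyrep_continuous[OF F] by (rule borel_measurable_continuous_onI)
    have "(\<integral>\<^sup>+x. ennreal ((fmod F x)\<^sup>2) \<partial>count_space (lat a b)) \<le>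
      (\<integral>\<^sup>+x. ennreal C * (\<integral>\<^sup>+w. ennreal ((fmod F w)\<^sup>2) * indicator (cball x \<delta>) w \<partial>lborel) \<partial>count_space (lat a b))"
      by (intro nn_integral_mono le[OF F])
    also have "\<dots> = ennreal C * (\<integral>\<^sup>+x. (\<integral>\<^sup>+w. ennreal ((fmod F w)\<^sup>2) * indicator (cball x \<delta>) w \<partial>lborel) \<partial>count_space (lat a b))"
      by (rule nn_integral_cmult) simp
    also have "\<dots> \<le> ennreal C * fock_norm2 F"
      unfolding fock_norm2_fmod using \<delta>(2)
      by (intro mult_left_mono separated_balls_nn_integral_le lat_countable) auto
    finally show ?thesis .
  qed
  with C show ?thesis by blast
qed

lemma polyrep_fmod_bound:
  "\<exists>C>0. \<forall>F \<phi> z. polyrep n \<phi> F \<longrightarrow> ennreal ((fmod F z)\<^sup>2) \<le> ennreal C * fock_norm2 F"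
proof -
  obtain C where C: "C > 0" and le: "\<And>F \<phi> z. polyrep n \<phi> F \<Longrightarrow>
    ennreal ((fmod F z)\<^sup>2) \<le> ennreal C * (\<integral>\<^sup>+w. ennreal ((fmod F w)\<^sup>2) * indicator (cball z 1) w \<partial>lborel)"
    using polyrep_local_estimate[of 1 n] by auto
  have "ennreal C * (\<integral>\<^sup>+w. ennreal ((fmod F w)\<^sup>2) * indicator (cball z 1) w \<partial>lborel) \<le> ennreal C * fock_norm2 F" for F z
    unfolding fock_norm2_fmod by (intro mult_left_mono nn_integral_mono) (auto split: split_indicator)
  with C le show ?thesis by (meson order_trans)
qed

lemma norm_add_sq_le: "(norm (x + y))\<^sup>2 \<le> 2 * (norm x)\<^sup>2 + 2 * (norm (y :: 'a::real_normed_vector))\<^sup>2"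
proof -
  have "(norm (x + y))\<^sup>2 \<le> (norm x + norm y)\<^sup>2" by (intro power_mono norm_triangle_ineq) auto
  also have "\<dots> \<le> 2 * (norm x)\<^sup>2 + 2 * (norm y)\<^sup>2"
    using zero_le_power2[of "norm x - norm y"] by (simp add: power2_eq_square algebra_simps)
  finally show ?thesis .
qed

text \<open>Comparison with a Gaussian integral over disjoint balls. The explicit 1 / t matters: at
  the critical density it cancels against a factor of order t as t tends to 0.\<close>

lemma lat_gauss_sum:
  assumes "Im (cnj a * b) \<noteq> 0"
  shows "\<exists>C>0. \<exists>d. \<forall>t>0. \<forall>z. (\<integral>\<^sup>+x. ennreal (exp (- t * (norm (x - z))\<^sup>2)) \<partial>count_space (lat a b)) \<le> ennreal (C * exp (t * d) / t)"
proof -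
  obtain \<delta> where \<delta>: "\<delta> > 0" "\<forall>x\<in>lat a b. \<forall>y\<in>lat a b. x \<noteq> y \<longrightarrow> dist x y > 2 * \<delta>"
    using lat_separated[OF assms] by blast
  define V where "V = measure lborel (cball (0::complex) \<delta>)"
  have V: "V > 0" unfolding V_def using \<delta> by (metis content_cball_pos)
  have Vz: "emeasure lborel (cball (z::complex) \<delta>) = ennreal V" for z
  proof -
    have "emeasure lborel (cball z \<delta>) = ennreal (measure lborel (cball z \<delta>))"
      by (intro emeasure_eq_ennreal_measure) (use emeasure_bounded_finite[of "cball z \<delta>"] in auto)
    then show ?thesis using \<delta> by (simp add: V_def content_cball)
  qed
  define G where "G = enn2real gauss_mass"
  have G: "gauss_mass = ennreal G" "G > 0" using gauss_mass_finite gauss_mass_pos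
    by (auto simp: G_def enn2real_positive_iff less_top)
  have "(\<integral>\<^sup>+x. ennreal (exp (- t * (norm (x - z))\<^sup>2)) \<partial>count_space (lat a b)) \<le> ennreal (2 * pi * G / V * exp (t * \<delta>\<^sup>2) / t)"
    if t: "t > 0" for t z
  proof -
    \<comment> \<open>Half the rate absorbs the displacement of w inside the ball, since t / 2 * |w
      - z|^2 is at most t * |x - z|^2 + t * \<delta>^2; dividing by V turns the integral over the
      ball into an average.\<close>
    define H where "H w = exp (t * \<delta>\<^sup>2) / V * exp (- (t / 2) * (norm (w - z))\<^sup>2)" for w :: complex
    have H0: "H w \<ge> 0" for w using V by (simp add: H_def)
    have Hm[measurable]: "H \<in> borel_measurable borel" unfolding H_def[abs_def] by measurable
    have le: "ennreal (exp (- t * (norm (x - z))\<^sup>2)) \<le> (\<integral>\<^sup>+w. ennreal (H w) * indicator (cball x \<delta>) w \<partial>lborel)" for x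
    proof -
      have "ennreal (exp (- t * (norm (x - z))\<^sup>2)) = (\<integral>\<^sup>+w. ennreal (exp (- t * (norm (x - z))\<^sup>2) / V) * indicator (cball x \<delta>) w \<partial>lborel)"
        using V by (simp add: nn_integral_cmult_indicator Vz ennreal_mult[symmetric])
      also have "\<dots> \<le> (\<integral>\<^sup>+w. ennreal (H w) * indicator (cball x \<delta>) w \<partial>lborel)"
      proof (intro nn_integral_mono)
        fix w
        show "ennreal (exp (- t * (norm (x - z))\<^sup>2) / V) * indicator (cball x \<delta>) w \<le> ennreal (H w) * indicator (cball x \<delta>) w"
        proof (cases "w \<in> cball x \<delta>")
          case True
          have "(norm (w - z))\<^sup>2 \<le> 2 * (norm (x - z))\<^sup>2 + 2 * (norm (w - x))\<^sup>2"
            using norm_add_sq_le[of "x - z" "w - x"] by simp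
          also have "(norm (w - x))\<^sup>2 \<le> \<delta>\<^sup>2"
            using True by (intro power_mono) (auto simp: dist_norm norm_minus_commute)
          finally have "t / 2 * (norm (w - z))\<^sup>2 \<le> t / 2 * (2 * (norm (x - z))\<^sup>2 + 2 * \<delta>\<^sup>2)"
            using t by (intro mult_left_mono) auto
          then have "- t * (norm (x - z))\<^sup>2 \<le> t * \<delta>\<^sup>2 + - (t / 2) * (norm (w - z))\<^sup>2" by (simp add: algebra_simps)
          then have "exp (- t * (norm (x - z))\<^sup>2) \<le> exp (t * \<delta>\<^sup>2) * exp (- (t / 2) * (norm (w - z))\<^sup>2)"
            by (simp add: mult_exp_exp)
          then have "exp (- t * (norm (x - z))\<^sup>2) / V \<le> H w" using V by (simp add: H_def field_simps)
          then show ?thesis using True by (simp add: ennreal_leI)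
        qed auto
      qed
      finally show ?thesis .
    qed
    have "(\<integral>\<^sup>+x. ennreal (exp (- t * (norm (x - z))\<^sup>2)) \<partial>count_space (lat a b))
       \<le> (\<integral>\<^sup>+x. (\<integral>\<^sup>+w. ennreal (H w) * indicator (cball x \<delta>) w \<partial>lborel) \<partial>count_space (lat a b))"
      by (intro nn_integral_mono le)
    also have "\<dots> \<le> (\<integral>\<^sup>+w. ennreal (H w) \<partial>lborel)"
      using \<delta>(2) by (intro separated_balls_nn_integral_le lat_countable) auto
    also have "\<dots> = ennreal (exp (t * \<delta>\<^sup>2) / V) * (\<integral>\<^sup>+w. ennreal (exp (- (t / 2) * (norm (w - z))\<^sup>2)) \<partial>lborel)"
      using V unfolding H_def by (subst nn_integral_cmult[symmetric]) (auto simp: ennreal_mult[symmetric])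
    also have "\<dots> = ennreal (exp (t * \<delta>\<^sup>2) / V) * (ennreal (pi / (t / 2)) * gauss_mass)"
      using t by (subst nn_integral_gauss) auto
    also have "\<dots> = ennreal (2 * pi * G / V * exp (t * \<delta>\<^sup>2) / t)"
      unfolding G(1) using t V G(2) by (simp add: ennreal_mult[symmetric])
    finally show ?thesis .
  qed
  moreover have "2 * pi * G / V > 0" using V G by simp
  ultimately show ?thesis by blast
qed

subsection \<open>Quasi-periodic functions\<close>

text \<open>The values of h are integer multiples of 2 * pi * i, hence separated by gaps of at least
  2 * pi, and the plane is connected.\<close>

lemma exp_eq_1_imp_constant:
  fixes h :: "complex \<Rightarrow> complex"
  assumes "continuous_on UNIV h" "\<And>z. exp (h z) = 1"
  shows "h z = h w"
proof -
  have "h constant_on UNIV"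
  proof (rule continuous_discrete_range_constant)
    fix x
    have "2 * pi \<le> norm (h y - h x)" if ne: "h y \<noteq> h x" for y
    proof -
      have "exp (h y - h x) = 1" using assms(2) by (simp add: exp_diff)
      then obtain n :: int where n: "Re (h y - h x) = 0" "Im (h y - h x) = of_int (2 * n) * pi"
        using exp_eq_1[of "h y - h x"] by blast
      have "n \<noteq> 0" using n ne by (auto simp: complex_eq_iff)
      then have "1 \<le> \<bar>real_of_int n\<bar>" by linarith
      then have "2 * pi \<le> \<bar>Im (h y - h x)\<bar>" unfolding n by (simp add: abs_mult)
      then show ?thesis using abs_Im_le_cmod order_trans by blast
    qed
    then show "\<exists>e>0. \<forall>y. y \<in> UNIV \<and> h y \<noteq> h x \<longrightarrow> e \<le> norm (h y - h x)"
      by (intro exI[of _ "2 * pi"]) auto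
  qed (use assms in auto)
  then show ?thesis by (auto simp: constant_on_def)
qed

text \<open>A zero-free such function has a continuous logarithm \<open>g\<close> on the plane. Comparing the two ways
  of computing \<open>g (z + a + b)\<close> forces \<open>cnj a * b\<close> to be real.\<close>

lemma quasi_periodic_has_zero:
  fixes d :: "complex \<Rightarrow> complex" and k :: real
  assumes cont: "continuous_on UNIV d"
    and qa: "\<And>z. d (z + a) = c1 * exp (of_real k * cnj a * z) * d z"
    and qb: "\<And>z. d (z + b) = c2 * exp (of_real k * cnj b * z) * d z"
    and k: "k \<noteq> 0" and ab: "Im (cnj a * b) \<noteq> 0"
  shows "\<exists>z. d z = 0"
proof (rule ccontr)
  assume "\<not> (\<exists>z. d z = 0)"
  then have nz: "d z \<noteq> 0" for z by simp
  obtain g where g: "continuous_on UNIV g" "\<And>z. d z = exp (g z)"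
    by (rule continuous_logarithm_on_contractible[OF cont convex_imp_contractible[OF convex_UNIV]]) (use nz in auto)
  have c: "\<exists>K. \<forall>z. g (z + v) = g z + of_real k * cnj v * z + K"
    if q: "\<And>z. d (z + v) = c * exp (of_real k * cnj v * z) * d z" for v c
  proof -
    have c0: "c \<noteq> 0"
    proof
      assume "c = 0"
      then have "d (0 + v) = 0" by (subst q) simp
      then show False using nz[of "0 + v"] by simp
    qed
    \<comment> \<open>The difference between the increment of the logarithm g and the logarithm
      prescribed by quasi-periodicity; its exponential is 1, so it is constant.\<close>
    define h where "h z = g (z + v) - g z - of_real k * cnj v * z - Ln c" for z
    have "exp (h z) = 1" for z
    proof -
      have "exp (g (z + v)) = c * exp (of_real k * cnj v * z) * exp (g z)" using q[of z] by (simp only: g(2))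
      then show ?thesis using c0 by (simp add: h_def exp_diff)
    qed
    note exph = this
    have "continuous_on UNIV (\<lambda>z. g (z + v))"
      by (rule continuous_on_compose2[OF g(1)]) (auto intro!: continuous_intros)
    then have "continuous_on UNIV h"
      unfolding h_def using g(1) by (auto intro!: continuous_intros)
    from exp_eq_1_imp_constant[OF this exph] have hc: "h z = h 0" for z .
    have hz: "g (z + v) - g z - of_real k * cnj v * z - Ln c = h 0" for z
      by (rule HOL.trans[OF h_def[symmetric] hc])
    have "g (z + v) = g z + of_real k * cnj v * z + (h 0 + Ln c)" for z
      unfolding hz[of z, symmetric] by simp
    then show ?thesis by (intro exI[of _ "h 0 + Ln c"] allI)
  qed
  from c[of a c1, OF qa] obtain K1 where "\<forall>z. g (z + a) = g z + of_real k * cnj a * z + K1" by (rule exE)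
  then have K1: "g (z + a) = g z + of_real k * cnj a * z + K1" for z by (rule spec)
  from c[of b c2, OF qb] obtain K2 where "\<forall>z. g (z + b) = g z + of_real k * cnj b * z + K2" by (rule exE)
  then have K2: "g (z + b) = g z + of_real k * cnj b * z + K2" for z by (rule spec)
  have 1: "g (a + b) = g a + of_real k * cnj b * a + K2" by (rule K2)
  have 2: "g (a + b) = g b + of_real k * cnj a * b + K1" by (subst add.commute) (rule K1)
  have 3: "g a = g 0 + K1" "g b = g 0 + K2" using K1[of 0] K2[of 0] by simp_all
  have *: "X = Y" if "u + x + X + y = u + y + Y + x" for u x y X Y :: complex
    using that by (simp add: algebra_simps)
  have "of_real k * cnj b * a = of_real k * cnj a * b" using 1 unfolding 2 3 by (rule *[OF sym])
  then have e: "cnj b * a = cnj a * b" using k by (simp only: mult.assoc mult_cancel_left of_real_eq_0_iff simp_thms)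
  have "Im (cnj b * a) = Im (cnj a * b)" by (subst e) (rule refl)
  moreover have "Im (cnj b * a) = - Im (cnj a * b)" by simp
  ultimately show False using ab by linarith
qed

section \<open>The Jacobi theta function\<close>

lemma summable_on_int_geometric:
  fixes q :: real assumes "0 \<le> q" "q < 1"
  shows "(\<lambda>k::int. q ^ nat \<bar>k\<bar>) summable_on UNIV"
proof -
  have s: "(\<lambda>n::nat. q ^ n) summable_on UNIV"
    using assms by (intro norm_summable_imp_summable_on) (auto simp: summable_geometric)
  have "(\<lambda>k::int. q ^ nat \<bar>k\<bar>) summable_on range int"
    using s by (subst summable_on_reindex) (auto simp: o_def)
  moreover have "(\<lambda>k::int. q ^ nat \<bar>k\<bar>) summable_on range (\<lambda>n. - int n)"
    using s by (subst summable_on_reindex) (auto simp: o_def inj_on_def)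
  ultimately have "(\<lambda>k::int. q ^ nat \<bar>k\<bar>) summable_on (range int \<union> range (\<lambda>n. - int n))"
    using assms by (intro summable_on_union) auto
  moreover have "range int \<union> range (\<lambda>n. - int n) = UNIV"
  proof -
    have "x \<in> range int \<union> range (\<lambda>n. - int n)" for x
      by (cases x rule: int_cases2) auto
    then show ?thesis by blast
  qed
  ultimately show ?thesis by simp
qed

definition theta_term :: "complex \<Rightarrow> int \<Rightarrow> complex \<Rightarrow> complex" where
  "theta_term \<tau> k t = exp (of_real pi * \<i> * \<tau> * of_int k ^ 2 + 2 * of_real pi * \<i> * of_int k * t)"

definition theta :: "complex \<Rightarrow> complex \<Rightarrow> complex" where
  "theta \<tau> t = (\<Sum>\<^sub>\<infinity>k. theta_term \<tau> k t)"

text \<open>Completing the square trades the term linear in k for half of the quadratic one; k^2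
  \<ge> |k| then turns the other half into a geometric majorant, uniform for bounded imaginary
  part.\<close>

lemma theta_term_bound:
  assumes "Im \<tau> > 0" "\<bar>Im t\<bar> \<le> R"
  shows "norm (theta_term \<tau> k t) \<le> exp (2 * pi * R\<^sup>2 / Im \<tau>) * exp (- pi * Im \<tau> / 2) ^ nat \<bar>k\<bar>"
proof -
  define y where "y = Im \<tau>"
  have y: "y > 0" using assms by (simp add: y_def)
  define m where "m = \<bar>real_of_int k\<bar>"
  have m2: "m \<le> (real_of_int k)\<^sup>2"
  proof -
    have "\<bar>k\<bar> \<le> k\<^sup>2"
    proof (cases "k = 0")
      case False
      then have "1 \<le> \<bar>k\<bar>" by linarith
      from mult_left_mono[OF this, of "\<bar>k\<bar>"] show ?thesis by (simp add: power2_eq_square)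
    qed simp
    then have "real_of_int \<bar>k\<bar> \<le> real_of_int (k\<^sup>2)" by (simp only: of_int_le_iff)
    then show ?thesis by (simp add: m_def)
  qed
  have mm: "m\<^sup>2 = (real_of_int k)\<^sup>2" by (simp add: m_def)
  have "0 \<le> (y * m - 2 * R)\<^sup>2" by simp
  then have "2 * R * m \<le> y / 2 * m\<^sup>2 + 2 * R\<^sup>2 / y"
    using y by (simp add: power2_eq_square field_simps)
  moreover have "- (real_of_int k * Im t) \<le> m * R"
  proof -
    have "- (real_of_int k * Im t) \<le> m * \<bar>Im t\<bar>"
      using abs_ge_minus_self[of "real_of_int k * Im t"] by (simp add: m_def abs_mult)
    also have "\<dots> \<le> m * R" using assms(2) by (intro mult_left_mono) (auto simp: m_def)
    finally show ?thesis .
  qed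
  ultimately have "- y * m\<^sup>2 - 2 * (real_of_int k * Im t) \<le> 2 * R\<^sup>2 / y - y / 2 * m\<^sup>2" by (simp add: algebra_simps)
  also have "\<dots> \<le> 2 * R\<^sup>2 / y - y / 2 * m" using y m2 mm by (simp add: mult_left_mono)
  finally have "pi * (- y * m\<^sup>2 - 2 * (real_of_int k * Im t)) \<le> pi * (2 * R\<^sup>2 / y - y / 2 * m)"
    by (intro mult_left_mono) auto
  then have 1: "pi * (- y * m\<^sup>2 - 2 * (real_of_int k * Im t)) \<le> 2 * pi * R\<^sup>2 / y + real (nat \<bar>k\<bar>) * (- pi * y / 2)"
    by (simp add: m_def algebra_simps)
  have "Re (of_real pi * \<i> * \<tau> * of_int k ^ 2 + 2 * of_real pi * \<i> * of_int k * t)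
      = pi * (- y * m\<^sup>2 - 2 * (real_of_int k * Im t))"
    unfolding mm y_def by (simp add: power2_eq_square algebra_simps)
  then have "norm (theta_term \<tau> k t) = exp (pi * (- y * m\<^sup>2 - 2 * (real_of_int k * Im t)))"
    by (simp add: theta_term_def)
  also have "\<dots> \<le> exp (2 * pi * R\<^sup>2 / y + real (nat \<bar>k\<bar>) * (- pi * y / 2))" using 1 by simp
  also have "\<dots> = exp (2 * pi * R\<^sup>2 / y) * exp (- pi * y / 2) ^ nat \<bar>k\<bar>"
    unfolding exp_add by (simp add: exp_of_nat_mult[symmetric])
  finally show ?thesis by (simp add: y_def)
qed

lemma theta_uniform_limit:
  assumes "Im \<tau> > 0" "bounded K"
  shows "uniform_limit K (\<lambda>X t. \<Sum>k\<in>X. theta_term \<tau> k t) (theta \<tau>) (finite_subsets_at_top UNIV)"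
proof -
  obtain R where R: "\<And>z. z \<in> K \<Longrightarrow> norm z \<le> R" using assms(2) by (auto simp: bounded_iff)
  have "uniform_limit K (\<lambda>X t. \<Sum>k\<in>X. theta_term \<tau> k t) (\<lambda>t. \<Sum>\<^sub>\<infinity>k. theta_term \<tau> k t) (finite_subsets_at_top UNIV)"
  proof (rule Weierstrass_m_test_general)
    fix k t assume "t \<in> K"
    then have "\<bar>Im t\<bar> \<le> R" using R abs_Im_le_cmod order_trans by blast
    then show "norm (theta_term \<tau> k t) \<le> exp (2 * pi * R\<^sup>2 / Im \<tau>) * exp (- pi * Im \<tau> / 2) ^ nat \<bar>k\<bar>"
      by (rule theta_term_bound[OF assms(1)])
  qed (use assms(1) in \<open>auto intro!: summable_on_cmult_right summable_on_int_geometric\<close>)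
  then show ?thesis by (simp add: theta_def[abs_def])
qed

lemma theta_holomorphic:
  assumes "Im \<tau> > 0" shows "theta \<tau> holomorphic_on UNIV"
proof -
  have "theta \<tau> holomorphic_on ball 0 r" for r
  proof (rule holomorphic_uniform_limit)
    show "\<forall>\<^sub>F X in finite_subsets_at_top UNIV. continuous_on (cball 0 r) (\<lambda>t. \<Sum>k\<in>X. theta_term \<tau> k t)
        \<and> (\<lambda>t. \<Sum>k\<in>X. theta_term \<tau> k t) holomorphic_on ball 0 r"
      unfolding theta_term_def by (intro always_eventually allI conjI) (auto intro!: continuous_intros holomorphic_intros)
    show "uniform_limit (cball 0 r) (\<lambda>X t. \<Sum>k\<in>X. theta_term \<tau> k t) (theta \<tau>) (finite_subsets_at_top UNIV)"
      using assms by (intro theta_uniform_limit) auto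
  qed auto
  then have "theta \<tau> field_differentiable at z" for z
    using holomorphic_on_imp_differentiable_at[of "theta \<tau>" "ball 0 (norm z + 1)" z] by auto
  then show ?thesis by (auto simp: holomorphic_on_def intro: field_differentiable_at_within)
qed

lemma exp_2pi_int: "exp (2 * of_real pi * \<i> * of_int k) = (1::complex)"
  using exp_integer_2pi[of "of_int k"] by (simp add: mult_ac)

lemma theta_plus_1: "theta \<tau> (t + 1) = theta \<tau> t"
proof -
  have "theta_term \<tau> k (t + 1) = theta_term \<tau> k t" for k
  proof -
    show ?thesis by (simp add: theta_term_def distrib_left exp_add exp_2pi_int)
  qed
  then show ?thesis by (simp add: theta_def)
qed

text \<open>In the exponent, translation by \<tau> completes to the square (k + 1)^2, so it amounts
  to a shift of the summation index.\<close>

lemma theta_plus_tau: "theta \<tau> (t + \<tau>) = exp (- of_real pi * \<i> * \<tau> - 2 * of_real pi * \<i> * t) * theta \<tau> t"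
proof -
  define E where "E = exp (- of_real pi * \<i> * \<tau> - 2 * of_real pi * \<i> * t)"
  have "theta_term \<tau> k (t + \<tau>) = E * theta_term \<tau> (k + 1) t" for k
    unfolding theta_term_def E_def mult_exp_exp by (rule arg_cong[where f=exp]) (simp add: power2_eq_square algebra_simps)
  then have "theta \<tau> (t + \<tau>) = (\<Sum>\<^sub>\<infinity>k. E * theta_term \<tau> (k + 1) t)" by (simp add: theta_def)
  also have "\<dots> = E * (\<Sum>\<^sub>\<infinity>k. theta_term \<tau> (k + 1) t)" by (rule infsum_cmult_right') 
  also have "(\<Sum>\<^sub>\<infinity>k. theta_term \<tau> (k + 1) t) = (\<Sum>\<^sub>\<infinity>k. theta_term \<tau> k t)"
    by (rule infsum_reindex_bij_betw) (rule bij_betw_byWitness[where f'="\<lambda>k. k - 1"]; auto)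
  finally show ?thesis by (simp add: theta_def E_def)
qed

text \<open>The integral over the unit interval is the zeroth Fourier coefficient, which equals 1:
  the terms with nonzero k integrate to 0 over a full period.\<close>

lemma theta_nonzero:
  assumes "Im \<tau> > 0" shows "\<exists>t. theta \<tau> t \<noteq> 0"
proof (rule ccontr)
  assume "\<not> ?thesis"
  then have z: "theta \<tau> t = 0" for t by blast
  have ft: "((\<lambda>x. theta_term \<tau> k (of_real x)) has_integral (if k = 0 then 1 else 0)) (cbox 0 (1::real))" for k
  proof (cases "k = 0")
    case True
    then show ?thesis using has_integral_const_real[of "1::complex" 0 1] by (simp add: theta_term_def)
  next
    case False
    define c where "c = 2 * of_real pi * \<i> * of_int k"
    have c0: "c \<noteq> 0" using False by (simp add: c_def)
    define Q where "Q = exp (of_real pi * \<i> * \<tau> * of_int k ^ 2)"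
    have tt: "theta_term \<tau> k (of_real x) = Q * exp (c * of_real x)" for x
      by (simp add: theta_term_def Q_def c_def exp_add mult_ac)
    have "((\<lambda>x. theta_term \<tau> k (of_real x)) has_integral (Q / c * exp (c * of_real 1) - Q / c * exp (c * of_real 0))) {0..1::real}"
    proof (rule fundamental_theorem_of_calculus)
      fix x :: real
      have "((\<lambda>z. Q / c * exp (c * z)) has_field_derivative Q * exp (c * of_real x)) (at (of_real x))"
        using c0 by (auto intro!: derivative_eq_intros)
      then have "((\<lambda>z. Q / c * exp (c * of_real z)) has_vector_derivative Q * exp (c * of_real x)) (at x within {0..1})"
        by (intro has_vector_derivative_real_field)
      then show "((\<lambda>x. Q / c * exp (c * of_real x)) has_vector_derivative theta_term \<tau> k (of_real x)) (at x within {0..1})"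
        by (simp add: tt)
    qed simp
    moreover have "exp c = 1" unfolding c_def by (rule exp_2pi_int)
    ultimately show ?thesis using False by simp
  qed
  have ul: "uniform_limit (cbox 0 (1::real)) (\<lambda>X x. \<Sum>k\<in>X. theta_term \<tau> k (of_real x)) (\<lambda>x. theta \<tau> (of_real x)) (finite_subsets_at_top UNIV)"
  proof -
    have "uniform_limit (of_real ` cbox 0 (1::real)) (\<lambda>X t. \<Sum>k\<in>X. theta_term \<tau> k t) (theta \<tau>) (finite_subsets_at_top UNIV)"
    proof (rule theta_uniform_limit[OF assms])
      show "bounded (complex_of_real ` cbox 0 (1::real))"
        by (rule compact_imp_bounded[OF compact_continuous_image[OF continuous_on_of_real[OF continuous_on_id] compact_cbox]])
    qed
    then show ?thesis by (auto simp: uniform_limit_iff)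
  qed
  have int: "(\<lambda>x. \<Sum>k\<in>X. theta_term \<tau> k (of_real x)) integrable_on cbox 0 (1::real)" if "finite X" for X
    using ft that by (intro integrable_sum) (auto simp: has_integral_integrable)
  have cont: "continuous_on (cbox 0 (1::real)) (\<lambda>x. \<Sum>k\<in>X. theta_term \<tau> k (of_real x))" for X
    unfolding theta_term_def by (auto intro!: continuous_intros)
  obtain I J where I: "\<And>X. ((\<lambda>x. \<Sum>k\<in>X. theta_term \<tau> k (of_real x)) has_integral I X) (cbox 0 (1::real))"
    and J: "((\<lambda>x. theta \<tau> (of_real x)) has_integral J) (cbox 0 (1::real))"
    and lim: "(I \<longlongrightarrow> J) (finite_subsets_at_top UNIV)"
    by (rule uniform_limit_integral_cbox[OF ul cont]) auto
  have "J = 0" using J by (simp add: z)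
  have "\<forall>\<^sub>F X in finite_subsets_at_top UNIV. I X = 1"
    unfolding eventually_finite_subsets_at_top
  proof (intro exI[of _ "{0}"] conjI allI impI)
    fix X :: "int set" assume X: "finite X \<and> {0} \<subseteq> X \<and> X \<subseteq> UNIV"
    have "((\<lambda>x. \<Sum>k\<in>X. theta_term \<tau> k (of_real x)) has_integral (\<Sum>k\<in>X. if k = 0 then 1 else 0)) (cbox 0 (1::real))"
      using ft X by (intro has_integral_sum) auto
    moreover have "(\<Sum>k\<in>X. if k = 0 then 1 else 0) = (1::complex)" using X by simp
    ultimately show "I X = 1" using I has_integral_unique by metis
  qed auto
  then have "(I \<longlongrightarrow> 1) (finite_subsets_at_top UNIV)" by (rule tendsto_eventually)
  then have "J = 1" using lim by (intro tendsto_unique[OF finite_subsets_at_top_neq_bot])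
  with \<open>J = 0\<close> show False by simp
qed

text \<open>The multiplier matches the one built into \<open>fshift\<close>. The prescribed modulus
  of the constant is the value for which the weighted modulus \<open>fmod s\<close> has the period
  \<open>a\<close>.\<close>

definition quasi_periodic :: "complex \<Rightarrow> (complex \<Rightarrow> complex) \<Rightarrow> bool" where
  "quasi_periodic a s \<longleftrightarrow> (\<exists>c. norm c = exp (pi * (norm a)\<^sup>2 / 2) \<and> (\<forall>z. s (z + a) = c * exp (of_real pi * cnj a * z) * s z))"

text \<open>A theta function of z / a times a Gaussian exp (\<beta> * z^2). Theta is invariant under
  the period a, so the Gaussian alone supplies that multiplier; for b the multipliers of both
  factors combine correctly because the cell has unit area.\<close>

lemma exists_quasi_periodic_entire:
  assumes ab: "\<bar>Im (cnj a * b)\<bar> = 1"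
  shows "\<exists>s. s holomorphic_on UNIV \<and> (\<exists>z. s z \<noteq> 0) \<and> quasi_periodic a s \<and> quasi_periodic b s"
proof -
  \<comment> \<open>Positive orientation puts b / a into the upper half-plane; in the other case a
    and b exchange roles at the end.\<close>
  have main: "\<exists>s. s holomorphic_on UNIV \<and> (\<exists>z. s z \<noteq> 0) \<and> quasi_periodic a s \<and> quasi_periodic b s"
    if ab: "Im (cnj a * b) = 1" for a b
  proof -
    have a0: "a \<noteq> 0" using ab by auto
    define \<tau> where "\<tau> = b / a"
    have "\<tau> = (cnj a * b) / of_real ((norm a)\<^sup>2)"
    proof -
      have "of_real ((norm a)\<^sup>2) = a * cnj a" by (rule complex_norm_square)
      then show ?thesis using a0 by (simp only: \<tau>_def) simp
    qed
    then have \<tau>: "Im \<tau> > 0" using ab a0 by (simp add: Im_divide_of_real)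
    \<comment> \<open>Solves 2 * \<beta> * a = pi * cnj a, the linear coefficient that the period a
      demands.\<close>
    define \<beta> where "\<beta> = of_real pi * cnj a / (2 * a)"
    define s where "s z = exp (\<beta> * z\<^sup>2) * theta \<tau> (z / a)" for z
    have hs: "s holomorphic_on UNIV"
    proof -
      have "(theta \<tau> \<circ> (\<lambda>z. z / a)) holomorphic_on UNIV"
        by (rule holomorphic_on_compose_gen[where t=UNIV]) (use theta_holomorphic[OF \<tau>] a0 in \<open>auto intro!: holomorphic_intros\<close>)
      then show ?thesis unfolding s_def[abs_def] by (auto simp: o_def intro!: holomorphic_intros)
    qed
    obtain t where "theta \<tau> t \<noteq> 0" using theta_nonzero[OF \<tau>] by blast
    then have nz: "s (a * t) \<noteq> 0" using a0 by (simp add: s_def)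
    have \<beta>a: "2 * \<beta> * a = of_real pi * cnj a" using a0 by (simp add: \<beta>_def)
    have na: "of_real pi * cnj v * v = of_real (pi * (norm v)\<^sup>2)" for v
      using complex_norm_square[of v] by (simp add: mult_ac)
    have "s (z + a) = exp (of_real (pi * (norm a)\<^sup>2 / 2)) * exp (of_real pi * cnj a * z) * s z" for z
    proof -
      have "\<beta> * (z + a)\<^sup>2 = \<beta> * z\<^sup>2 + (2 * \<beta> * a) * z + (2 * \<beta> * a) * a / 2" by (simp add: power2_eq_square algebra_simps)
      also have "\<dots> = of_real (pi * (norm a)\<^sup>2 / 2) + of_real pi * cnj a * z + \<beta> * z\<^sup>2"
        unfolding \<beta>a na by simp
      finally have e: "exp (\<beta> * (z + a)\<^sup>2) = exp (of_real (pi * (norm a)\<^sup>2 / 2)) * exp (of_real pi * cnj a * z) * exp (\<beta> * z\<^sup>2)"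
        by (simp add: exp_add)
      have "theta \<tau> ((z + a) / a) = theta \<tau> (z / a)"
        using a0 theta_plus_1[of \<tau> "z / a"] by (simp add: add_divide_distrib)
      then show ?thesis unfolding s_def e by simp
    qed
    then have qa: "quasi_periodic a s" unfolding quasi_periodic_def
      by (intro exI[of _ "exp (of_real (pi * (norm a)\<^sup>2 / 2))"]) simp
    \<comment> \<open>Unit area in complex form. It acts as the Legendre relation does for the sigma
      function: it makes the linear coefficient for b come out as pi * cnj b.\<close>
    have ab': "cnj a * b - cnj b * a = 2 * \<i>" using ab by (simp add: complex_eq_iff algebra_simps)
    have bb: "2 * \<beta> * b - 2 * of_real pi * \<i> / a = of_real pi * cnj b"
    proof -
      have "2 * \<beta> * b - 2 * of_real pi * \<i> / a = of_real pi * (cnj a * b - 2 * \<i>) / a"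
      proof -
        have "2 * \<beta> * b = of_real pi * (cnj a * b) / a" by (simp add: \<beta>_def)
        then show ?thesis by (simp add: diff_divide_distrib right_diff_distrib mult_ac)
      qed
      also have "cnj a * b - 2 * \<i> = cnj b * a" unfolding ab'[symmetric] by simp
      finally show ?thesis using a0 by simp
    qed
    have "s (z + b) = exp (of_real (pi * (norm b)\<^sup>2 / 2)) * exp (of_real pi * cnj b * z) * s z" for z
    proof -
      have th: "theta \<tau> ((z + b) / a) = exp (- of_real pi * \<i> * \<tau> - 2 * of_real pi * \<i> * (z / a)) * theta \<tau> (z / a)"
        using theta_plus_tau[of \<tau> "z / a"] by (simp add: add_divide_distrib \<tau>_def)
      have "\<beta> * (z + b)\<^sup>2 + (- of_real pi * \<i> * \<tau> - 2 * of_real pi * \<i> * (z / a))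
        = of_real (pi * (norm b)\<^sup>2 / 2) + of_real pi * cnj b * z + \<beta> * z\<^sup>2"
      proof -
        have "\<beta> * (z + b)\<^sup>2 + (- of_real pi * \<i> * \<tau> - 2 * of_real pi * \<i> * (z / a))
          = \<beta> * z\<^sup>2 + (2 * \<beta> * b - 2 * of_real pi * \<i> / a) * z + (\<beta> * b - of_real pi * \<i> / a) * b"
          by (simp add: \<tau>_def power2_eq_square divide_inverse algebra_simps)
        moreover have "\<beta> * b - of_real pi * \<i> / a = of_real pi * cnj b / 2"
          unfolding bb[symmetric] by simp
        ultimately show ?thesis using na[of b] unfolding bb by simp
      qed
      then have "exp (\<beta> * (z + b)\<^sup>2) * exp (- of_real pi * \<i> * \<tau> - 2 * of_real pi * \<i> * (z / a))
        = exp (of_real (pi * (norm b)\<^sup>2 / 2)) * exp (of_real pi * cnj b * z) * exp (\<beta> * z\<^sup>2)"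
        unfolding mult_exp_exp by simp
      then show ?thesis unfolding s_def th by (simp only: mult.assoc[symmetric])
    qed
    then have qb: "quasi_periodic b s" unfolding quasi_periodic_def
      by (intro exI[of _ "exp (of_real (pi * (norm b)\<^sup>2 / 2))"]) simp
    show ?thesis
    proof (rule exI[of _ s], intro conjI)
      show "\<exists>z. s z \<noteq> 0" using nz by (rule exI)
    qed (fact hs qa qb)+
  qed
  show ?thesis
  proof (cases "Im (cnj a * b) = 1")
    case True then show ?thesis by (rule main)
  next
    case False
    then have "Im (cnj b * a) = 1" using ab by (auto simp: algebra_simps)
    from main[OF this] show ?thesis
      by (elim exE conjE) (rule exI, intro conjI; (assumption | (rule exI, assumption)))
  qed
qed

subsection \<open>Periodisation and Poisson summation\<close>

definition gauss_bounded :: "(complex \<Rightarrow> 'b::real_normed_vector) \<Rightarrow> bool" where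
  "gauss_bounded G \<longleftrightarrow> continuous_on UNIV G \<and> (\<exists>C \<epsilon>. \<epsilon> > 0 \<and> (\<forall>w. norm (G w) \<le> C * exp (- \<epsilon> * (norm w)\<^sup>2)))"

definition periodize :: "complex \<Rightarrow> complex \<Rightarrow> (complex \<Rightarrow> 'b::real_normed_vector) \<Rightarrow> complex \<Rightarrow> 'b" where
  "periodize a b G x = (\<Sum>\<^sub>\<infinity>l\<in>lat a b. G (x + l))"

lemma gauss_boundedE:
  assumes "gauss_bounded G"
  obtains C \<epsilon> where "C > 0" "\<epsilon> > 0" "\<epsilon> \<le> 1" "\<And>w. norm (G w) \<le> C * exp (- \<epsilon> * (norm w)\<^sup>2)"
proof -
  from assms obtain C \<epsilon> where \<epsilon>: "\<epsilon> > 0" and le: "\<And>w. norm (G w) \<le> C * exp (- \<epsilon> * (norm w)\<^sup>2)"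
    by (auto simp: gauss_bounded_def)
  show ?thesis
  \<comment> \<open>Capping the rate at 1 prepares the comparison with exp (- |w|^2), the fixed
    Gaussian of the unfolding argument.\<close>
  proof (rule that[of "\<bar>C\<bar> + 1" "min \<epsilon> 1"])
    fix w
    have "norm (G w) \<le> C * exp (- \<epsilon> * (norm w)\<^sup>2)" by (rule le)
    also have "\<dots> \<le> (\<bar>C\<bar> + 1) * exp (- min \<epsilon> 1 * (norm w)\<^sup>2)"
      by (intro mult_mono) (auto intro: mult_right_mono)
    finally show "norm (G w) \<le> (\<bar>C\<bar> + 1) * exp (- min \<epsilon> 1 * (norm w)\<^sup>2)" .
  qed (use \<epsilon> in auto)
qed

lemma gauss_integrable:
  assumes "\<epsilon> > 0" shows "integrable lborel (\<lambda>w::complex. exp (- \<epsilon> * (norm w)\<^sup>2))"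
proof (rule integrableI_bounded)
  have "(\<integral>\<^sup>+w. ennreal (norm (exp (- \<epsilon> * (norm (w::complex))\<^sup>2))) \<partial>lborel) = ennreal (pi / \<epsilon>) * gauss_mass"
    using nn_integral_gauss[OF assms, of 0] by simp
  also have "\<dots> < \<infinity>" using gauss_mass_finite by (simp add: ennreal_mult_less_top)
  finally show "(\<integral>\<^sup>+w. ennreal (norm (exp (- \<epsilon> * (norm (w::complex))\<^sup>2))) \<partial>lborel) < \<infinity>" .
qed measurable

lemma gauss_bounded_integrable:
  fixes G :: "complex \<Rightarrow> 'b::{banach,second_countable_topology}"
  assumes "gauss_bounded G" shows "integrable lborel G"
proof -
  obtain C \<epsilon> where C: "C > 0" "\<epsilon> > 0" "\<And>w. norm (G w) \<le> C * exp (- \<epsilon> * (norm w)\<^sup>2)"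
    using gauss_boundedE[OF assms] by metis
  show ?thesis
  proof (rule Bochner_Integration.integrable_bound)
    show "integrable lborel (\<lambda>w::complex. C * exp (- \<epsilon> * (norm w)\<^sup>2))"
      by (rule integrable_mult_right[OF gauss_integrable[OF C(2)]])
    show "G \<in> borel_measurable lborel"
      using assms by (auto simp: gauss_bounded_def intro: borel_measurable_continuous_onI)
  qed (use C in \<open>auto intro!: AE_I2\<close>)
qed

lemma gauss_summable_on_lat:
  assumes nd: "Im (cnj a * b) \<noteq> 0" and t: "t > 0"
  shows "(\<lambda>l. exp (- t * (norm (l - z))\<^sup>2)) summable_on lat a b"
proof -
  obtain C d where "(\<integral>\<^sup>+x. ennreal (exp (- t * (norm (x - z))\<^sup>2)) \<partial>count_space (lat a b)) \<le> ennreal (C * exp (t * d) / t)"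
    using lat_gauss_sum[OF nd] t by meson
  then obtain K where K: "(\<integral>\<^sup>+x. ennreal (exp (- t * (norm (x - z))\<^sup>2)) \<partial>count_space (lat a b)) \<le> ennreal K" by blast
  show ?thesis
  proof (rule nonneg_bdd_above_summable_on)
    show "bdd_above (sum (\<lambda>l. exp (- t * (norm (l - z))\<^sup>2)) ` {F. F \<subseteq> lat a b \<and> finite F})"
    proof (rule bdd_aboveI2)
      fix F assume F: "F \<in> {F. F \<subseteq> lat a b \<and> finite F}"
      have "ennreal (\<Sum>l\<in>F. exp (- t * (norm (l - z))\<^sup>2)) = (\<Sum>l\<in>F. ennreal (exp (- t * (norm (l - z))\<^sup>2)))"
        by (rule sum_ennreal[symmetric]) simp
      also have "\<dots> \<le> infsum (\<lambda>l. ennreal (exp (- t * (norm (l - z))\<^sup>2))) (lat a b)"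
        using F by (subst nonneg_infsum_complete) (auto intro!: SUP_upper)
      also have "\<dots> \<le> ennreal K" using K by (simp add: infsum_ennreal_eq_nn_integral[OF lat_countable])
      finally show "(\<Sum>l\<in>F. exp (- t * (norm (l - z))\<^sup>2)) \<le> max K 0"
        by (auto simp: ennreal_le_iff2 max_def)
    qed
  qed simp
qed

text \<open>Follows from |l|^2 \<le> 2 * |x + l|^2 + 2 * |x|^2. Gaussian decay thus survives a
  translation over a bounded set at half the rate, which gives the uniform majorants for lattice
  sums.\<close>

lemma gauss_split_bound:
  assumes "\<epsilon> > 0"
  shows "exp (- \<epsilon> * (norm (x + l :: complex))\<^sup>2) \<le> exp (\<epsilon> * (norm x)\<^sup>2) * exp (- (\<epsilon> / 2) * (norm l)\<^sup>2)"
proof -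
  have "(norm l)\<^sup>2 \<le> 2 * (norm (x + l))\<^sup>2 + 2 * (norm x)\<^sup>2"
    using norm_add_sq_le[of "x + l" "-x"] by simp
  then have "\<epsilon> / 2 * (norm l)\<^sup>2 \<le> \<epsilon> / 2 * (2 * (norm (x + l))\<^sup>2 + 2 * (norm x)\<^sup>2)"
    using assms by (intro mult_left_mono) auto
  then show ?thesis unfolding mult_exp_exp exp_le_cancel_iff by (simp add: algebra_simps)
qed

lemma gauss_bounded_abs_summable:
  assumes nd: "Im (cnj a * b) \<noteq> 0" and G: "gauss_bounded G"
  shows "(\<lambda>l. norm (G (x + l))) summable_on lat a b"
proof -
  obtain C \<epsilon> where C: "C > 0" "\<epsilon> > 0" "\<And>w. norm (G w) \<le> C * exp (- \<epsilon> * (norm w)\<^sup>2)"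
    using gauss_boundedE[OF G] by metis
  show ?thesis
  proof (rule Infinite_Sum.abs_summable_on_comparison_test')
    show "(\<lambda>l. C * exp (- \<epsilon> * (norm (l - (- x)))\<^sup>2)) summable_on lat a b"
      by (intro summable_on_cmult_right gauss_summable_on_lat nd C)
    show "norm (G (x + l)) \<le> C * exp (- \<epsilon> * (norm (l - (- x)))\<^sup>2)" for l
      using C(3)[of "x + l"] by (simp add: add.commute)
  qed
qed

lemma periodize_continuous:
  fixes G :: "complex \<Rightarrow> 'b::banach"
  assumes nd: "Im (cnj a * b) \<noteq> 0" and G: "gauss_bounded G"
  shows "continuous_on UNIV (periodize a b G)"
proof -
  obtain C \<epsilon> where C: "C > 0" "\<epsilon> > 0" "\<And>w. norm (G w) \<le> C * exp (- \<epsilon> * (norm w)\<^sup>2)"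
    using gauss_boundedE[OF G] by metis
  have contG: "continuous_on UNIV G" using G by (simp add: gauss_bounded_def)
  have "continuous_on (ball 0 r) (periodize a b G)" if r: "r > 0" for r
  proof -
    have "uniform_limit (ball 0 r) (\<lambda>X y. \<Sum>l\<in>X. G (y + l)) (\<lambda>y. \<Sum>\<^sub>\<infinity>l\<in>lat a b. G (y + l)) (finite_subsets_at_top (lat a b))"
    proof (rule Weierstrass_m_test_general)
      show "(\<lambda>l. C * exp (\<epsilon> * r\<^sup>2) * exp (- (\<epsilon> / 2) * (norm (l - 0))\<^sup>2)) summable_on lat a b"
        using C by (intro summable_on_cmult_right gauss_summable_on_lat nd) auto
      fix l y :: complex assume "y \<in> ball 0 r"
      then have y: "norm y \<le> r" by simp
      have "norm (G (y + l)) \<le> C * (exp (\<epsilon> * (norm y)\<^sup>2) * exp (- (\<epsilon> / 2) * (norm l)\<^sup>2))"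
        using order_trans[OF C(3) mult_left_mono[OF gauss_split_bound[OF C(2)], of C]] C(1) by simp
      also have "\<dots> \<le> C * (exp (\<epsilon> * r\<^sup>2) * exp (- (\<epsilon> / 2) * (norm l)\<^sup>2))"
        using C y r by (intro mult_left_mono mult_right_mono) (auto intro!: power_mono)
      finally show "norm (G (y + l)) \<le> C * exp (\<epsilon> * r\<^sup>2) * exp (- (\<epsilon> / 2) * (norm (l - 0))\<^sup>2)" by simp
    qed
    then have "continuous_on (ball 0 r) (\<lambda>y. \<Sum>\<^sub>\<infinity>l\<in>lat a b. G (y + l))"
    proof (rule uniform_limit_theorem[rotated])
      show "\<forall>\<^sub>F X in finite_subsets_at_top (lat a b). continuous_on (ball 0 r) (\<lambda>y. \<Sum>l\<in>X. G (y + l))"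
      proof (intro always_eventually allI continuous_on_sum)
        fix l
        show "continuous_on (ball 0 r) (\<lambda>y. G (y + l))"
          by (rule continuous_on_compose2[OF contG]) (auto intro!: continuous_intros)
      qed
    qed simp
    then show ?thesis by (simp add: periodize_def[abs_def])
  qed
  note cb = this
  have "isCont (periodize a b G) x" for x
  proof -
    have "continuous_on (ball 0 (norm x + 1)) (periodize a b G)" by (rule cb) (simp add: add_nonneg_pos)
    then show ?thesis by (rule continuous_on_interior) simp
  qed
  then show ?thesis by (simp add: continuous_on_eq_continuous_at)
qed

lemma periodize_periodic:
  assumes m: "m \<in> lat a b" shows "periodize a b G (x + m) = periodize a b G x"
proof -
  have "bij_betw (\<lambda>l. m + l) (lat a b) (lat a b)"
  proof (rule bij_betw_byWitness[where f'="\<lambda>l. l - m"])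
    show "(\<lambda>l. m + l) ` lat a b \<subseteq> lat a b" using lat_add[OF m] by auto
    show "(\<lambda>l. l - m) ` lat a b \<subseteq> lat a b" using lat_diff[OF _ m] by auto
  qed auto
  from infsum_reindex_bij_betw[OF this, of "\<lambda>l. G (x + l)"] show ?thesis
    by (simp add: periodize_def add.assoc)
qed

lemma lat_coords:
  assumes "Im (cnj a * b) \<noteq> 0"
  shows "x = of_real (- Im (cnj b * x) / Im (cnj a * b)) * a + of_real (Im (cnj a * x) / Im (cnj a * b)) * b"
proof -
  define D where "D = Im (cnj a * b)"
  have D: "D \<noteq> 0" using assms by (simp add: D_def)
  have 1: "x * of_real D = of_real (- Im (cnj b * x)) * a + of_real (Im (cnj a * x)) * b"
    by (simp add: D_def complex_eq_iff algebra_simps)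
  have "of_real (- Im (cnj b * x) / D) * a + of_real (Im (cnj a * x) / D) * b
      = (of_real (- Im (cnj b * x)) * a + of_real (Im (cnj a * x)) * b) / of_real D"
    by (simp only: of_real_divide times_divide_eq_left add_divide_distrib)
  also have "\<dots> = x" unfolding 1[symmetric] using D by simp
  finally show ?thesis by (simp add: D_def)
qed

lemma lat_reduce:
  assumes nd: "Im (cnj a * b) \<noteq> 0"
  shows "\<exists>s t. \<exists>l\<in>lat a b. 0 \<le> s \<and> s \<le> 1 \<and> 0 \<le> t \<and> t \<le> 1 \<and> x = of_real s * a + of_real t * b + l"
proof -
  define S where "S = - Im (cnj b * x) / Im (cnj a * b)"
  define T where "T = Im (cnj a * x) / Im (cnj a * b)"
  have "x = of_real S * a + of_real T * b" unfolding S_def T_def by (rule lat_coords[OF nd])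
  also have "\<dots> = of_real (frac S) * a + of_real (frac T) * b + (of_int \<lfloor>S\<rfloor> * a + of_int \<lfloor>T\<rfloor> * b)"
    by (simp add: frac_def algebra_simps)
  finally show ?thesis
    by (intro exI[of _ "frac S"] exI[of _ "frac T"] bexI[of _ "of_int \<lfloor>S\<rfloor> * a + of_int \<lfloor>T\<rfloor> * b"] conjI latI)
       (auto simp: less_imp_le[OF frac_lt_1])
qed

text \<open>A closed parallelogram, so representatives on its edges are ambiguous; in exchange it is
  compact, and continuous periodic functions are bounded through it.\<close>

definition cell :: "complex \<Rightarrow> complex \<Rightarrow> complex set" where
  "cell a b = (\<lambda>(s, t). of_real s * a + of_real t * b) ` ({0..1} \<times> {0..1})"

lemma compact_cell: "compact (cell a b)"
  unfolding cell_def case_prod_unfold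
  by (intro compact_continuous_image compact_Times compact_Icc continuous_intros)

lemma lat_reduce_cell:
  assumes "Im (cnj a * b) \<noteq> 0" obtains y l where "y \<in> cell a b" "l \<in> lat a b" "x = y + l"
proof -
  obtain s t l where "l \<in> lat a b" "0 \<le> s" "s \<le> 1" "0 \<le> t" "t \<le> 1" "x = of_real s * a + of_real t * b + l"
    using lat_reduce[OF assms, of x] by metis
  then show ?thesis by (intro that[of "of_real s * a + of_real t * b" l]) (auto simp: cell_def)
qed

lemma periodic_bounded:
  fixes h :: "complex \<Rightarrow> 'b::real_normed_vector"
  assumes nd: "Im (cnj a * b) \<noteq> 0" and c: "continuous_on UNIV h"
    and p: "\<And>l x. l \<in> lat a b \<Longrightarrow> h (x + l) = h x"
  obtains B where "B > 0" "\<And>x. norm (h x) \<le> B"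
proof -
  have "compact (h ` cell a b)"
    by (intro compact_continuous_image compact_cell continuous_on_subset[OF c]) auto
  then have "bounded (h ` cell a b)" by (rule compact_imp_bounded)
  then obtain B where B: "B > 0" "\<And>y. y \<in> cell a b \<Longrightarrow> norm (h y) \<le> B"
    unfolding bounded_pos by auto
  show ?thesis
  proof (rule that[OF B(1)])
    fix x
    obtain y l where "y \<in> cell a b" "l \<in> lat a b" "x = y + l" using lat_reduce_cell[OF nd] by metis
    then show "norm (h x) \<le> B" using B(2) p by simp
  qed
qed

text \<open>Unfolding against the periodised Gaussian instead of over a fundamental domain: both sides
  equal the sum over the lattice of the integrals of \<open>G w * h w * exp (- \<bar>w - l\<bar>\<^sup>2)\<close>.\<close>

lemma unfolding_gauss:
  fixes G h :: "complex \<Rightarrow> complex"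
  assumes nd: "Im (cnj a * b) \<noteq> 0" and G: "gauss_bounded G"
    and hm[measurable]: "h \<in> borel_measurable borel" and hb: "\<And>x. norm (h x) \<le> B"
    and hp: "\<And>l x. l \<in> lat a b \<Longrightarrow> h (x + l) = h x"
  shows "(LINT w|lborel. G w * h w * of_real (periodize a b (\<lambda>w. exp (- (norm w)\<^sup>2)) w))
       = (LINT w|lborel. periodize a b G w * h w * of_real (exp (- (norm w)\<^sup>2)))"
proof -
  define \<gamma> where "\<gamma> w = exp (- (norm (w::complex))\<^sup>2)" for w
  obtain C \<epsilon> where C: "C > 0" "\<epsilon> > 0" "\<epsilon> \<le> 1" "\<And>w. norm (G w) \<le> C * exp (- \<epsilon> * (norm w)\<^sup>2)"
    using gauss_boundedE[OF G] by metis
  have B0: "B \<ge> 0" using hb[of 0] norm_ge_zero order_trans by blast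
  have Gm[measurable]: "G \<in> borel_measurable borel"
    using G by (auto simp: gauss_bounded_def intro: borel_measurable_continuous_onI)
  have \<gamma>m[measurable]: "\<gamma> \<in> borel_measurable borel" unfolding \<gamma>_def[abs_def] by measurable
  have \<gamma>g: "gauss_bounded \<gamma>"
    unfolding gauss_bounded_def \<gamma>_def by (intro conjI exI[of _ 1]) (auto intro!: continuous_intros)
  have inf: "infinite (lat a b)"
  proof
    assume fin: "finite (lat a b)"
    have "inj (\<lambda>n::nat. of_nat n * a)"
      using nd by (auto intro!: injI)
    moreover have "range (\<lambda>n::nat. of_nat n * a) \<subseteq> lat a b"
      using latI[of "int _" a 0 b] by auto
    ultimately show False using fin by (metis finite_subset finite_imageD infinite_UNIV_nat)
  qed
  obtain e :: "nat \<Rightarrow> complex" where e: "bij_betw e UNIV (lat a b)"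
    using inf lat_countable by (metis countableE_infinite bij_betw_inv_into)
  have el: "e k \<in> lat a b" for k using e by (auto simp: bij_betw_def)
  have um: "bij_betw uminus (lat a b) (lat a b)"
  proof (rule bij_betw_byWitness[where f'=uminus])
    show "uminus ` lat a b \<subseteq> lat a b" using lat_uminus by auto
  qed (use lat_uminus in auto)
  have e': "bij_betw (\<lambda>k. - e k) UNIV (lat a b)"
    using bij_betw_trans[OF e um] by (simp add: o_def)
  have ps: "(\<lambda>k. H (x - e k)) sums periodize a b H x" "summable (\<lambda>k. norm (H (x - e k)))"
    if H: "gauss_bounded H" for H :: "complex \<Rightarrow> 'c::banach" and x
  proof -
    note s = gauss_bounded_abs_summable[OF nd H, of x]
    have "((\<lambda>l. H (x + l)) has_sum periodize a b H x) (lat a b)"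
      unfolding periodize_def using abs_summable_summable[OF s] by (rule has_sum_infsum)
    then have "((\<lambda>k. H (x + - e k)) has_sum periodize a b H x) UNIV"
      by (subst (asm) has_sum_reindex_bij_betw[OF e', symmetric])
    then show "(\<lambda>k. H (x - e k)) sums periodize a b H x" by (auto dest: has_sum_imp_sums)
    have "(\<lambda>k. norm (H (x + - e k))) summable_on UNIV"
      using s by (subst (asm) summable_on_reindex_bij_betw[OF e', symmetric])
    then show "summable (\<lambda>k. norm (H (x - e k)))" by (auto dest: summable_on_imp_summable)
  qed
  define f where "f k w = G w * h w * of_real (\<gamma> (w - e k))" for k w
  define f' where "f' k w = G (w - e k) * h w * of_real (\<gamma> w)" for k w
  have fm[measurable]: "f k \<in> borel_measurable borel" "f' k \<in> borel_measurable borel" for k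
    unfolding f_def f'_def by measurable
  \<comment> \<open>Half of the decay of G is kept for the integral over w. The other half, together
    with the Gaussian at w - e k, pays for summability over the lattice; this is where \<epsilon>
    \<le> 1 enters.\<close>
  have nf: "norm (f k w) \<le> C * B * exp (- (\<epsilon> / 2) * (norm w)\<^sup>2) * exp (- (\<epsilon> / 4) * (norm (e k))\<^sup>2)" for k w
  proof -
    have "(norm (e k))\<^sup>2 \<le> 2 * (norm w)\<^sup>2 + 2 * (norm (w - e k))\<^sup>2"
      using norm_add_sq_le[of w "e k - w"] by (simp add: norm_minus_commute)
    then have "\<epsilon> / 4 * (norm (e k))\<^sup>2 \<le> \<epsilon> / 4 * (2 * (norm w)\<^sup>2 + 2 * (norm (w - e k))\<^sup>2)"
      using C by (intro mult_left_mono) auto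
    moreover have "\<epsilon> / 2 * (norm (w - e k))\<^sup>2 \<le> 1 * (norm (w - e k))\<^sup>2"
      using C by (intro mult_right_mono) auto
    ultimately have "- \<epsilon> * (norm w)\<^sup>2 + - (norm (w - e k))\<^sup>2 \<le> - (\<epsilon> / 2) * (norm w)\<^sup>2 + - (\<epsilon> / 4) * (norm (e k))\<^sup>2"
      by (simp add: algebra_simps)
    then have E: "exp (- \<epsilon> * (norm w)\<^sup>2) * \<gamma> (w - e k) \<le> exp (- (\<epsilon> / 2) * (norm w)\<^sup>2) * exp (- (\<epsilon> / 4) * (norm (e k))\<^sup>2)"
      unfolding \<gamma>_def mult_exp_exp by simp
    have "norm (f k w) = norm (G w) * norm (h w) * \<gamma> (w - e k)"
      by (simp add: f_def norm_mult \<gamma>_def)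
    also have "\<dots> \<le> (C * exp (- \<epsilon> * (norm w)\<^sup>2)) * B * \<gamma> (w - e k)"
      using C B0 by (intro mult_right_mono mult_mono C hb) (auto simp: \<gamma>_def)
    also have "\<dots> = C * B * (exp (- \<epsilon> * (norm w)\<^sup>2) * \<gamma> (w - e k))" by simp
    also have "\<dots> \<le> C * B * (exp (- (\<epsilon> / 2) * (norm w)\<^sup>2) * exp (- (\<epsilon> / 4) * (norm (e k))\<^sup>2))"
      using E C B0 by (intro mult_left_mono) auto
    finally show ?thesis by simp
  qed
  have fi: "integrable lborel (f k)" for k
  proof (rule Bochner_Integration.integrable_bound)
    show "integrable lborel (\<lambda>w::complex. C * B * exp (- (\<epsilon> / 2) * (norm w)\<^sup>2) * exp (- (\<epsilon> / 4) * (norm (e k))\<^sup>2))"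
      using C by (intro integrable_mult_right integrable_mult_left gauss_integrable) auto
    show "AE w in lborel. norm (f k w) \<le> norm (C * B * exp (- (\<epsilon> / 2) * (norm w)\<^sup>2) * exp (- (\<epsilon> / 4) * (norm (e k))\<^sup>2))"
      by (rule AE_I2, rule order_trans[OF nf]) simp
  qed simp
  have hh: "h (w - e k) = h w" for k w
    using hp[OF lat_uminus[OF el[of k]], of w] by simp
  \<comment> \<open>The permutation of the indices that realises l -> - l, so that
    \<open>f' k\<close> is a translate of \<open>f (j k)\<close>.\<close>
  obtain j where j: "\<And>k. e (j k) = - e k" and jb: "bij j"
  proof -
    have "bij_betw (inv_into UNIV e \<circ> (\<lambda>k. - e k)) UNIV UNIV"
      by (rule bij_betw_trans[OF e' bij_betw_inv_into[OF e]])
    moreover have "e (inv_into UNIV e (- e k)) = - e k" for k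
      using e lat_uminus[OF el[of k]] by (metis bij_betw_inv_into_right)
    ultimately show ?thesis using that[of "inv_into UNIV e \<circ> (\<lambda>k. - e k)"] by simp
  qed
  have f'eq: "f' k = (\<lambda>w. f (j k) (w + - e k))" for k
    by (rule ext) (simp add: f_def f'_def j hh)
  have f'i: "integrable lborel (f' k)" for k
  proof -
    have "integrable (distr lborel borel ((+) (- e k))) (f (j k))" by (simp add: lborel_distr_plus fi)
    then have "integrable lborel (\<lambda>w. f (j k) (- e k + w))" by (subst (asm) integrable_distr_eq) auto
    then show ?thesis by (simp add: f'eq add.commute)
  qed
  have int1: "(LINT w|lborel. f' k w) = (LINT w|lborel. f (j k) w)" for k
    unfolding f'eq by (rule integral_translate) simp
  have int2: "(LINT w|lborel. norm (f' k w)) = (LINT w|lborel. norm (f (j k) w))" for k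
    unfolding f'eq by (rule integral_translate[where f="\<lambda>w. norm (f (j k) w)"]) simp
  have es: "(\<lambda>k. exp (- t * (norm (e k))\<^sup>2)) summable_on UNIV" if "t > 0" for t
    using gauss_summable_on_lat[OF nd that, of 0] by (subst (asm) summable_on_reindex_bij_betw[OF e, symmetric]) simp
  have nsum: "(\<lambda>k. LINT w|lborel. norm (f k w)) summable_on UNIV"
  proof (rule summable_on_comparison_test)
    define I where "I = (LINT w|lborel. C * B * exp (- (\<epsilon> / 2) * (norm (w::complex))\<^sup>2))"
    show "(\<lambda>k. I * exp (- (\<epsilon> / 4) * (norm (e k))\<^sup>2)) summable_on UNIV"
      using C by (intro summable_on_cmult_right es) auto
    show "(LINT w|lborel. norm (f k w)) \<le> I * exp (- (\<epsilon> / 4) * (norm (e k))\<^sup>2)" for k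
    proof -
      have "(LINT w|lborel. norm (f k w)) \<le> (LINT w|lborel. C * B * exp (- (\<epsilon> / 2) * (norm (w::complex))\<^sup>2) * exp (- (\<epsilon> / 4) * (norm (e k))\<^sup>2))"
        using C nf fi by (intro Bochner_Integration.integral_mono integrable_norm integrable_mult_right integrable_mult_left gauss_integrable) auto
      then show ?thesis by (simp add: I_def)
    qed
  qed simp
  have nsum': "(\<lambda>k. LINT w|lborel. norm (f (j k) w)) summable_on UNIV"
    using nsum by (subst summable_on_reindex_bij_betw[OF jb])
  have f1: "(LINT w|lborel. (\<Sum>k. f k w)) = (\<Sum>k. LINT w|lborel. f k w)"
  proof (rule integral_suminf[OF fi])
    show "AE w in lborel. summable (\<lambda>k. norm (f k w))"
      using ps(2)[OF \<gamma>g] by (intro AE_I2) (auto simp: f_def norm_mult intro!: summable_mult)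
    show "summable (\<lambda>k. LINT w|lborel. norm (f k w))" using nsum by (rule summable_on_imp_summable)
  qed
  have f2: "(LINT w|lborel. (\<Sum>k. f' k w)) = (\<Sum>k. LINT w|lborel. f' k w)"
  proof (rule integral_suminf[OF f'i])
    show "AE w in lborel. summable (\<lambda>k. norm (f' k w))"
      using ps(2)[OF G] by (intro AE_I2) (auto simp: f'_def norm_mult intro!: summable_mult2)
    show "summable (\<lambda>k. LINT w|lborel. norm (f' k w))"
      unfolding int2 using nsum' by (rule summable_on_imp_summable)
  qed
  have ias: "(\<lambda>k. norm (LINT w|lborel. f k w)) summable_on UNIV"
    by (rule summable_on_comparison_test[OF nsum]) (use integral_norm_bound in auto)
  have "(\<Sum>k. LINT w|lborel. f' k w) = (\<Sum>k. LINT w|lborel. f k w)"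
  proof -
    have s: "((\<lambda>k. LINT w|lborel. f k w) has_sum infsum (\<lambda>k. LINT w|lborel. f k w) UNIV) UNIV"
      using abs_summable_summable[OF ias] by (rule has_sum_infsum)
    then have "((\<lambda>k. LINT w|lborel. f (j k) w) has_sum infsum (\<lambda>k. LINT w|lborel. f k w) UNIV) UNIV"
      by (subst has_sum_reindex_bij_betw[OF jb])
    with s show ?thesis unfolding int1 by (metis has_sum_imp_sums sums_unique)
  qed
  moreover have "(\<Sum>k. f k w) = G w * h w * of_real (periodize a b \<gamma> w)" for w
    unfolding f_def using ps(1)[OF \<gamma>g, of w] by (intro sums_unique[symmetric] sums_mult sums_of_real)
  moreover have "(\<Sum>k. f' k w) = periodize a b G w * h w * of_real (\<gamma> w)" for w
    unfolding f'_def using ps(1)[OF G, of w] by (intro sums_unique[symmetric] sums_mult2)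
  ultimately show ?thesis using f1 f2 by (simp add: \<gamma>_def[abs_def])
qed

section \<open>Characters of the torus and trigonometric approximation\<close>

definition chr :: "complex \<Rightarrow> complex \<Rightarrow> complex" where
  "chr \<mu> w = exp (of_real pi * (\<mu> * cnj w - cnj \<mu> * w))"

text \<open>The lattice dual under the symplectic pairing Im (cnj \<mu> * w) that underlies
  \<open>chr\<close>. For this pairing duality is division by the signed cell area, so the cell area
  of the dual is the inverse.\<close>

definition adj_lat :: "complex \<Rightarrow> complex \<Rightarrow> complex set" where
  "adj_lat a b = lat (a / of_real (Im (cnj a * b))) (b / of_real (Im (cnj a * b)))"

lemma chr_eq: "chr \<mu> w = exp (- (2 * of_real pi * \<i> * of_real (Im (cnj \<mu> * w))))"
proof -
  have "\<mu> * cnj w - cnj \<mu> * w = - (2 * \<i> * of_real (Im (cnj \<mu> * w)))"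
    by (simp add: complex_eq_iff algebra_simps)
  then show ?thesis unfolding chr_def by (simp add: mult_ac)
qed

lemma chr_add: "chr \<mu> (w + v) = chr \<mu> w * chr \<mu> v"
  by (simp add: chr_def mult_exp_exp algebra_simps)

lemma chr_add_left: "chr (\<mu> + \<nu>) w = chr \<mu> w * chr \<nu> w"
  by (simp add: chr_def mult_exp_exp algebra_simps)

lemma chr_uminus: "chr (- \<mu>) w = cnj (chr \<mu> w)"
  by (simp add: chr_def exp_cnj algebra_simps)

lemma chr_0 [simp]: "chr 0 w = 1" "chr \<mu> 0 = 1"
  by (simp_all add: chr_def)

lemma norm_chr [simp]: "norm (chr \<mu> w) = 1"
  by (simp add: chr_eq)

lemma continuous_chr [continuous_intros]: "continuous_on S (chr \<mu>)"
  unfolding chr_def by (intro continuous_intros)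

lemma measurable_chr [measurable]: "chr \<mu> \<in> borel_measurable borel"
  by (intro borel_measurable_continuous_onI continuous_intros)

lemma chr_adj_lat:
  assumes nd: "Im (cnj a * b) \<noteq> 0" and \<mu>: "\<mu> \<in> adj_lat a b" and l: "l \<in> lat a b"
  shows "chr \<mu> l = 1"
proof -
  define D where "D = Im (cnj a * b)"
  have D: "D \<noteq> 0" using nd by (simp add: D_def)
  obtain p q where m: "\<mu> = of_int p * (a / of_real D) + of_int q * (b / of_real D)"
    using \<mu> unfolding adj_lat_def D_def[symmetric] by (elim latE) simp
  obtain r s where l: "l = of_int r * a + of_int s * b" using l by (elim latE) simp
  have "Im (cnj \<mu> * l) * D = Im (cnj (\<mu> * of_real D) * l)" by (simp add: algebra_simps)
  also have "\<mu> * of_real D = of_int p * a + of_int q * b" using D by (simp add: m field_simps)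
  also have "Im (cnj (of_int p * a + of_int q * b) * l) = of_int (p * s - q * r) * D"
    by (simp add: l D_def algebra_simps)
  finally have "Im (cnj \<mu> * l) * D = of_int (p * s - q * r) * D" .
  then have im: "Im (cnj \<mu> * l) = of_int (p * s - q * r)" by (rule mult_right_cancel[OF D, THEN iffD1])
  have "chr \<mu> l = exp (2 * of_real pi * \<i> * of_int (- (p * s - q * r)))"
    unfolding chr_eq im by (simp only: of_real_of_int_eq of_int_minus mult_minus_right)
  then show ?thesis unfolding exp_2pi_int .
qed

text \<open>Generated by monomials and sums alone; products stay in the class because characters
  multiply by adding frequencies.\<close>

inductive trig_poly :: "complex \<Rightarrow> complex \<Rightarrow> (complex \<Rightarrow> complex) \<Rightarrow> bool" for a b where
  trig_chr: "\<mu> \<in> adj_lat a b \<Longrightarrow> trig_poly a b (\<lambda>w. c * chr \<mu> w)"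
| trig_add: "trig_poly a b f \<Longrightarrow> trig_poly a b g \<Longrightarrow> trig_poly a b (\<lambda>w. f w + g w)"

lemma trig_const: "trig_poly a b (\<lambda>w. c)"
  using trig_chr[of 0 a b c] by (simp add: adj_lat_def)

lemma trig_mult:
  assumes "trig_poly a b f" "trig_poly a b g" shows "trig_poly a b (\<lambda>w. f w * g w)"
  using assms(1)
proof induction
  case (trig_chr \<mu> c)
  show ?case using assms(2)
  proof induction
    case (trig_chr \<nu> d)
    have m: "\<mu> + \<nu> \<in> adj_lat a b"
      using \<open>\<mu> \<in> adj_lat a b\<close> \<open>\<nu> \<in> adj_lat a b\<close> unfolding adj_lat_def by (rule lat_add)
    have eq: "(\<lambda>w. c * chr \<mu> w * (d * chr \<nu> w)) = (\<lambda>w. (c * d) * chr (\<mu> + \<nu>) w)"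
      by (rule ext) (simp add: chr_add_left)
    show ?case unfolding eq by (rule trig_poly.trig_chr[OF m])
  next
    case (trig_add f g)
    have eq: "(\<lambda>w. c * chr \<mu> w * (f w + g w)) = (\<lambda>w. c * chr \<mu> w * f w + c * chr \<mu> w * g w)"
      by (rule ext) (rule distrib_left)
    show ?case unfolding eq by (rule trig_poly.trig_add[OF trig_add.IH])
  qed
next
  case (trig_add f h)
  have eq: "(\<lambda>w. (f w + h w) * g w) = (\<lambda>w. f w * g w + h w * g w)"
    by (rule ext) (rule distrib_right)
  show ?case unfolding eq by (rule trig_poly.trig_add[OF trig_add.IH])
qed

lemma trig_chr_Re_Im:
  assumes "\<mu> \<in> adj_lat a b"
  shows "trig_poly a b (\<lambda>w. of_real (Re (chr \<mu> w)))" "trig_poly a b (\<lambda>w. of_real (Im (chr \<mu> w)))"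
proof -
  have m: "- \<mu> \<in> adj_lat a b" using assms by (simp add: adj_lat_def lat_uminus)
  have "(\<lambda>w. of_real (Re (chr \<mu> w))) = (\<lambda>w. 1/2 * chr \<mu> w + 1/2 * chr (- \<mu>) w)"
    by (auto simp: fun_eq_iff chr_uminus complex_eq_iff)
  then show "trig_poly a b (\<lambda>w. of_real (Re (chr \<mu> w)))"
    using trig_add[OF trig_chr[OF assms, of "1/2"] trig_chr[OF m, of "1/2"]] by simp
  have "(\<lambda>w. of_real (Im (chr \<mu> w))) = (\<lambda>w. (- \<i>/2) * chr \<mu> w + (\<i>/2) * chr (- \<mu>) w)"
    by (auto simp: fun_eq_iff chr_uminus complex_eq_iff)
  then show "trig_poly a b (\<lambda>w. of_real (Im (chr \<mu> w)))"
    using trig_add[OF trig_chr[OF assms, of "- \<i>/2"] trig_chr[OF m, of "\<i>/2"]] by simp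
qed

text \<open>Connects the real polynomials of the Stone-Weierstrass theorem with trigonometric
  polynomials: real coordinates of a character are combinations of the character and its conjugate,
  the character of the opposite frequency.\<close>

lemma trig_real_polynomial:
  assumes \<mu>: "\<mu> \<in> adj_lat a b" and \<nu>: "\<nu> \<in> adj_lat a b"
    and "real_polynomial_function (p :: complex \<times> complex \<Rightarrow> real)"
  shows "trig_poly a b (\<lambda>w. of_real (p (chr \<mu> w, chr \<nu> w)))"
  using assms(3)
proof induction
  case (linear f)
  interpret f: bounded_linear f by (rule linear)
  have fxy: "f (x, y) = Re x * f (1, 0) + Im x * f (\<i>, 0) + Re y * f (0, 1) + Im y * f (0, \<i>)" for x y
  proof -
    have "(x, y) = Re x *\<^sub>R (1, 0) + Im x *\<^sub>R (\<i>, 0) + Re y *\<^sub>R (0, 1) + Im y *\<^sub>R (0, \<i>)"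
      by (simp add: complex_eq_iff)
    then have "f (x, y) = f (Re x *\<^sub>R (1, 0) + Im x *\<^sub>R (\<i>, 0) + Re y *\<^sub>R (0, 1) + Im y *\<^sub>R (0, \<i>))" by (rule arg_cong)
    then show ?thesis by (simp only: f.add f.scaleR real_scaleR_def)
  qed
  have eq: "(\<lambda>w. of_real (f (chr \<mu> w, chr \<nu> w)) :: complex) = (\<lambda>w. of_real (Re (chr \<mu> w)) * of_real (f (1, 0)) + of_real (Im (chr \<mu> w)) * of_real (f (\<i>, 0))
    + of_real (Re (chr \<nu> w)) * of_real (f (0, 1)) + of_real (Im (chr \<nu> w)) * of_real (f (0, \<i>)))"
    by (rule ext, subst fxy) (simp only: of_real_add of_real_mult)
  show ?case unfolding eq
    by (intro trig_add trig_mult trig_chr_Re_Im \<mu> \<nu> trig_const)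
next
  case (const c)
  show ?case by (rule trig_const)
next
  case (add f g)
  show ?case unfolding of_real_add by (rule trig_add[OF add.IH])
next
  case (mult f g)
  show ?case unfolding of_real_mult by (rule trig_mult[OF mult.IH])
qed

lemma chr_eq_1_imp_int:
  assumes "chr \<mu> w = 1" shows "Im (cnj \<mu> * w) \<in> \<int>"
proof -
  define t where "t = Im (cnj \<mu> * w)"
  have "exp (- (2 * of_real pi * \<i> * of_real t)) = (1::complex)" using assms by (simp only: chr_eq t_def)
  then have "\<exists>n::int. Im (- (2 * of_real pi * \<i> * of_real t)) = of_int (2 * n) * pi"
    unfolding exp_eq_1 by (rule conjunct2)
  then obtain n :: int where "Im (- (2 * of_real pi * \<i> * of_real t)) = of_int (2 * n) * pi" by (rule exE)
  then have "pi * (t + of_int n) = 0" by (simp add: algebra_simps)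
  then have "t = of_int (- n)" by simp
  then show ?thesis by (simp only: t_def Ints_of_int)
qed

text \<open>The characters of the two dual generators embed the torus into C^2. A continuous
  periodic function becomes a continuous function on the compact image, where real polynomials are
  dense.\<close>

lemma trig_poly_dense:
  fixes h :: "complex \<Rightarrow> complex"
  assumes nd: "Im (cnj a * b) \<noteq> 0" and c: "continuous_on UNIV h"
    and p: "\<And>l x. l \<in> lat a b \<Longrightarrow> h (x + l) = h x" and \<epsilon>: "\<epsilon> > 0"
  shows "\<exists>T. trig_poly a b T \<and> (\<forall>w. norm (h w - T w) < \<epsilon>)"
proof -
  define D where "D = Im (cnj a * b)"
  have D: "D \<noteq> 0" using nd by (simp add: D_def)
  define \<mu> where "\<mu> = a / of_real D"
  define \<nu> where "\<nu> = b / of_real D"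
  have \<mu>: "\<mu> \<in> adj_lat a b" and \<nu>: "\<nu> \<in> adj_lat a b"
    by (simp_all add: adj_lat_def \<mu>_def \<nu>_def D_def)
  define E where "E w = (chr \<mu> w, chr \<nu> w)" for w
  have contE: "continuous_on S E" for S unfolding E_def by (intro continuous_intros)
  \<comment> \<open>Equal characters force the difference of the points to have integer coordinates,
    that is, to lie in the lattice.\<close>
  have Eeq: "h w = h w'" if "E w = E w'" for w w'
  proof -
    define v where "v = w - w'"
    have w: "w = w' + v" by (simp add: v_def)
    have nz: "chr \<mu> w' \<noteq> 0" "chr \<nu> w' \<noteq> 0" by (metis norm_chr norm_zero zero_neq_one)+
    have "chr \<mu> v = 1" "chr \<nu> v = 1" using that nz unfolding w E_def by (auto simp: chr_add)
    from this[THEN chr_eq_1_imp_int] have "Im (cnj \<mu> * v) \<in> \<int>" "Im (cnj \<nu> * v) \<in> \<int>" .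
    moreover have "Im (cnj \<mu> * v) = Im (cnj a * v) / D" "Im (cnj \<nu> * v) = Im (cnj b * v) / D"
      by (simp_all add: \<mu>_def \<nu>_def diff_divide_distrib add_divide_distrib)
    ultimately obtain m n :: int where mn: "Im (cnj a * v) / D = of_int m" "Im (cnj b * v) / D = of_int n"
      by (metis Ints_cases)
    have "v = of_real (- Im (cnj b * v) / D) * a + of_real (Im (cnj a * v) / D) * b"
      unfolding D_def by (rule lat_coords[OF nd])
    also have "- Im (cnj b * v) / D = of_int (- n)" unfolding minus_divide_left[symmetric] mn(2) by simp
    also note mn(1)
    finally have "v = of_int (- n) * a + of_int m * b" by simp
    then have "v \<in> lat a b" using latI[of "- n" a m b] by simp
    then show ?thesis unfolding w by (rule p)
  qed
  define K where "K = E ` cell a b"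
  define g where "g y = h (SOME w. w \<in> cell a b \<and> E w = y)" for y
  have gE: "g (E w) = h w" if "w \<in> cell a b" for w
  proof -
    have "E (SOME w'. w' \<in> cell a b \<and> E w' = E w) = E w"
      using that someI[of "\<lambda>w'. w' \<in> cell a b \<and> E w' = E w" w] by blast
    then show ?thesis unfolding g_def by (rule Eeq)
  qed
  have compK: "compact K" unfolding K_def by (intro compact_continuous_image compact_cell contE)
  have "continuous_on K g"
  \<comment> \<open>The graph of g is the image of the compact cell under (E, h), hence closed. This
    gives continuity although g is defined through an arbitrary choice of preimages.\<close>
  proof (rule continuous_from_closed_graph)
    show "compact (h ` cell a b)"
      by (intro compact_continuous_image compact_cell continuous_on_subset[OF c]) auto
    show "g \<in> K \<rightarrow> h ` cell a b" using gE by (auto simp: K_def)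
    have "(\<lambda>y. (y, g y)) ` K = (\<lambda>w. (E w, h w)) ` cell a b"
      unfolding K_def image_image using gE by (intro image_cong) auto
    moreover have "compact ((\<lambda>w. (E w, h w)) ` cell a b)"
      by (intro compact_continuous_image compact_cell continuous_on_Pair contE continuous_on_subset[OF c]) auto
    ultimately show "closed ((\<lambda>y. (y, g y)) ` K)" by (simp add: compact_imp_closed)
  qed
  from Stone_Weierstrass_polynomial_function[OF compK this \<epsilon>]
  obtain q where q: "polynomial_function q" "\<And>y. y \<in> K \<Longrightarrow> norm (g y - q y) < \<epsilon>" by blast
  have "real_polynomial_function (Re \<circ> q)" "real_polynomial_function (Im \<circ> q)"
    using q(1) bounded_linear_Re bounded_linear_Im by (auto simp: polynomial_function_def)
  from this[THEN trig_real_polynomial[OF \<mu> \<nu>]]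
  have t: "trig_poly a b (\<lambda>w. of_real (Re (q (E w))))" "trig_poly a b (\<lambda>w. of_real (Im (q (E w))))"
    by (simp_all add: E_def)
  have "trig_poly a b (\<lambda>w. of_real (Re (q (E w))) + \<i> * of_real (Im (q (E w))))"
    by (intro trig_add trig_mult trig_const t)
  moreover have "(\<lambda>w. of_real (Re (q (E w))) + \<i> * of_real (Im (q (E w)))) = (\<lambda>w. q (E w))"
    by (simp add: complex_eq_iff fun_eq_iff)
  ultimately have T: "trig_poly a b (\<lambda>w. q (E w))" by simp
  have "norm (h w - q (E w)) < \<epsilon>" for w
  proof -
    obtain y l where yl: "y \<in> cell a b" "l \<in> lat a b" "w = y + l" using lat_reduce_cell[OF nd] by metis
    have "E w = E y" using chr_adj_lat[OF nd \<mu> yl(2)] chr_adj_lat[OF nd \<nu> yl(2)] by (simp add: E_def yl(3) chr_add)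
    moreover have "h w = g (E y)" using p[OF yl(2)] gE[OF yl(1)] by (simp add: yl(3))
    ultimately show ?thesis using q(2)[of "E y"] yl(1) by (simp add: K_def)
  qed
  with T show ?thesis by (intro exI[of _ "\<lambda>w. q (E w)"] conjI allI)
qed

lemma gauss_bounded_shift:
  assumes "gauss_bounded G" shows "gauss_bounded (\<lambda>w. G (w + y))"
proof -
  obtain C \<epsilon> where C: "C > 0" "\<epsilon> > 0" "\<And>w. norm (G w) \<le> C * exp (- \<epsilon> * (norm w)\<^sup>2)"
    using gauss_boundedE[OF assms] by metis
  have "continuous_on UNIV G" using assms by (simp add: gauss_bounded_def)
  then have "continuous_on UNIV (\<lambda>w. G (w + y))"
    by (rule continuous_on_compose2) (auto intro!: continuous_intros)
  moreover have "norm (G (w + y)) \<le> (C * exp (\<epsilon> * (norm y)\<^sup>2)) * exp (- (\<epsilon> / 2) * (norm w)\<^sup>2)" for w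
    using order_trans[OF C(3)[of "y + w"] mult_left_mono[OF gauss_split_bound[OF C(2), of y w], of C]] C(1)
    by (simp add: add.commute)
  ultimately show ?thesis unfolding gauss_bounded_def using C(2)
    by (intro conjI exI[of _ "C * exp (\<epsilon> * (norm y)\<^sup>2)"] exI[of _ "\<epsilon> / 2"]) auto
qed

lemma gauss_bounded_diff:
  assumes "gauss_bounded G" "gauss_bounded H" shows "gauss_bounded (\<lambda>w. G w - H w)"
proof -
  obtain C \<epsilon> where C: "C > 0" "\<epsilon> > 0" "\<And>w. norm (G w) \<le> C * exp (- \<epsilon> * (norm w)\<^sup>2)"
    using gauss_boundedE[OF assms(1)] by metis
  obtain C' \<epsilon>' where C': "C' > 0" "\<epsilon>' > 0" "\<And>w. norm (H w) \<le> C' * exp (- \<epsilon>' * (norm w)\<^sup>2)"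
    using gauss_boundedE[OF assms(2)] by metis
  have "norm (G w - H w) \<le> (C + C') * exp (- min \<epsilon> \<epsilon>' * (norm w)\<^sup>2)" for w
  proof -
    have "norm (G w - H w) \<le> C * exp (- \<epsilon> * (norm w)\<^sup>2) + C' * exp (- \<epsilon>' * (norm w)\<^sup>2)"
      using C(3)[of w] C'(3)[of w] norm_triangle_ineq4[of "G w" "H w"] by linarith
    also have "\<dots> \<le> C * exp (- min \<epsilon> \<epsilon>' * (norm w)\<^sup>2) + C' * exp (- min \<epsilon> \<epsilon>' * (norm w)\<^sup>2)"
      using C C' by (intro add_mono mult_left_mono) (auto intro!: mult_right_mono)
    finally show ?thesis by (simp add: algebra_simps)
  qed
  moreover have "continuous_on UNIV (\<lambda>w. G w - H w)"
    using assms by (intro continuous_intros) (auto simp: gauss_bounded_def)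
  ultimately show ?thesis unfolding gauss_bounded_def using C C'
    by (intro conjI exI[of _ "C + C'"] exI[of _ "min \<epsilon> \<epsilon>'"]) auto
qed

lemma gauss_bounded_mult_integrable:
  fixes G h :: "complex \<Rightarrow> complex"
  assumes "gauss_bounded G" "h \<in> borel_measurable borel" "\<And>w. norm (h w) \<le> B"
  shows "integrable lborel (\<lambda>w. G w * h w)"
proof (rule Bochner_Integration.integrable_bound)
  show "integrable lborel (\<lambda>w. B * norm (G w))"
    using gauss_bounded_integrable[OF assms(1)] by auto
  have "G \<in> borel_measurable borel"
    using assms by (auto simp: gauss_bounded_def intro: borel_measurable_continuous_onI)
  then show "(\<lambda>w. G w * h w) \<in> borel_measurable lborel" using assms(2) by simp
  show "AE w in lborel. norm (G w * h w) \<le> norm (B * norm (G w))"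
  proof (rule AE_I2)
    fix w
    have "norm (G w * h w) \<le> B * norm (G w)"
      using mult_right_mono[OF assms(3)[of w], of "norm (G w)"] by (simp add: norm_mult mult.commute)
    then show "norm (G w * h w) \<le> norm (B * norm (G w))" by (rule order_trans) simp
  qed
qed

lemma trig_poly_bounded:
  assumes "trig_poly a b T"
  shows "continuous_on UNIV T \<and> (\<exists>B. \<forall>w. norm (T w) \<le> B)"
  using assms
proof induction
  case (trig_chr \<mu> c)
  then show ?case by (auto simp: norm_mult intro!: continuous_intros exI[of _ "norm c"])
next
  case (trig_add f g)
  then obtain B B' where "\<forall>w. norm (f w) \<le> B" "\<forall>w. norm (g w) \<le> B'" by metis
  then have "\<forall>w. norm (f w + g w) \<le> B + B'" by (metis add_mono norm_triangle_le)
  then show ?case using trig_add by (intro conjI continuous_on_add exI[of _ "B + B'"]) auto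
qed

text \<open>Orthogonality passes from characters to trigonometric polynomials by linearity, and to h
  by uniform approximation, since G is integrable.\<close>

lemma orthogonal_characters_imp_periodic:
  fixes G h :: "complex \<Rightarrow> complex"
  assumes nd: "Im (cnj a * b) \<noteq> 0" and G: "gauss_bounded G"
    and o: "\<And>\<mu>. \<mu> \<in> adj_lat a b \<Longrightarrow> (LINT w|lborel. G w * chr \<mu> w) = 0"
    and c: "continuous_on UNIV h" and p: "\<And>l x. l \<in> lat a b \<Longrightarrow> h (x + l) = h x"
  shows "(LINT w|lborel. G w * h w) = 0"
proof -
  have T0: "(LINT w|lborel. G w * T w) = 0" if "trig_poly a b T" for T
    using that
  proof induction
    case (trig_chr \<mu> c)
    have "(LINT w|lborel. G w * (c * chr \<mu> w)) = (LINT w|lborel. c * (G w * chr \<mu> w))" by (simp add: mult_ac)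
    then show ?case using o[OF trig_chr] by simp
  next
    case (trig_add f g)
    have i: "integrable lborel (\<lambda>w. G w * f w)" if "trig_poly a b f" for f
      using trig_poly_bounded[OF that] gauss_bounded_mult_integrable[OF G] borel_measurable_continuous_onI by metis
    show ?case using trig_add i by (simp add: distrib_left)
  qed
  obtain B where hB: "\<And>x. norm (h x) \<le> B" using periodic_bounded[OF nd c p] by metis
  define N where "N = (LINT w|lborel. norm (G w))"
  have N0: "N \<ge> 0" by (simp add: N_def)
  have hm: "h \<in> borel_measurable borel" using c by (rule borel_measurable_continuous_onI)
  have "norm (LINT w|lborel. G w * h w) \<le> \<epsilon>" if \<epsilon>: "\<epsilon> > 0" for \<epsilon>
  proof -
    define \<delta> where "\<delta> = \<epsilon> / (N + 1)"
    have \<delta>: "\<delta> > 0" using \<epsilon> N0 by (simp add: \<delta>_def)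
    obtain T where T: "trig_poly a b T" "\<And>w. norm (h w - T w) < \<delta>"
      using trig_poly_dense[OF nd c p \<delta>] by metis
    obtain B' where TB: "\<And>w. norm (T w) \<le> B'" and cT: "continuous_on UNIV T" using trig_poly_bounded[OF T(1)] by metis
    have Tm: "T \<in> borel_measurable borel" using cT by (rule borel_measurable_continuous_onI)
    have "(LINT w|lborel. G w * h w) = (LINT w|lborel. G w * h w) - (LINT w|lborel. G w * T w)" by (simp add: T0[OF T(1)])
    also have "\<dots> = (LINT w|lborel. G w * h w - G w * T w)"
      by (rule Bochner_Integration.integral_diff[symmetric])
         (use gauss_bounded_mult_integrable[OF G hm hB] gauss_bounded_mult_integrable[OF G Tm TB] in auto)
    finally have "norm (LINT w|lborel. G w * h w) = norm (LINT w|lborel. G w * (h w - T w))" by (simp add: right_diff_distrib)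
    also have "\<dots> \<le> (LINT w|lborel. norm (G w * (h w - T w)))" by (rule integral_norm_bound)
    also have "\<dots> \<le> (LINT w|lborel. \<delta> * norm (G w))"
    proof (rule Bochner_Integration.integral_mono)
      show "integrable lborel (\<lambda>w. norm (G w * (h w - T w)))"
        by (intro integrable_norm gauss_bounded_mult_integrable[OF G, where B=\<delta>] borel_measurable_diff hm Tm less_imp_le[OF T(2)])
      show "integrable lborel (\<lambda>w. \<delta> * norm (G w))" using gauss_bounded_integrable[OF G] by auto
      show "norm (G w * (h w - T w)) \<le> \<delta> * norm (G w)" for w
        using mult_right_mono[OF less_imp_le[OF T(2)[of w]], of "norm (G w)"] by (simp add: norm_mult mult.commute)
    qed
    also have "\<dots> = \<delta> * N" by (simp add: N_def)
    also have "\<dots> \<le> \<epsilon>" using \<epsilon> N0 by (simp add: \<delta>_def field_simps)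
    finally show ?thesis .
  qed
  then have "norm (LINT w|lborel. G w * h w) \<le> 0" by (rule field_le_epsilon[of _ 0, simplified])
  then show ?thesis by simp
qed

lemma continuous_AE_zero:
  fixes f :: "complex \<Rightarrow> real"
  assumes c: "continuous_on UNIV f" and z: "AE w in lborel. f w = 0"
  shows "f x = 0"
proof (rule ccontr)
  assume "f x \<noteq> 0"
  have "open {w. f w \<noteq> 0}" using c by (intro open_Collect_neq) auto
  moreover have "x \<in> {w. f w \<noteq> 0}" using \<open>f x \<noteq> 0\<close> by simp
  ultimately obtain r where r: "r > 0" "ball x r \<subseteq> {w. f w \<noteq> 0}" by (rule openE)
  have "AE w in lborel. w \<notin> ball x r"
    by (rule eventually_mono[OF z]) (use r(2) in blast)
  then have "emeasure lborel (ball x r) = 0" by (subst (asm) AE_iff_measurable[where N="ball x r"]) auto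
  moreover have "measure lborel (ball x r) > 0" using r by (metis content_ball_pos)
  ultimately show False by (simp add: measure_def)
qed

text \<open>When only the constant Fourier coefficient can be nonzero, the periodisation is
  constant: the periodisation of a difference of translates of G is orthogonal to itself. Unfolding
  against 1 / S then identifies the constant up to a factor depending on the lattice alone.\<close>

lemma poisson_summation:
  assumes nd: "Im (cnj a * b) \<noteq> 0"
  shows "\<exists>\<kappa>. \<forall>G :: complex \<Rightarrow> complex. gauss_bounded G \<longrightarrow> (\<forall>\<mu>\<in>adj_lat a b - {0}. (LINT w|lborel. G w * chr \<mu> w) = 0)
     \<longrightarrow> (\<forall>x. (LINT w|lborel. G w) = \<kappa> * periodize a b G x)"
proof -
  define \<gamma> where "\<gamma> w = exp (- (norm (w::complex))\<^sup>2)" for w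
  have \<gamma>g: "gauss_bounded \<gamma>"
    unfolding gauss_bounded_def \<gamma>_def by (intro conjI exI[of _ 1]) (auto intro!: continuous_intros)
  define S where "S = periodize a b \<gamma>"
  have Sc: "continuous_on UNIV S" unfolding S_def by (rule periodize_continuous[OF nd \<gamma>g])
  have Sp: "S (x + l) = S x" if "l \<in> lat a b" for l x unfolding S_def by (rule periodize_periodic[OF that])
  obtain m where m: "m > 0" "\<And>w. S w \<ge> m"
  proof -
    obtain R where R: "R > 0" "\<And>y. y \<in> cell a b \<Longrightarrow> norm y \<le> R"
      using compact_imp_bounded[OF compact_cell] unfolding bounded_pos by metis
    \<comment> \<open>One term suffices, namely the lattice point that moves w into the
      cell.\<close>
    have "S w \<ge> exp (- R\<^sup>2)" for w
    proof -
      obtain y l where yl: "y \<in> cell a b" "l \<in> lat a b" "w = y + l" using lat_reduce_cell[OF nd] by metis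
      have "S w = (\<Sum>\<^sub>\<infinity>l\<in>lat a b. \<gamma> (w + l))" by (simp add: S_def periodize_def)
      also have "\<dots> \<ge> (\<Sum>l\<in>{- l}. \<gamma> (w + l))"
        using gauss_bounded_abs_summable[OF nd \<gamma>g, of w] yl(2)
        by (intro finite_sum_le_infsum) (auto simp: \<gamma>_def lat_uminus)
      also have "(\<Sum>l\<in>{- l}. \<gamma> (w + l)) = exp (- (norm y)\<^sup>2)" by (simp add: \<gamma>_def yl(3))
      also have "\<dots> \<ge> exp (- R\<^sup>2)" using R(2)[OF yl(1)] by (auto intro!: power_mono)
      finally show ?thesis .
    qed
    then show ?thesis using that[of "exp (- R\<^sup>2)"] by auto
  qed
  have S0: "S w > 0" for w using m(1) m(2)[of w] by linarith
  have unf: "(LINT w|lborel. G w * h w * of_real (S w)) = (LINT w|lborel. periodize a b G w * h w * of_real (\<gamma> w))"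
    if "gauss_bounded G" "h \<in> borel_measurable borel" "\<And>x. norm (h x) \<le> B" "\<And>l x. l \<in> lat a b \<Longrightarrow> h (x + l) = h x"
    for G h :: "complex \<Rightarrow> complex" and B
    using unfolding_gauss[OF nd that] by (simp add: S_def \<gamma>_def[abs_def])
  \<comment> \<open>In effect the area of a cell, computed by weighting the plane with \<gamma> / S,
    whose translates by the lattice add up to 1.\<close>
  define \<kappa> :: complex where "\<kappa> = (LINT w|lborel. of_real (1 / S w) * of_real (\<gamma> w))"
  have main: "(LINT w|lborel. G w) = \<kappa> * periodize a b G x"
    if G: "gauss_bounded G" and o: "\<forall>\<mu>\<in>adj_lat a b - {0}. (LINT w|lborel. G w * chr \<mu> w) = 0" for G :: "complex \<Rightarrow> complex" and x
  proof -
    define P where "P = periodize a b G"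
    have Gm[measurable]: "G \<in> borel_measurable borel"
      using G by (auto simp: gauss_bounded_def intro: borel_measurable_continuous_onI)
    have Pc: "P (x + y) = P x" for x y
    proof -
      \<comment> \<open>The other coefficients of H vanish by assumption on G and the constant one
        by translation invariance, so H is orthogonal to all characters.\<close>
      define H where "H w = G (w + y) - G w" for w
      have H: "gauss_bounded H" unfolding H_def[abs_def]
        by (intro gauss_bounded_diff gauss_bounded_shift G)
      have Ho: "(LINT w|lborel. H w * chr \<mu> w) = 0" if \<mu>: "\<mu> \<in> adj_lat a b" for \<mu>
      proof -
        have i1: "integrable lborel (\<lambda>w. G (w + y) * chr \<mu> w)"
          by (rule gauss_bounded_mult_integrable[OF gauss_bounded_shift[OF G], of _ 1]) auto
        have i2: "integrable lborel (\<lambda>w. G w * chr \<mu> w)"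
          by (rule gauss_bounded_mult_integrable[OF G, of _ 1]) auto
        have "(LINT w|lborel. G (w + y) * chr \<mu> w) = (LINT w|lborel. chr \<mu> (- y) * (G (w + y) * chr \<mu> (w + y)))"
        proof (rule Bochner_Integration.integral_cong[OF refl])
          fix w
          have "chr \<mu> w = chr \<mu> (w + y) * chr \<mu> (- y)"
            using chr_add[of \<mu> "w + y" "- y"] by (simp only: add_diff_cancel_right' diff_conv_add_uminus[symmetric])
          then show "G (w + y) * chr \<mu> w = chr \<mu> (- y) * (G (w + y) * chr \<mu> (w + y))"
            by (simp only: mult_ac)
        qed
        also have "\<dots> = chr \<mu> (- y) * (LINT w|lborel. G (w + y) * chr \<mu> (w + y))" by simp
        also have "(LINT w|lborel. G (w + y) * chr \<mu> (w + y)) = (LINT w|lborel. G w * chr \<mu> w)"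
          by (rule integral_translate) simp
        finally have "(LINT w|lborel. H w * chr \<mu> w) = (chr \<mu> (- y) - 1) * (LINT w|lborel. G w * chr \<mu> w)"
          using i1 i2 by (simp add: H_def left_diff_distrib)
        then show ?thesis using o \<mu> by (cases "\<mu> = 0") auto
      qed
      define Q where "Q = periodize a b H"
      have Qc: "continuous_on UNIV Q" unfolding Q_def by (rule periodize_continuous[OF nd H])
      have Qp: "Q (x + l) = Q x" if "l \<in> lat a b" for l x unfolding Q_def by (rule periodize_periodic[OF that])
      obtain B where B: "\<And>x. norm (Q x) \<le> B" using periodic_bounded[OF nd Qc Qp] by metis
      \<comment> \<open>Testing H with cnj Q * S and unfolding produces the integral of |Q|^2
        against \<gamma>, which forces Q to vanish.\<close>
      have "(LINT w|lborel. H w * (cnj (Q w) * of_real (S w))) = 0"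
        by (rule orthogonal_characters_imp_periodic[OF nd H Ho])
           (auto intro!: continuous_intros Qc Sc simp: Qp Sp)
      moreover have "(LINT w|lborel. H w * cnj (Q w) * of_real (S w)) = (LINT w|lborel. Q w * cnj (Q w) * of_real (\<gamma> w))"
        unfolding Q_def
      proof (rule unf[OF H], unfold Q_def[symmetric])
        show "(\<lambda>w. cnj (Q w)) \<in> borel_measurable borel"
          using Qc by (intro borel_measurable_continuous_onI continuous_intros)
        show "norm (cnj (Q w)) \<le> B" for w using B by simp
      qed (simp add: Qp)
      moreover have "(LINT w|lborel. complex_of_real ((norm (Q w))\<^sup>2 * \<gamma> w)) = (LINT w|lborel. Q w * cnj (Q w) * of_real (\<gamma> w))"
        by (simp only: of_real_mult complex_norm_square)
      ultimately have "(LINT w|lborel. complex_of_real ((norm (Q w))\<^sup>2 * \<gamma> w)) = 0" by (simp only: mult.assoc)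
      then have z: "(LINT w|lborel. (norm (Q w))\<^sup>2 * \<gamma> w) = 0"
        by (subst (asm) integral_complex_of_real) (simp only: of_real_eq_0_iff)
      have qcont: "continuous_on UNIV (\<lambda>w. (norm (Q w))\<^sup>2 * \<gamma> w)"
        unfolding \<gamma>_def by (intro continuous_intros Qc)
      have qg: "gauss_bounded (\<lambda>w. (norm (Q w))\<^sup>2 * \<gamma> w)"
        unfolding gauss_bounded_def
      proof (rule conjI[OF qcont], rule exI[of _ "B\<^sup>2"], rule exI[of _ 1], intro conjI allI)
        fix w
        have "(norm (Q w))\<^sup>2 \<le> B\<^sup>2" using B by (intro power_mono) auto
        then show "norm ((norm (Q w))\<^sup>2 * \<gamma> w) \<le> B\<^sup>2 * exp (- 1 * (norm w)\<^sup>2)"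
          by (simp add: \<gamma>_def abs_mult)
      qed simp
      have "AE w in lborel. (norm (Q w))\<^sup>2 * \<gamma> w = 0"
        using z by (subst (asm) integral_nonneg_eq_0_iff_AE[OF gauss_bounded_integrable[OF qg]]) (auto simp: \<gamma>_def)
      then have "(norm (Q x))\<^sup>2 * \<gamma> x = 0" by (rule continuous_AE_zero[OF qcont])
      then have "Q x = 0" by (simp add: \<gamma>_def)
      moreover have "Q x = P (x + y) - P x"
      proof -
        have s1: "(\<lambda>l. G (x + l + y)) summable_on lat a b"
          using abs_summable_summable[OF gauss_bounded_abs_summable[OF nd gauss_bounded_shift[OF G]]] .
        have s2: "(\<lambda>l. G (x + l)) summable_on lat a b"
          using abs_summable_summable[OF gauss_bounded_abs_summable[OF nd G]] .
        
        have "((\<lambda>l. G (x + l + y) + - G (x + l)) has_sum ((\<Sum>\<^sub>\<infinity>l\<in>lat a b. G (x + l + y)) + - (\<Sum>\<^sub>\<infinity>l\<in>lat a b. G (x + l)))) (lat a b)"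
          by (intro has_sum_add has_sum_uminusI has_sum_infsum s1 s2)
        from infsumI[OF this] show ?thesis
          by (simp add: Q_def P_def periodize_def H_def add_ac)
      qed
      ultimately show ?thesis by simp
    qed
    \<comment> \<open>The factor 1 / S is periodic and bounded; inserted as h into the unfolding
      identity it leaves the plain integral of G on one side.\<close>
    have "(LINT w|lborel. G w) = (LINT w|lborel. G w * of_real (1 / S w) * of_real (S w))"
      using S0 by (intro Bochner_Integration.integral_cong) (auto simp: less_imp_neq[OF S0, symmetric])
    also have "\<dots> = (LINT w|lborel. P w * of_real (1 / S w) * of_real (\<gamma> w))"
      unfolding P_def
    proof (rule unf[OF G])
      have [measurable]: "S \<in> borel_measurable borel" using Sc by (rule borel_measurable_continuous_onI)
      show "(\<lambda>w. complex_of_real (1 / S w)) \<in> borel_measurable borel" by measurable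
      show "norm (complex_of_real (1 / S w)) \<le> 1 / m" for w
        using m(1) m(2)[of w] S0[of w] by (simp add: norm_divide frac_le)
    qed (use Sp in auto)
    also have "\<dots> = (LINT w|lborel. P x * (of_real (1 / S w) * of_real (\<gamma> w)))"
    proof (rule Bochner_Integration.integral_cong[OF refl])
      fix w
      have "P w = P x" using Pc[of x "w - x"] by simp
      then show "P w * of_real (1 / S w) * of_real (\<gamma> w) = P x * (of_real (1 / S w) * of_real (\<gamma> w))" by simp
    qed
    also have "\<dots> = P x * \<kappa>" unfolding \<kappa>_def by (rule integral_mult_right_zero)
    finally show ?thesis by (simp add: P_def mult.commute)
  qed
  show ?thesis by (rule exI[of _ \<kappa>]) (use main in auto)
qed

subsection \<open>Samples and the top coefficient\<close>

text \<open>On a disc, rotation invariance leaves only the term l = n - 1, through its value at 0,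
  multiplied by a radial moment. Moments grow with the disc, so the moment of the unit disc serves
  as N, and the bound survives the passage to the plane.\<close>

lemma gaussian_polyrep_integral:
  fixes \<theta> :: "nat \<Rightarrow> complex \<Rightarrow> complex"
  assumes n: "n \<ge> 1"
  shows "\<exists>N>0. \<forall>\<theta> H. (\<forall>l<n. \<theta> l holomorphic_on UNIV) \<longrightarrow> (\<forall>u. H u = (\<Sum>l<n. cnj u ^ l * (u ^ (n - 1) * \<theta> l u)))
     \<longrightarrow> integrable lborel (\<lambda>u. of_real (exp (- pi * (norm u)\<^sup>2)) * H u)
     \<longrightarrow> norm (\<theta> (n - 1) 0) * N \<le> norm (LINT u|lborel. of_real (exp (- pi * (norm u)\<^sup>2)) * H u)
       \<and> (\<theta> (n - 1) 0 = 0 \<longrightarrow> (LINT u|lborel. of_real (exp (- pi * (norm u)\<^sup>2)) * H u) = 0)"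
proof -
  define r where "r R x = (if 0 \<le> x \<and> x \<le> R then exp (- pi * x\<^sup>2) else 0)" for R x :: real
  have rm[measurable]: "r R \<in> borel_measurable borel" for R unfolding r_def[abs_def] by measurable
  have rb: "\<bar>r R x\<bar> \<le> 1" for R x by (simp add: r_def)
  have r0: "r R x \<ge> 0" for R x by (simp add: r_def)
  define r' where "r' R l x = r R x * x ^ (2 * l)" for R x l
  have r'm[measurable]: "r' R l \<in> borel_measurable borel" for R l unfolding r'_def[abs_def] by measurable
  have r'b: "\<bar>r' R l x\<bar> \<le> R ^ (2 * l)" if "R > 0" for R l x
  proof (cases "0 \<le> x \<and> x \<le> R")
    case True
    have "\<bar>r' R l x\<bar> = \<bar>r R x\<bar> * x ^ (2 * l)" using True by (simp add: r'_def abs_mult)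
    also have "\<dots> \<le> 1 * R ^ (2 * l)" using True rb by (intro mult_mono power_mono) auto
    finally show ?thesis by simp
  next
    case False
    then have "r' R l x = 0" unfolding r'_def r_def by (simp only: if_False mult_zero_left)
    then show ?thesis using that by simp
  qed
  have r'z: "r' R l x = 0" if "x > R" for R l x using that by (simp add: r'_def r_def)
  define J where "J R = (LINT u|lborel. r' R (n - 1) (norm (u::complex)))" for R
  have Ji: "integrable lborel (\<lambda>u. r' R (n - 1) (norm (u::complex)))" if "R > 0" for R
    by (rule integrable_ball_bounded[where R=R and B="R ^ (2 * (n - 1))"]) (use r'b[OF that] r'z in auto)
  have J1: "J 1 > 0"
  proof -
    define c where "c = exp (- pi) * (1 / 2) ^ (2 * (n - 1))"
    have c: "c > 0" by (simp add: c_def)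
    \<comment> \<open>A disc inside the annulus 1/2 \<le> |u| \<le> 1, on which the integrand is at
      least c.\<close>
    define B where "B = cball (3/4 :: complex) (1/8)"
    have "0 < c * measure lborel B" unfolding B_def using c content_cball_pos[of "1/8" "3/4::complex"] by simp
    also have "\<dots> = (LINT u|lborel. indicator B u * c)" by (simp add: B_def)
    also have "\<dots> \<le> J 1" unfolding J_def
    proof (rule Bochner_Integration.integral_mono)
      show "integrable lborel (\<lambda>u. indicator B u * c)" unfolding B_def
        by (intro integrable_mult_left integrable_real_indicator emeasure_bounded_finite) auto
      show "integrable lborel (\<lambda>u::complex. r' 1 (n - 1) (norm u))" by (rule Ji) simp
      fix u :: complex
      show "indicator B u * c \<le> r' 1 (n - 1) (norm u)"
      proof (cases "u \<in> B")
        case True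
        then have d: "norm (3/4 - u) \<le> 1/8" by (simp add: B_def dist_norm)
        have u: "1/2 \<le> norm u" "norm u \<le> 1"
          using d norm_triangle_ineq2[of "3/4" u] norm_triangle_ineq3[of "3/4" u] by (auto simp: abs_if split: if_splits)
        have "c \<le> exp (- pi * (norm u)\<^sup>2) * norm u ^ (2 * (n - 1))"
          unfolding c_def using u by (intro mult_mono power_mono) (auto simp: power_le_one)
        then show ?thesis using True u by (simp add: r'_def r_def)
      next
        case False
        then show ?thesis using r0 by (simp add: r'_def)
      qed
    qed
    finally show ?thesis .
  qed
  have J_mono: "J 1 \<le> J R" if "R \<ge> 1" for R
    unfolding J_def
  proof (rule Bochner_Integration.integral_mono[OF Ji Ji])
    show "r' 1 (n - 1) (norm u) \<le> r' R (n - 1) (norm u)" for u :: complex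
      using that by (auto simp: r'_def r_def intro!: mult_right_mono)
  qed (use that in auto)
  have "norm (\<theta> (n - 1) 0) * J 1 \<le> norm (LINT u|lborel. of_real (exp (- pi * (norm u)\<^sup>2)) * H u)
      \<and> (\<theta> (n - 1) 0 = 0 \<longrightarrow> (LINT u|lborel. of_real (exp (- pi * (norm u)\<^sup>2)) * H u) = 0)"
    if hol: "\<forall>l<n. \<theta> l holomorphic_on UNIV" and H: "\<forall>u. H u = (\<Sum>l<n. cnj u ^ l * (u ^ (n - 1) * \<theta> l u))"
      and int: "integrable lborel (\<lambda>u. of_real (exp (- pi * (norm u)\<^sup>2)) * H u)" for \<theta> and H :: "complex \<Rightarrow> complex"
  proof -
    define f where "f R u = of_real (r R (norm u)) * H u" for R and u :: complex
    have I: "(LINT u|lborel. f R u) = \<theta> (n - 1) 0 * of_real (J R)" if R: "R > 0" for R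
    proof -
      have hl: "(\<lambda>u. u ^ (n - 1 - l) * \<theta> l u) holomorphic_on UNIV" if "l < n" for l
        using hol that by (intro holomorphic_intros) auto
      \<comment> \<open>The product cnj u ^ l * u ^ l is absorbed into the radial weight
        \<open>r'\<close>. What remains is holomorphic and gets evaluated at 0, where u ^ (n - 1 -
        l) vanishes unless l = n - 1.\<close>
      note ri = radial_integral[OF r'm r'b[OF R] r'z R hl, where l=0]
      have term_eq: "of_real (r R (norm u)) * (cnj u ^ l * (u ^ (n - 1) * \<theta> l u))
          = of_real (r' R l (norm u)) * cnj u ^ 0 * (u ^ (n - 1 - l) * \<theta> l u)" if "l < n" for l u
      proof -
        have "cnj u * u = of_real ((norm u)\<^sup>2)" by (metis complex_norm_square mult.commute)
        then have "cnj u ^ l * u ^ l = of_real (norm u ^ (2 * l))"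
          by (metis of_real_power power_mult power_mult_distrib)
        moreover have "u ^ (n - 1) = u ^ l * u ^ (n - 1 - l)" using that by (simp flip: power_add)
        ultimately have "cnj u ^ l * u ^ (n - 1) = of_real (norm u ^ (2 * l)) * u ^ (n - 1 - l)"
          by (metis mult.assoc)
        then show ?thesis by (simp only: r'_def of_real_mult power_0 mult_1_right mult.assoc[symmetric])
      qed
      have "(LINT u|lborel. f R u) = (LINT u|lborel. (\<Sum>l<n. of_real (r' R l (norm u)) * cnj u ^ 0 * (u ^ (n - 1 - l) * \<theta> l u)))"
      proof (rule Bochner_Integration.integral_cong[OF refl])
        fix u
        have "f R u = (\<Sum>l<n. of_real (r R (norm u)) * (cnj u ^ l * (u ^ (n - 1) * \<theta> l u)))"
          unfolding f_def H[rule_format] by (rule sum_distrib_left)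
        also have "\<dots> = (\<Sum>l<n. of_real (r' R l (norm u)) * cnj u ^ 0 * (u ^ (n - 1 - l) * \<theta> l u))"
          by (rule sum.cong[OF refl]) (use term_eq in auto)
        finally show "f R u = (\<Sum>l<n. of_real (r' R l (norm u)) * cnj u ^ 0 * (u ^ (n - 1 - l) * \<theta> l u))" .
      qed
      also have "\<dots> = (\<Sum>l<n. LINT u|lborel. of_real (r' R l (norm u)) * cnj u ^ 0 * (u ^ (n - 1 - l) * \<theta> l u))"
        by (rule Bochner_Integration.integral_sum) (use ri(1) in auto)
      also have "\<dots> = (\<Sum>l<n. if l = n - 1 then \<theta> (n - 1) 0 * of_real (J R) else 0)"
      proof (rule sum.cong[OF refl])
        fix l assume "l \<in> {..<n}"
        then have l: "l < n" by simp
        show "(LINT u|lborel. of_real (r' R l (norm u)) * cnj u ^ 0 * (u ^ (n - 1 - l) * \<theta> l u)) = (if l = n - 1 then \<theta> (n - 1) 0 * of_real (J R) else 0)"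
          using ri(2)[OF _ l] l by (auto simp: J_def power_0_left)
      qed
      also have "\<dots> = \<theta> (n - 1) 0 * of_real (J R)" using n by simp
      finally show ?thesis .
    qed
    define A where "A = (LINT u|lborel. of_real (exp (- pi * (norm u)\<^sup>2)) * H u)"
    \<comment> \<open>Integrability over the plane supplies the dominating function that lets the
      discs exhaust it.\<close>
    have lim: "(\<lambda>k. LINT u|lborel. f (real (Suc k)) u) \<longlonglongrightarrow> A"
      unfolding A_def
    proof (rule integral_dominated_convergence)
      have Hm: "H \<in> borel_measurable borel"
      proof -
        have "H = (\<lambda>u. \<Sum>l<n. cnj u ^ l * (u ^ (n - 1) * \<theta> l u))" using H by (intro ext) simp
        moreover have "continuous_on UNIV \<dots>" using hol
          by (intro continuous_intros) (auto intro: holomorphic_on_imp_continuous_on)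
        ultimately show ?thesis by (simp add: borel_measurable_continuous_onI)
      qed
      show "(\<lambda>u. of_real (exp (- pi * (norm u)\<^sup>2)) * H u) \<in> borel_measurable lborel" using int by (rule borel_measurable_integrable)
      show "f (real (Suc k)) \<in> borel_measurable lborel" for k unfolding f_def[abs_def] using Hm by simp
      show "integrable lborel (\<lambda>u. norm (of_real (exp (- pi * (norm u)\<^sup>2)) * H u))" using int by (rule integrable_norm)
      show "AE u in lborel. (\<lambda>k. f (real (Suc k)) u) \<longlonglongrightarrow> of_real (exp (- pi * (norm u)\<^sup>2)) * H u"
      proof (rule AE_I2)
        fix u :: complex
        obtain K :: nat where K: "norm u \<le> real K" using real_arch_simple by blast
        have "\<forall>\<^sub>F k in sequentially. f (real (Suc k)) u = of_real (exp (- pi * (norm u)\<^sup>2)) * H u"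
          using eventually_ge_at_top[of K] by eventually_elim (use K in \<open>auto simp: f_def r_def\<close>)
        then show "(\<lambda>k. f (real (Suc k)) u) \<longlonglongrightarrow> of_real (exp (- pi * (norm u)\<^sup>2)) * H u" by (rule tendsto_eventually)
      qed
      show "AE u in lborel. norm (f (real (Suc k)) u) \<le> norm (of_real (exp (- pi * (norm u)\<^sup>2)) * H u)" for k
        by (rule AE_I2) (auto simp: f_def r_def norm_mult)
    qed
    have ge: "norm (\<theta> (n - 1) 0) * J 1 \<le> norm (LINT u|lborel. f (real (Suc k)) u)" for k
    proof -
      have "norm (\<theta> (n - 1) 0) * J 1 \<le> norm (\<theta> (n - 1) 0) * \<bar>J (real (Suc k))\<bar>"
        using J_mono[of "real (Suc k)"] by (intro mult_left_mono) auto
      moreover have "real (Suc k) > 0" by simp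
      ultimately show ?thesis by (simp only: I norm_mult norm_of_real)
    qed
    have "norm (\<theta> (n - 1) 0) * J 1 \<le> norm A"
      by (rule tendsto_lowerbound[OF tendsto_norm[OF lim]]) (use ge in auto)
    moreover have "A = 0" if z: "\<theta> (n - 1) 0 = 0"
    proof -
      have "(LINT u|lborel. f (real (Suc k)) u) = 0" for k
        using I[of "real (Suc k)"] unfolding z by simp
      then have "(\<lambda>k. LINT u|lborel. f (real (Suc k)) u) = (\<lambda>k. 0)" by (intro ext)
      with lim have "(\<lambda>k. 0) \<longlonglongrightarrow> A" by (simp only:)
      then show ?thesis by (simp add: LIMSEQ_const_iff)
    qed
    ultimately show ?thesis by (simp add: A_def)
  qed
  then show ?thesis using J1 by (intro exI[of _ "J 1"] conjI allI impI) (erule (3) mp | assumption | blast)+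
qed

lemma norm_infsum_le_nn_integral:
  fixes f :: "'a \<Rightarrow> 'b::banach"
  assumes A: "countable A" and s: "(\<lambda>x. norm (f x)) summable_on A"
  shows "ennreal (norm (infsum f A)) \<le> (\<integral>\<^sup>+x. ennreal (norm (f x)) \<partial>count_space A)"
proof (cases "(\<integral>\<^sup>+x. ennreal (norm (f x)) \<partial>count_space A)")
  case (real K)
  have "norm (infsum f A) \<le> infsum (\<lambda>x. norm (f x)) A" by (rule norm_infsum_bound[OF s])
  also have "\<dots> \<le> K"
  proof (rule infsum_le_finite_sums[OF s])
    fix F assume F: "finite F" "F \<subseteq> A"
    have "ennreal (\<Sum>x\<in>F. norm (f x)) = (\<Sum>x\<in>F. ennreal (norm (f x)))" by (rule sum_ennreal[symmetric]) simp
    also have "\<dots> \<le> infsum (\<lambda>x. ennreal (norm (f x))) A"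
      using F by (subst nonneg_infsum_complete) (auto intro!: SUP_upper)
    also have "\<dots> = ennreal K" using real by (simp add: infsum_ennreal_eq_nn_integral[OF A])
    finally show "(\<Sum>x\<in>F. norm (f x)) \<le> K" using real(1) by simp
  qed
  finally show ?thesis using real by (simp add: ennreal_leI)
qed simp

lemma fock_norm2_fshift:
  assumes "F \<in> borel_measurable borel" shows "fock_norm2 (fshift a F) = fock_norm2 F"
proof -
  have "fock_norm2 (fshift a F) = (\<integral>\<^sup>+z. ennreal ((fmod F (z + a))\<^sup>2) \<partial>lborel)"
    by (simp only: fock_norm2_fmod fmod_fshift)
  also have "\<dots> = (\<integral>\<^sup>+z. ennreal ((fmod F z)\<^sup>2) \<partial>lborel)"
    by (rule nn_integral_translate) (use assms in measurable)
  finally show ?thesis by (simp only: fock_norm2_fmod)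
qed

text \<open>Pointwise, F grows at most like exp (pi / 2 * |w|^2) and g strictly slower, so the
  weight exp (- pi * |w|^2) leaves Gaussian decay at the rate pi / 2 * (1 - \<kappa>).\<close>

lemma polyrep_gauss_bounded:
  assumes F: "polyrep n \<phi> F" and fin: "fock_norm2 F < \<infinity>" and g: "g holomorphic_on UNIV"
    and gb: "\<And>w. norm (g w) \<le> C * exp (pi / 2 * \<kappa> * (norm w)\<^sup>2)" and \<kappa>: "\<kappa> < 1"
  shows "gauss_bounded (\<lambda>w. F w * g w * of_real (exp (- pi * (norm w)\<^sup>2)))"
proof -
  obtain C' where C': "C' > 0" "\<forall>F \<phi> z. polyrep n \<phi> F \<longrightarrow> ennreal ((fmod F z)\<^sup>2) \<le> ennreal C' * fock_norm2 F"
    using polyrep_fmod_bound by metis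
  obtain N where N: "N \<ge> 0" "fock_norm2 F = ennreal N" using fin by (cases "fock_norm2 F") auto
  define M where "M = sqrt (C' * N)"
  have M: "fmod F w \<le> M" for w
  proof -
    have "ennreal ((fmod F w)\<^sup>2) \<le> ennreal (C' * N)"
      using C'(2)[rule_format, OF F, of w] C'(1) N by (simp add: ennreal_mult)
    then have "(fmod F w)\<^sup>2 \<le> C' * N" using C'(1) N by (simp add: ennreal_le_iff)
    then show ?thesis unfolding M_def by (rule real_le_rsqrt)
  qed
  have "norm (F w * g w * of_real (exp (- pi * (norm w)\<^sup>2))) \<le> (M * C) * exp (- (pi / 2 * (1 - \<kappa>)) * (norm w)\<^sup>2)" for w
  proof -
    have e: "exp (- pi * (norm w)\<^sup>2) = exp (- pi * (norm w)\<^sup>2 / 2) * exp (- pi * (norm w)\<^sup>2 / 2)"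
      by (simp add: mult_exp_exp)
    have "norm (F w * g w * of_real (exp (- pi * (norm w)\<^sup>2))) = fmod F w * (norm (g w) * exp (- pi * (norm w)\<^sup>2 / 2))"
      unfolding e by (simp add: norm_mult fmod_def)
    also have "\<dots> \<le> M * ((C * exp (pi / 2 * \<kappa> * (norm w)\<^sup>2)) * exp (- pi * (norm w)\<^sup>2 / 2))"
      by (intro mult_mono M mult_right_mono gb) (auto intro!: order_trans[OF fmod_nonneg M])
    also have "\<dots> = (M * C) * (exp (pi / 2 * \<kappa> * (norm w)\<^sup>2) * exp (- pi * (norm w)\<^sup>2 / 2))" by simp
    also have "exp (pi / 2 * \<kappa> * (norm w)\<^sup>2) * exp (- pi * (norm w)\<^sup>2 / 2) = exp (- (pi / 2 * (1 - \<kappa>)) * (norm w)\<^sup>2)"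
      unfolding mult_exp_exp by (simp add: field_simps)
    finally show ?thesis .
  qed
  moreover have "continuous_on UNIV (\<lambda>w. F w * g w * of_real (exp (- pi * (norm w)\<^sup>2)))"
    using polyrep_continuous[OF F] holomorphic_on_imp_continuous_on[OF g] by (intro continuous_intros)
  moreover have "pi / 2 * (1 - \<kappa>) > 0" using \<kappa> by simp
  ultimately show ?thesis unfolding gauss_bounded_def by blast
qed

text \<open>The zeros of \<open>g\<close> on the adjoint lattice annihilate all terms of the Poisson summation formula
  for \<open>F * g * exp (- pi * \<bar>w\<bar>\<^sup>2)\<close> except the one at the origin, which only sees the top coefficient of \<open>F\<close>.\<close>

lemma top_coefficient_bound_0:
  assumes nd: "Im (cnj a * b) \<noteq> 0" and n: "n \<ge> 1" and \<kappa>: "\<kappa> < 1" and g: "g holomorphic_on UNIV"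
    and gb: "\<And>w. norm (g w) \<le> Cg * exp (pi / 2 * \<kappa> * (norm w)\<^sup>2)"
    and q0: "q0 holomorphic_on UNIV" "q0 0 \<noteq> 0" "\<And>w. g w = w ^ (n - 1) * q0 w"
    and q: "\<And>\<mu>. \<mu> \<in> adj_lat a b \<Longrightarrow> \<mu> \<noteq> 0 \<Longrightarrow> \<exists>q. q holomorphic_on UNIV \<and> (\<forall>u. g (u + \<mu>) = u ^ n * q u)"
  shows "\<exists>C>0. \<forall>F \<phi> x. polyrep n \<phi> F \<longrightarrow> fock_norm2 F < \<infinity> \<longrightarrow>
     ennreal (norm (\<phi> (n - 1) 0)) \<le> ennreal C * (\<integral>\<^sup>+l. ennreal (fmod F (x + l) * exp (- (pi / 2 * (1 - \<kappa>)) * (norm (x + l))\<^sup>2)) \<partial>count_space (lat a b))"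
proof -
  from gaussian_polyrep_integral[OF n, THEN exE] obtain N where N': "N > 0 \<and> (\<forall>\<theta> H. (\<forall>l<n. \<theta> l holomorphic_on UNIV) \<longrightarrow> (\<forall>u. H u = (\<Sum>l<n. cnj u ^ l * (u ^ (n - 1) * \<theta> l u)))
     \<longrightarrow> integrable lborel (\<lambda>u. of_real (exp (- pi * (norm u)\<^sup>2)) * H u)
     \<longrightarrow> norm (\<theta> (n - 1) 0) * N \<le> norm (LINT u|lborel. of_real (exp (- pi * (norm u)\<^sup>2)) * H u)
       \<and> (\<theta> (n - 1) 0 = 0 \<longrightarrow> (LINT u|lborel. of_real (exp (- pi * (norm u)\<^sup>2)) * H u) = 0))" .
  note N = conjunct1[OF N'] and gp = conjunct2[OF N', THEN spec, THEN spec, THEN mp, THEN mp, THEN mp]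
  from poisson_summation[OF nd, THEN exE] obtain k where k': "\<forall>G :: complex \<Rightarrow> complex. gauss_bounded G \<longrightarrow> (\<forall>\<mu>\<in>adj_lat a b - {0}. (LINT w|lborel. G w * chr \<mu> w) = 0)
     \<longrightarrow> (\<forall>x. (LINT w|lborel. G w) = k * periodize a b G x)" .
  note k = k'[THEN spec, THEN mp, THEN mp, THEN spec]
  define \<epsilon> where "\<epsilon> = pi / 2 * (1 - \<kappa>)"
  have Cg0: "Cg \<ge> 0"
  proof -
    have "norm (g 0) \<le> Cg" using gb[of 0] by simp
    then show ?thesis using norm_ge_zero order_trans by blast
  qed
  define c where "c = Cg + 1"
  have c: "c > 0" "Cg \<le> c" using Cg0 by (simp_all add: c_def)
  define C where "C = (norm k + 1) / (norm (q0 0) * N) * c"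
  have nk: "norm k + 1 > 0" by (simp add: add_nonneg_pos)
  have C: "C > 0" unfolding C_def using N q0(2) c nk by (intro mult_pos_pos divide_pos_pos) auto
  have "ennreal (norm (\<phi> (n - 1) 0)) \<le> ennreal C * (\<integral>\<^sup>+l. ennreal (fmod F (x + l) * exp (- \<epsilon> * (norm (x + l))\<^sup>2)) \<partial>count_space (lat a b))"
    if F: "polyrep n \<phi> F" and fin: "fock_norm2 F < \<infinity>" for F \<phi> x
  proof -
    define G where "G w = F w * g w * of_real (exp (- pi * (norm w)\<^sup>2))" for w
    have G: "gauss_bounded G" unfolding G_def[abs_def] by (rule polyrep_gauss_bounded[OF F fin g gb \<kappa>])
    have Gm[measurable]: "G \<in> borel_measurable borel"
      using G by (auto simp: gauss_bounded_def intro: borel_measurable_continuous_onI)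
    have orth: "(LINT w|lborel. G w * chr \<mu> w) = 0" if \<mu>: "\<mu> \<in> adj_lat a b - {0}" for \<mu>
    proof -
      obtain q where q: "q holomorphic_on UNIV" "\<And>u. g (u + \<mu>) = u ^ n * q u" using q \<mu> by blast
      obtain \<psi> where \<psi>: "polyrep n \<psi> (fshift \<mu> F)" using polyrep_fshift[OF F] by blast
      \<comment> \<open>The holomorphic exponential that remains once the factor contained in
        \<open>fshift\<close> has been taken out.\<close>
      define K where "K u = exp (- of_real (pi * (norm \<mu>)\<^sup>2 / 2) - of_real pi * cnj \<mu> * u)" for u
      \<comment> \<open>The extra factor u records that g vanishes at \<mu> to order n, one more
        than the u ^ (n - 1) that is split off; it makes \<open>\<theta> (n - 1)\<close> vanish at
        0.\<close>
      define \<theta> where "\<theta> l u = u * (q u * K u * \<psi> l u)" for l u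
      define H where "H u = fshift \<mu> F u * K u * g (u + \<mu>)" for u
      have \<theta>: "\<forall>l<n. \<theta> l holomorphic_on UNIV"
        unfolding \<theta>_def K_def using \<psi> q(1) by (auto simp: polyrep_def intro!: holomorphic_intros)
      have Heq: "\<forall>u. H u = (\<Sum>l<n. cnj u ^ l * (u ^ (n - 1) * \<theta> l u))"
      proof
        fix u :: complex
        have un: "u ^ n = u ^ (n - 1) * u" using n power_minus_mult[of n u] by simp
        have "H u = (\<Sum>l<n. cnj u ^ l * \<psi> l u) * (K u * (u ^ (n - 1) * u * q u))"
          using \<psi> by (simp add: H_def q(2) un polyrep_def mult_ac)
        also have "\<dots> = (\<Sum>l<n. cnj u ^ l * (u ^ (n - 1) * \<theta> l u))"
          unfolding sum_distrib_right by (rule sum.cong[OF refl]) (simp add: \<theta>_def mult_ac)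
        finally show "H u = (\<Sum>l<n. cnj u ^ l * (u ^ (n - 1) * \<theta> l u))" .
      qed
      \<comment> \<open>The character cancels the antiholomorphic factor exp (- pi * \<mu> * cnj u)
        of the translated weight, so the radial Gaussian multiplies a polyanalytic function of
        unchanged order.\<close>
      have GH: "G (u + \<mu>) * chr \<mu> (u + \<mu>) = of_real (exp (- pi * (norm u)\<^sup>2)) * H u" for u
      proof -
        have e1: "of_real (exp (- pi * (norm (u + \<mu>))\<^sup>2)) * chr \<mu> (u + \<mu>) =
            exp (- of_real pi * cnj \<mu> * u - of_real (pi * (norm \<mu>)\<^sup>2 / 2)) * K u * of_real (exp (- pi * (norm u)\<^sup>2))"
          unfolding chr_def K_def exp_of_real[symmetric] mult_exp_exp
        proof (rule arg_cong[where f=exp])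
          have n1: "complex_of_real ((norm z)\<^sup>2) = z * cnj z" for z by (rule complex_norm_square)
          show "complex_of_real (- pi * (norm (u + \<mu>))\<^sup>2) + of_real pi * (\<mu> * cnj (u + \<mu>) - cnj \<mu> * (u + \<mu>)) =
             - of_real pi * cnj \<mu> * u - of_real (pi * (norm \<mu>)\<^sup>2 / 2) + (- of_real (pi * (norm \<mu>)\<^sup>2 / 2) - of_real pi * cnj \<mu> * u) + of_real (- pi * (norm u)\<^sup>2)"
            unfolding of_real_mult of_real_divide n1 of_real_minus by (simp add: field_simps)
        qed
        have "G (u + \<mu>) * chr \<mu> (u + \<mu>) = F (u + \<mu>) * g (u + \<mu>) * (of_real (exp (- pi * (norm (u + \<mu>))\<^sup>2)) * chr \<mu> (u + \<mu>))"
          by (simp add: G_def mult_ac)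
        also have "\<dots> = of_real (exp (- pi * (norm u)\<^sup>2)) * H u"
          unfolding e1 by (simp add: H_def fshift_def mult_ac)
        finally show ?thesis .
      qed
      have "integrable lborel (\<lambda>w. G w * chr \<mu> w)"
        by (rule gauss_bounded_mult_integrable[OF G, of _ 1]) auto
      then have "integrable (distr lborel borel ((+) \<mu>)) (\<lambda>w. G w * chr \<mu> w)" by (simp only: lborel_distr_plus)
      then have "integrable lborel (\<lambda>u. G (\<mu> + u) * chr \<mu> (\<mu> + u))" by (subst (asm) integrable_distr_eq) auto
      then have "integrable lborel (\<lambda>u. of_real (exp (- pi * (norm u)\<^sup>2)) * H u)"
        unfolding GH[symmetric] by (simp only: add.commute)
      note gp[OF \<theta> Heq this]
      moreover have "\<theta> (n - 1) 0 = 0" by (simp add: \<theta>_def)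
      ultimately have "(LINT u|lborel. of_real (exp (- pi * (norm u)\<^sup>2)) * H u) = 0" by (rule conjunct2[THEN mp])
      then have "(LINT u|lborel. G (u + \<mu>) * chr \<mu> (u + \<mu>)) = 0" by (simp only: GH)
      moreover have "(LINT u|lborel. G (u + \<mu>) * chr \<mu> (u + \<mu>)) = (LINT w|lborel. G w * chr \<mu> w)"
        by (rule integral_translate) simp
      ultimately show ?thesis by simp
    qed
    have "norm (q0 0 * \<phi> (n - 1) 0) * N \<le> norm (LINT w|lborel. G w)"
    proof -
      have \<theta>: "\<forall>l<n. (\<lambda>u. q0 u * \<phi> l u) holomorphic_on UNIV"
        using F q0(1) by (auto simp: polyrep_def intro!: holomorphic_intros)
      have H: "\<forall>u. F u * g u = (\<Sum>l<n. cnj u ^ l * (u ^ (n - 1) * (q0 u * \<phi> l u)))"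
      proof
        fix u
        have "F u * g u = (\<Sum>l<n. cnj u ^ l * \<phi> l u) * (u ^ (n - 1) * q0 u)"
          using F by (simp add: polyrep_def q0(3))
        also have "\<dots> = (\<Sum>l<n. cnj u ^ l * (u ^ (n - 1) * (q0 u * \<phi> l u)))"
          unfolding sum_distrib_right by (rule sum.cong[OF refl]) (simp add: mult_ac)
        finally show "F u * g u = (\<Sum>l<n. cnj u ^ l * (u ^ (n - 1) * (q0 u * \<phi> l u)))" .
      qed
      have Geq: "G = (\<lambda>u. of_real (exp (- pi * (norm u)\<^sup>2)) * (F u * g u))" by (rule ext) (simp add: G_def)
      have "integrable lborel (\<lambda>u. of_real (exp (- pi * (norm u)\<^sup>2)) * (F u * g u))"
        using gauss_bounded_integrable[OF G] by (simp only: Geq)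
      from gp[OF \<theta> H this] show ?thesis by (simp only: Geq)
    qed
    also have "(LINT w|lborel. G w) = k * periodize a b G x" by (rule k[OF G]) (use orth in auto)
    finally have 1: "norm (q0 0 * \<phi> (n - 1) 0) * N \<le> norm k * norm (periodize a b G x)" by (simp only: norm_mult)
    have "norm (\<phi> (n - 1) 0) \<le> (norm k + 1) / (norm (q0 0) * N) * norm (periodize a b G x)"
    proof -
      have "norm (\<phi> (n - 1) 0) * (norm (q0 0) * N) \<le> norm k * norm (periodize a b G x)" using 1 by (simp add: norm_mult mult_ac)
      also have "\<dots> \<le> (norm k + 1) * norm (periodize a b G x)" by (intro mult_right_mono) auto
      finally show ?thesis using N q0(2) by (simp add: field_simps)
    qed
    then have "ennreal (norm (\<phi> (n - 1) 0)) \<le> ennreal ((norm k + 1) / (norm (q0 0) * N)) * ennreal (norm (periodize a b G x))"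
      using N by (simp add: ennreal_mult[symmetric] ennreal_leI)
    also have "ennreal (norm (periodize a b G x)) \<le> (\<integral>\<^sup>+l. ennreal (norm (G (x + l))) \<partial>count_space (lat a b))"
      unfolding periodize_def by (rule norm_infsum_le_nn_integral[OF lat_countable gauss_bounded_abs_summable[OF nd G]])
    also have "\<dots> \<le> (\<integral>\<^sup>+l. ennreal c * ennreal (fmod F (x + l) * exp (- \<epsilon> * (norm (x + l))\<^sup>2)) \<partial>count_space (lat a b))"
    proof (rule nn_integral_mono)
      fix l
      define w where "w = x + l"
      have e: "exp (- pi * (norm w)\<^sup>2) = exp (- pi * (norm w)\<^sup>2 / 2) * exp (- pi * (norm w)\<^sup>2 / 2)"
        by (simp add: mult_exp_exp)
      have "norm (G w) = fmod F w * (norm (g w) * exp (- pi * (norm w)\<^sup>2 / 2))"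
        unfolding G_def e by (simp add: norm_mult fmod_def)
      also have "\<dots> \<le> fmod F w * ((c * exp (pi / 2 * \<kappa> * (norm w)\<^sup>2)) * exp (- pi * (norm w)\<^sup>2 / 2))"
        using c by (intro mult_left_mono mult_right_mono order_trans[OF gb]) auto
      also have "\<dots> = c * (fmod F w * (exp (pi / 2 * \<kappa> * (norm w)\<^sup>2) * exp (- pi * (norm w)\<^sup>2 / 2)))" by simp
      also have "exp (pi / 2 * \<kappa> * (norm w)\<^sup>2) * exp (- pi * (norm w)\<^sup>2 / 2) = exp (- \<epsilon> * (norm w)\<^sup>2)"
        unfolding mult_exp_exp \<epsilon>_def by (simp add: field_simps)
      finally show "ennreal (norm (G (x + l))) \<le> ennreal c * ennreal (fmod F (x + l) * exp (- \<epsilon> * (norm (x + l))\<^sup>2))"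
        unfolding w_def[symmetric] using c by (simp add: ennreal_mult[symmetric] ennreal_leI)
    qed
    also have "\<dots> = ennreal c * (\<integral>\<^sup>+l. ennreal (fmod F (x + l) * exp (- \<epsilon> * (norm (x + l))\<^sup>2)) \<partial>count_space (lat a b))"
      by (rule nn_integral_cmult) simp
    finally have "ennreal (norm (\<phi> (n - 1) 0)) \<le> ennreal ((norm k + 1) / (norm (q0 0) * N)) * (ennreal c * (\<integral>\<^sup>+l. ennreal (fmod F (x + l) * exp (- \<epsilon> * (norm (x + l))\<^sup>2)) \<partial>count_space (lat a b)))"
      by (simp add: mult_left_mono)
    also have "\<dots> = ennreal C * (\<integral>\<^sup>+l. ennreal (fmod F (x + l) * exp (- \<epsilon> * (norm (x + l))\<^sup>2)) \<partial>count_space (lat a b))"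
      unfolding C_def mult.assoc[symmetric] using N c nk by (subst (2) ennreal_mult) auto
    finally show ?thesis .
  qed
  with C show ?thesis unfolding \<epsilon>_def by (intro exI[of _ C]) auto
qed

text \<open>The estimate at the origin is applied to \<open>fshift z F\<close>. Taking x = - z there
  keeps the samples of F on the lattice itself, although z is arbitrary.\<close>

lemma top_coefficient_bound:
  assumes nd: "Im (cnj a * b) \<noteq> 0" and n: "n \<ge> 1" and \<kappa>: "\<kappa> < 1" and g: "g holomorphic_on UNIV"
    and gb: "\<And>w. norm (g w) \<le> Cg * exp (pi / 2 * \<kappa> * (norm w)\<^sup>2)"
    and q0: "q0 holomorphic_on UNIV" "q0 0 \<noteq> 0" "\<And>w. g w = w ^ (n - 1) * q0 w"
    and q: "\<And>\<mu>. \<mu> \<in> adj_lat a b \<Longrightarrow> \<mu> \<noteq> 0 \<Longrightarrow> \<exists>q. q holomorphic_on UNIV \<and> (\<forall>u. g (u + \<mu>) = u ^ n * q u)"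
  shows "\<exists>C>0. \<forall>F \<phi> z. polyrep n \<phi> F \<longrightarrow> fock_norm2 F < \<infinity> \<longrightarrow>
     ennreal (fmod (\<phi> (n - 1)) z) \<le> ennreal C * (\<integral>\<^sup>+l. ennreal (fmod F l * exp (- (pi / 2 * (1 - \<kappa>)) * (norm (l - z))\<^sup>2)) \<partial>count_space (lat a b))"
proof -
  have "\<exists>C>0. \<forall>F \<phi> x. polyrep n \<phi> F \<longrightarrow> fock_norm2 F < \<infinity> \<longrightarrow>
     ennreal (norm (\<phi> (n - 1) 0)) \<le> ennreal C * (\<integral>\<^sup>+l. ennreal (fmod F (x + l) * exp (- (pi / 2 * (1 - \<kappa>)) * (norm (x + l))\<^sup>2)) \<partial>count_space (lat a b))"
    by (rule top_coefficient_bound_0[OF nd n \<kappa> g gb q0]) (rule q)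
  then obtain C where C': "C > 0 \<and> (\<forall>F \<phi> x. polyrep n \<phi> F \<longrightarrow> fock_norm2 F < \<infinity> \<longrightarrow>
     ennreal (norm (\<phi> (n - 1) 0)) \<le> ennreal C * (\<integral>\<^sup>+l. ennreal (fmod F (x + l) * exp (- (pi / 2 * (1 - \<kappa>)) * (norm (x + l))\<^sup>2)) \<partial>count_space (lat a b)))"
    by (rule exE)
  note C = conjunct1[OF C'] and b = conjunct2[OF C', rule_format]
  have "ennreal (fmod (\<phi> (n - 1)) z) \<le> ennreal C * (\<integral>\<^sup>+l. ennreal (fmod F l * exp (- (pi / 2 * (1 - \<kappa>)) * (norm (l - z))\<^sup>2)) \<partial>count_space (lat a b))"
    if F: "polyrep n \<phi> F" and fin: "fock_norm2 F < \<infinity>" for F \<phi> z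
  proof -
    obtain \<psi> where \<psi>: "polyrep n \<psi> (fshift z F)" "\<psi> (n - 1) = fshift z (\<phi> (n - 1))"
      using polyrep_fshift[OF F, of z] n by auto
    have fin': "fock_norm2 (fshift z F) < \<infinity>"
      using fin polyrep_continuous[OF F] by (subst fock_norm2_fshift) (auto intro: borel_measurable_continuous_onI)
    have "norm (\<psi> (n - 1) 0) = fmod (\<phi> (n - 1)) z"
      using fmod_fshift[of z "\<phi> (n - 1)" 0] unfolding \<psi>(2) by (simp add: fmod_def)
    with b[OF \<psi>(1) fin', of "- z"] show ?thesis by (simp add: fmod_fshift)
  qed
  with C show ?thesis by (intro exI[of _ C]) auto
qed

section \<open>Entire functions with prescribed zeros on a lattice\<close>

lemma holomorphic_shift:
  assumes "f holomorphic_on UNIV"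
  shows "(\<lambda>u. f (u + c)) holomorphic_on UNIV" "(\<lambda>u. f (c + u)) holomorphic_on UNIV"
proof -
  have "(f \<circ> (\<lambda>u. u + c)) holomorphic_on UNIV"
    by (rule holomorphic_on_compose_gen[where t=UNIV]) (use assms in \<open>auto intro!: holomorphic_intros\<close>)
  then show "(\<lambda>u. f (u + c)) holomorphic_on UNIV" "(\<lambda>u. f (c + u)) holomorphic_on UNIV"
    by (simp_all add: o_def add.commute)
qed

text \<open>The local cofactor at z0 and the quotient f w / (w - z0) ^ m away from z0 agree where
  both are defined and glue to an entire function.\<close>

lemma entire_factor_zero:
  assumes f: "f holomorphic_on UNIV" and z: "f z0 = 0" and nz: "f z1 \<noteq> 0"
  shows "\<exists>m h. m > 0 \<and> h holomorphic_on UNIV \<and> h z0 \<noteq> 0 \<and> (\<forall>w. f w = (w - z0) ^ m * h w)"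
proof -
  have nc: "\<not> f constant_on UNIV" using z nz by (metis UNIV_I constant_on_def)
  obtain g r m where g: "0 < m" "0 < r" "g holomorphic_on ball z0 r"
    "\<And>w. w \<in> ball z0 r \<Longrightarrow> f w = (w - z0) ^ m * g w" "\<And>w. w \<in> ball z0 r \<Longrightarrow> g w \<noteq> 0"
    by (rule holomorphic_factor_zero_nonconstant[OF f open_UNIV connected_UNIV UNIV_I z nc]) blast
  define h where "h w = (if w = z0 then g z0 else f w / (w - z0) ^ m)" for w
  have "h w = g w" if "w \<in> ball z0 r" for w using g(4)[OF that] by (simp add: h_def)
  then have 1: "h holomorphic_on ball z0 r" by (intro holomorphic_transform[OF g(3)]) simp
  have "(\<lambda>w. f w / (w - z0) ^ m) holomorphic_on - {z0}"
    using holomorphic_on_subset[OF f] by (intro holomorphic_intros) auto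
  then have 2: "h holomorphic_on - {z0}" by (rule holomorphic_transform) (simp add: h_def)
  have "h holomorphic_on (ball z0 r \<union> - {z0})" by (intro holomorphic_on_Un 1 2 open_ball open_Compl closed_singleton)
  moreover have "ball z0 r \<union> - {z0} = UNIV" using g(2) by auto
  ultimately have "h holomorphic_on UNIV" by simp
  moreover have "h z0 \<noteq> 0" using g(2,5) by (simp add: h_def)
  moreover have "f w = (w - z0) ^ m * h w" for w using z g(1) by (simp add: h_def)
  ultimately show ?thesis using g(1) by blast
qed

lemma entire_divide_zero:
  assumes f: "f holomorphic_on UNIV" and z: "f z0 = 0"
  shows "\<exists>q. q holomorphic_on UNIV \<and> (\<forall>u. f (u + z0) = u * q u)"
proof (cases "\<forall>w. f w = 0")
  case True
  then show ?thesis by (intro exI[of _ "\<lambda>_. 0"]) simp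
next
  case False
  then obtain z1 where "f z1 \<noteq> 0" by blast
  from entire_factor_zero[OF f z this] obtain m h where h: "m > 0" "h holomorphic_on UNIV" "\<And>w. f w = (w - z0) ^ m * h w"
    by (elim exE conjE) metis
  have "(\<lambda>u. h (u + z0)) holomorphic_on UNIV"
    by (rule holomorphic_shift[OF h(2)])
  then have "(\<lambda>u. u ^ (m - 1) * h (u + z0)) holomorphic_on UNIV" by (intro holomorphic_intros)
  moreover have "f (u + z0) = u * (u ^ (m - 1) * h (u + z0))" for u
    using h(1) by (simp add: h(3) power_eq_if)
  ultimately show ?thesis by (intro exI[of _ "\<lambda>u. u ^ (m - 1) * h (u + z0)"] conjI allI)
qed

lemma fmod_quasi_periodic:
  assumes "quasi_periodic a s" shows "fmod s (z + a) = fmod s z"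
proof -
  from assms obtain c where c: "norm c = exp (pi * (norm a)\<^sup>2 / 2)" "\<And>z. s (z + a) = c * exp (of_real pi * cnj a * z) * s z"
    unfolding quasi_periodic_def by blast
  have "fmod s (z + a) = norm (s z) * (exp (pi * (norm a)\<^sup>2 / 2) * exp (pi * Re (cnj a * z)) * exp (- pi * (norm (z + a))\<^sup>2 / 2))"
    unfolding fmod_def c(2) norm_mult c(1) by (simp add: algebra_simps)
  also have "exp (pi * (norm a)\<^sup>2 / 2) * exp (pi * Re (cnj a * z)) * exp (- pi * (norm (z + a))\<^sup>2 / 2) = exp (- pi * (norm z)\<^sup>2 / 2)"
    unfolding mult_exp_exp norm_add_sq_complex by (simp add: field_simps)
  finally show ?thesis by (simp add: fmod_def)
qed

lemma periodic_int_multiple: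
  fixes h :: "complex \<Rightarrow> 'b"
  assumes "\<And>z. h (z + a) = h z" shows "h (z + of_int k * a) = h z"
proof -
  have nat: "h (z + of_nat n * a) = h z" for n z
  proof (induction n)
    case (Suc n)
    have "h (z + of_nat (Suc n) * a) = h (z + of_nat n * a + a)" by (simp add: algebra_simps)
    then show ?case using assms Suc by simp
  qed simp
  show ?thesis
  proof (cases k rule: int_cases2)
    case (nonneg n)
    then show ?thesis using nat by simp
  next
    case (nonpos n)
    have "h (z + of_int k * a + of_nat n * a) = h (z + of_int k * a)" by (rule nat)
    then show ?thesis by (simp add: nonpos)
  qed
qed

lemma periodic_lat:
  fixes h :: "complex \<Rightarrow> 'b"
  assumes "\<And>z. h (z + a) = h z" "\<And>z. h (z + b) = h z" and l: "l \<in> lat a b"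
  shows "h (z + l) = h z"
proof -
  obtain p q where "l = of_int p * a + of_int q * b" using l by (rule latE)
  then have "h (z + l) = h (z + of_int p * a + of_int q * b)" by (simp add: add.assoc)
  then show ?thesis using periodic_int_multiple[of h a, OF assms(1)] periodic_int_multiple[of h b, OF assms(2)] by simp
qed

text \<open>A stand-in for the Weierstrass sigma function. The topological argument yields one zero,
  \<open>fshift\<close> moves it to the origin, and periodicity of the weighted modulus both spreads
  it over the lattice and bounds the growth.\<close>

lemma exists_sigma_function:
  assumes ab: "\<bar>Im (cnj a * b)\<bar> = 1"
  shows "\<exists>s B. s holomorphic_on UNIV \<and> (\<exists>z. s z \<noteq> 0) \<and> (\<forall>l\<in>lat a b. s l = 0)
    \<and> B > 0 \<and> (\<forall>w. norm (s w) \<le> B * exp (pi / 2 * (norm w)\<^sup>2))"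
proof -
  obtain s z1 where s: "s holomorphic_on UNIV" "s z1 \<noteq> 0" "quasi_periodic a s" "quasi_periodic b s"
    using exists_quasi_periodic_entire[OF ab] by (elim exE conjE) metis
  have sc: "continuous_on UNIV s" using s(1) by (rule holomorphic_on_imp_continuous_on)
  have nd: "Im (cnj a * b) \<noteq> 0" using ab by auto
  obtain ca where ca: "\<forall>z. s (z + a) = ca * exp (of_real pi * cnj a * z) * s z"
    using s(3) unfolding quasi_periodic_def by blast
  obtain cb where cb: "\<forall>z. s (z + b) = cb * exp (of_real pi * cnj b * z) * s z"
    using s(4) unfolding quasi_periodic_def by blast
  have "\<exists>z. s z = 0"
    by (rule quasi_periodic_has_zero[OF sc ca[rule_format] cb[rule_format] _ nd]) simp
  then obtain z0 where z0: "s z0 = 0" by blast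
  define s1 where "s1 = fshift z0 s"
  have per: "fmod s (z + l) = fmod s z" if "l \<in> lat a b" for l z
    by (rule periodic_lat[OF _ _ that]) (rule fmod_quasi_periodic[OF s(3)], rule fmod_quasi_periodic[OF s(4)])
  obtain B where B: "B > 0" "\<And>z. norm (fmod s z) \<le> B"
    using periodic_bounded[OF nd continuous_fmod[OF sc] per] by metis
  have h1: "s1 holomorphic_on UNIV"
  proof -
    have "(\<lambda>u. s (u + z0)) holomorphic_on UNIV"
      by (rule holomorphic_shift[OF s(1)])
    then show ?thesis unfolding s1_def fshift_def[abs_def] by (intro holomorphic_intros)
  qed
  moreover have "s1 (z1 - z0) \<noteq> 0" using s(2) by (simp add: s1_def fshift_def)
  moreover have "s1 l = 0" if "l \<in> lat a b" for l
  proof -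
    have "fmod s1 l = fmod s (z0 + l)" by (simp only: s1_def fmod_fshift add.commute)
    also have "\<dots> = fmod s z0" by (rule per[OF that])
    also have "\<dots> = 0" by (simp add: fmod_def z0)
    finally show ?thesis by (simp add: fmod_def)
  qed
  moreover have "norm (s1 w) \<le> B * exp (pi / 2 * (norm w)\<^sup>2)" for w
  proof -
    have "norm (s1 w) = fmod s1 w * exp (pi / 2 * (norm w)\<^sup>2)"
      unfolding fmod_def mult.assoc mult_exp_exp by simp
    also have "fmod s1 w \<le> B" unfolding s1_def fmod_fshift using B(2)[of "w + z0"] by simp
    finally show ?thesis by (simp add: mult_right_mono)
  qed
  ultimately show ?thesis using B(1) by blast
qed

text \<open>Write the sigma-like function of the adjoint lattice as w ^ m * h w and take w ^ (n - 1)
  * h w ^ n. The order at 0 is then n - 1 whatever m is, while every other lattice point keeps a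
  zero of order at least n. The growth rate is n times that of the sigma-like function.\<close>

lemma exists_multiplicity_interpolant:
  assumes nd: "Im (cnj a * b) \<noteq> 0" and n: "n \<ge> 1"
  shows "\<exists>g q0 Cg. g holomorphic_on UNIV \<and> q0 holomorphic_on UNIV \<and> q0 0 \<noteq> 0 \<and> (\<forall>w. g w = w ^ (n - 1) * q0 w)
     \<and> (\<forall>w. norm (g w) \<le> Cg * exp (pi / 2 * (real n * \<bar>Im (cnj a * b)\<bar>) * (norm w)\<^sup>2))
     \<and> (\<forall>\<mu>\<in>adj_lat a b. \<mu> \<noteq> 0 \<longrightarrow> (\<exists>q. q holomorphic_on UNIV \<and> (\<forall>u. g (u + \<mu>) = u ^ n * q u)))"
proof -
  define D where "D = Im (cnj a * b)"
  define d where "d = \<bar>D\<bar>"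
  have d: "d > 0" using nd by (simp add: d_def D_def)
  \<comment> \<open>Dilation by t carries the adjoint lattice onto the lattice of a / t and b / t,
    whose cell has unit area.\<close>
  define t where "t = sqrt d"
  have t: "t > 0" "t * t = d" using d by (simp_all add: t_def)
  have "Im (cnj (a / of_real t) * (b / of_real t)) = D / (t * t)"
    using t(1) by (simp add: D_def diff_divide_distrib)
  then have "\<bar>Im (cnj (a / of_real t) * (b / of_real t))\<bar> = 1"
    using d by (simp add: t(2) d_def)
  from exists_sigma_function[OF this] obtain s B where s: "s holomorphic_on UNIV" "\<exists>z. s z \<noteq> 0"
      "\<forall>l\<in>lat (a / of_real t) (b / of_real t). s l = 0" "B > 0" "\<forall>w. norm (s w) \<le> B * exp (pi / 2 * (norm w)\<^sup>2)"
    by (elim exE conjE) metis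
  define s2 where "s2 w = s (of_real t * w)" for w
  have h2: "s2 holomorphic_on UNIV" unfolding s2_def
    using holomorphic_on_compose_gen[of "\<lambda>w. of_real t * w" UNIV s UNIV] s(1) by (auto simp: o_def intro!: holomorphic_intros)
  have b2: "norm (s2 w) \<le> B * exp (pi / 2 * d * (norm w)\<^sup>2)" for w
  proof -
    have "(norm (of_real t * w))\<^sup>2 = d * (norm w)\<^sup>2"
      using d by (simp add: norm_mult power_mult_distrib t_def)
    then show ?thesis using s(5)[rule_format, of "of_real t * w"] by (simp add: s2_def mult.assoc)
  qed
  have z2: "s2 \<mu> = 0" if \<mu>: "\<mu> \<in> adj_lat a b" for \<mu>
  proof -
    obtain p q where m: "\<mu> = of_int p * (a / of_real D) + of_int q * (b / of_real D)"
      using \<mu> unfolding adj_lat_def D_def[symmetric] by (elim latE) simp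
    \<comment> \<open>The sign of D, carried as an integer so that it can be moved into the lattice
      coordinates.\<close>
    obtain e :: int where e: "D = of_int e * (t * t)"
      using t(2) d_def by (cases "D \<ge> 0") (auto intro: that[of 1] that[of "-1"])
    have e1: "e = 1 \<or> e = -1"
    proof -
      have "\<bar>of_int e * d\<bar> = d" using e t(2) d_def by simp
      then have "\<bar>real_of_int e\<bar> = 1" using d by (simp add: abs_mult)
      then show ?thesis by linarith
    qed
    have "of_real t * \<mu> = of_int (e * p) * (a / of_real t) + of_int (e * q) * (b / of_real t)"
      using t(1) e1 by (auto simp: m e field_simps)
    then have "of_real t * \<mu> \<in> lat (a / of_real t) (b / of_real t)" by (simp only: latI)
    then show ?thesis using s(3) by (simp add: s2_def)
  qed
  obtain z where nz: "s2 z \<noteq> 0"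
  proof -
    obtain z where "s z \<noteq> 0" using s(2) by blast
    then have "s2 (z / of_real t) \<noteq> 0" using t(1) by (simp add: s2_def)
    then show ?thesis by (rule that)
  qed
  have s20: "s2 0 = 0" by (rule z2) (simp add: adj_lat_def)
  obtain m h where "m > 0 \<and> h holomorphic_on UNIV \<and> h 0 \<noteq> 0 \<and> (\<forall>w. s2 w = (w - 0) ^ m * h w)"
    by (rule exE[OF entire_factor_zero[OF h2 s20 nz]], erule exE, rule that)
  then have h: "m > 0" "h holomorphic_on UNIV" "h 0 \<noteq> 0" "\<And>w. s2 w = w ^ m * h w" by auto
  define g where "g w = w ^ (n - 1) * h w ^ n" for w
  have hg: "g holomorphic_on UNIV" unfolding g_def using h(2) by (intro holomorphic_intros)
  have hq: "(\<lambda>w. h w ^ n) holomorphic_on UNIV" using h(2) by (intro holomorphic_intros)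
  have "compact (g ` cball 0 1)"
    by (intro compact_continuous_image compact_cball continuous_on_subset[OF holomorphic_on_imp_continuous_on[OF hg]]) auto
  then have "bounded (g ` cball 0 1)" by (rule compact_imp_bounded)
  then obtain K where K: "K > 0" "\<And>w. norm w \<le> 1 \<Longrightarrow> norm (g w) \<le> K"
    unfolding bounded_pos by auto
  define Cg where "Cg = K + B ^ n"
  have bg: "norm (g w) \<le> Cg * exp (pi / 2 * (real n * d) * (norm w)\<^sup>2)" for w
  \<comment> \<open>Outside the unit disc w ^ (n - 1) is dominated by w ^ (m * n), so g is bounded
    by the n-th power of \<open>s2\<close>. Inside, compactness bounds g.\<close>
  proof (cases "norm w \<le> 1")
    case True
    have "norm (g w) \<le> K * 1" using K(2)[OF True] by simp
    also have "\<dots> \<le> Cg * exp (pi / 2 * (real n * d) * (norm w)\<^sup>2)"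
      using K(1) s(4) d unfolding Cg_def by (intro mult_mono) auto
    finally show ?thesis .
  next
    case False
    have "norm (g w) \<le> norm (s2 w) ^ n"
    proof -
      have "norm (g w) = norm w ^ (n - 1) * norm (h w) ^ n" by (simp add: g_def norm_mult norm_power)
      also have "norm w ^ (n - 1) \<le> norm w ^ (m * n)"
      proof (rule power_increasing)
        have "1 * n \<le> m * n" using h(1) by (intro mult_right_mono) auto
        then show "n - 1 \<le> m * n" by linarith
      qed (use False in auto)
      finally show ?thesis by (simp add: h(4) norm_mult norm_power power_mult power_mult_distrib mult_right_mono)
    qed
    also have "\<dots> \<le> (B * exp (pi / 2 * d * (norm w)\<^sup>2)) ^ n" by (intro power_mono b2) simp
    also have "\<dots> = B ^ n * exp (pi / 2 * (real n * d) * (norm w)\<^sup>2)"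
      unfolding power_mult_distrib exp_of_nat_mult[symmetric] by (simp add: mult_ac)
    also have "\<dots> \<le> Cg * exp (pi / 2 * (real n * d) * (norm w)\<^sup>2)" using K(1) by (simp add: Cg_def)
    finally show ?thesis .
  qed
  have zg: "\<exists>q. q holomorphic_on UNIV \<and> (\<forall>u. g (u + \<mu>) = u ^ n * q u)" if "\<mu> \<in> adj_lat a b" "\<mu> \<noteq> 0" for \<mu>
  proof -
    have "h \<mu> = 0" using z2[OF that(1)] that(2) by (simp add: h(4))
    from entire_divide_zero[OF h(2) this] obtain q where q: "q holomorphic_on UNIV" "\<And>u. h (u + \<mu>) = u * q u"
      by (elim exE conjE) metis
    have "g (u + \<mu>) = u ^ n * ((u + \<mu>) ^ (n - 1) * q u ^ n)" for u
      by (simp add: g_def q(2) power_mult_distrib)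
    moreover have "(\<lambda>u. (u + \<mu>) ^ (n - 1) * q u ^ n) holomorphic_on UNIV" using q(1) by (intro holomorphic_intros)
    ultimately show ?thesis by (intro exI[of _ "\<lambda>u. (u + \<mu>) ^ (n - 1) * q u ^ n"] conjI allI)
  qed
  show ?thesis
    unfolding D_def[symmetric] d_def[symmetric]
    by (intro exI[of _ g] exI[of _ "\<lambda>w. h w ^ n"] exI[of _ Cg] conjI ballI allI impI hg hq bg zg)
       (use h(3) in \<open>auto simp: g_def\<close>)
qed

text \<open>\<open>cocr m \<phi>\<close> is, up to a constant, the \<open>m\<close>-th Landau level raised from \<open>\<phi>\<close>: it equals
  \<open>(\<partial> - \<pi> cnj z)\<^sup>m \<phi>\<close>, written in a form in which covariance under \<open>fshift\<close> is evident.\<close>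

definition cocr :: "nat \<Rightarrow> (complex \<Rightarrow> complex) \<Rightarrow> complex \<Rightarrow> complex" where
  "cocr m \<phi> z = (deriv ^^ m) (\<lambda>u. exp (- of_real pi * cnj z * u) * \<phi> (z + u)) 0"

lemma higher_deriv_exp_linear: "(deriv ^^ i) (\<lambda>u. exp (c * u)) z = c ^ i * exp (c * z :: complex)"
proof -
  have "(deriv ^^ i) (\<lambda>u. exp (c * u)) z = c ^ i * (deriv ^^ i) exp (c * z)"
    by (rule higher_deriv_compose_linear[where S=UNIV and T=UNIV]) (auto intro!: holomorphic_intros)
  moreover have "(deriv ^^ i) exp = (exp :: complex \<Rightarrow> complex)"
  proof (induction i)
    case (Suc i)
    have "deriv exp = (exp :: complex \<Rightarrow> complex)" by (rule ext) (rule DERIV_imp_deriv[OF DERIV_exp])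
    then show ?case using Suc by simp
  qed simp
  ultimately show ?thesis by simp
qed

text \<open>Leibniz' rule for the product inside \<open>cocr\<close>. The term i = m shows that the
  highest power of cnj z carries (- pi) ^ m * \<phi>, so raising retains the raised function as top
  coefficient.\<close>

lemma cocr_expand:
  assumes \<phi>: "\<phi> holomorphic_on UNIV"
  shows "cocr m \<phi> z = (\<Sum>i<Suc m. cnj z ^ i * (of_nat (m choose i) * (- of_real pi) ^ i * (deriv ^^ (m - i)) \<phi> z))"
proof -
  have h1: "(\<lambda>u. \<phi> (z + u)) holomorphic_on UNIV"
    by (rule holomorphic_shift[OF \<phi>])
  have d: "(deriv ^^ k) (\<lambda>u. \<phi> (z + u)) 0 = (deriv ^^ k) \<phi> z" for k
    using higher_deriv_compose_linear'[OF \<phi> open_UNIV open_UNIV, of 0 1 z k] by (simp add: add.commute)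
  have "cocr m \<phi> z = (\<Sum>i = 0..m. of_nat (m choose i) * (deriv ^^ i) (\<lambda>u. exp (- of_real pi * cnj z * u)) 0 * (deriv ^^ (m - i)) (\<lambda>u. \<phi> (z + u)) 0)"
    unfolding cocr_def by (rule higher_deriv_mult[OF _ h1 open_UNIV]) (auto intro!: holomorphic_intros)
  also have "\<dots> = (\<Sum>i = 0..m. cnj z ^ i * (of_nat (m choose i) * (- of_real pi) ^ i * (deriv ^^ (m - i)) \<phi> z))"
    unfolding higher_deriv_exp_linear d
    by (rule sum.cong[OF refl]) (simp only: mult_zero_right mult_zero_left exp_zero mult_1_right mult_1_left power_mult_distrib mult_ac)
  finally show ?thesis by (simp only: atLeast0AtMost lessThan_Suc_atMost)
qed

lemma polyrep_cocr:
  assumes \<phi>: "\<phi> holomorphic_on UNIV"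
  shows "polyrep (Suc m) (\<lambda>i z. of_nat (m choose i) * (- of_real pi) ^ i * (deriv ^^ (m - i)) \<phi> z) (cocr m \<phi>)"
  unfolding polyrep_def using cocr_expand[OF \<phi>] \<phi> by (auto intro!: holomorphic_intros simp del: sum.lessThan_Suc)

text \<open>Cauchy's inequality on the unit circle. The function differentiated in
  \<open>cocr\<close> has modulus \<open>fmod \<phi> (z + u)\<close> times exp (pi * (|z|^2 + |u|^2)
  / 2); |u| = 1 gives the constant exp (pi / 2).\<close>

lemma fmod_cocr_le:
  assumes \<phi>: "\<phi> holomorphic_on UNIV" and B: "\<And>u. norm u = 1 \<Longrightarrow> fmod \<phi> (z + u) \<le> B"
  shows "fmod (cocr m \<phi>) z \<le> fact m * exp (pi / 2) * B"
proof -
  define f where "f u = exp (- of_real pi * cnj z * u) * \<phi> (z + u)" for u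
  have h1: "(\<lambda>u. \<phi> (z + u)) holomorphic_on UNIV"
    by (rule holomorphic_shift[OF \<phi>])
  have hf: "f holomorphic_on UNIV" unfolding f_def using h1 by (intro holomorphic_intros)
  have "norm ((deriv ^^ m) f 0) \<le> fact m * (B * exp (pi / 2) * exp (pi * (norm z)\<^sup>2 / 2)) / 1 ^ m"
  proof (rule Cauchy_inequality)
    show "f holomorphic_on ball 0 1" using hf by (rule holomorphic_on_subset) simp
    show "continuous_on (cball 0 1) f" using holomorphic_on_imp_continuous_on[OF hf] by (rule continuous_on_subset) simp
    fix u :: complex assume "norm (0 - u) = 1"
    then have u: "norm u = 1" by simp
    have "norm (f u) = fmod \<phi> (z + u) * (exp (- pi * Re (cnj z * u)) * exp (pi * (norm (u + z))\<^sup>2 / 2))"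
    proof -
      have "exp (- pi * (norm (z + u))\<^sup>2 / 2) * exp (pi * (norm (u + z))\<^sup>2 / 2) = 1"
        unfolding mult_exp_exp by (simp add: add.commute)
      then show ?thesis by (simp add: f_def fmod_def norm_mult algebra_simps)
    qed
    also have "exp (- pi * Re (cnj z * u)) * exp (pi * (norm (u + z))\<^sup>2 / 2) = exp (pi / 2) * exp (pi * (norm z)\<^sup>2 / 2)"
      unfolding mult_exp_exp norm_add_sq_complex u by (simp add: field_simps)
    also have "fmod \<phi> (z + u) * (exp (pi / 2) * exp (pi * (norm z)\<^sup>2 / 2)) \<le> B * exp (pi / 2) * exp (pi * (norm z)\<^sup>2 / 2)"
      using B[OF u] by simp
    finally show "norm (f u) \<le> B * exp (pi / 2) * exp (pi * (norm z)\<^sup>2 / 2)" .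
  qed simp
  then have "norm (cocr m \<phi> z) \<le> fact m * (B * exp (pi / 2) * exp (pi * (norm z)\<^sup>2 / 2))"
    by (simp add: cocr_def f_def[abs_def])
  then have "fmod (cocr m \<phi>) z \<le> fact m * (B * exp (pi / 2) * exp (pi * (norm z)\<^sup>2 / 2)) * exp (- pi * (norm z)\<^sup>2 / 2)"
    unfolding fmod_def by (rule mult_right_mono) simp
  also have "\<dots> = fact m * exp (pi / 2) * B * (exp (pi * (norm z)\<^sup>2 / 2) * exp (- pi * (norm z)\<^sup>2 / 2))" by simp
  also have "exp (pi * (norm z)\<^sup>2 / 2) * exp (- pi * (norm z)\<^sup>2 / 2) = 1" unfolding mult_exp_exp by simp
  finally show ?thesis by simp
qed

subsection \<open>Sampling above the critical density\<close>

text \<open>Schur's test. Cauchy-Schwarz splits the Gaussian kernel evenly; the lattice sums of the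
  kernel are bounded uniformly in z, and its integral over z is the same for every lattice
  point.\<close>

lemma lattice_schur_bound:
  assumes nd: "Im (cnj a * b) \<noteq> 0" and e: "e > 0"
  shows "\<exists>C>0. \<forall>f. (\<integral>\<^sup>+z. (\<integral>\<^sup>+l. ennreal (f l * exp (- e * (norm (l - z))\<^sup>2)) \<partial>count_space (lat a b))\<^sup>2 \<partial>lborel)
     \<le> ennreal C * (\<integral>\<^sup>+l. ennreal ((f l)\<^sup>2) \<partial>count_space (lat a b))"
proof -
  let ?L = "count_space (lat a b)"
  obtain C1 d where C1: "C1 > 0" "\<forall>t>0. \<forall>z. (\<integral>\<^sup>+x. ennreal (exp (- t * (norm (x - z))\<^sup>2)) \<partial>?L) \<le> ennreal (C1 * exp (t * d) / t)"
    using lat_gauss_sum[OF nd] by blast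
  define K where "K = C1 * exp (e * d) / e"
  have K: "K > 0" "\<And>z. (\<integral>\<^sup>+x. ennreal (exp (- e * (norm (x - z))\<^sup>2)) \<partial>?L) \<le> ennreal K"
    using C1 e by (auto simp: K_def)
  define G where "G = enn2real gauss_mass"
  have G: "gauss_mass = ennreal G" "G > 0" using gauss_mass_finite gauss_mass_pos
    by (auto simp: G_def enn2real_positive_iff less_top)
  define P where "P = pi / e"
  have P: "P > 0" using e by (simp add: P_def)
  define C where "C = K * (P * G)"
  have C: "C > 0" using K P G by (simp add: C_def)
  have main: "(\<integral>\<^sup>+z. (\<integral>\<^sup>+l. ennreal (f l * exp (- e * (norm (l - z))\<^sup>2)) \<partial>?L)\<^sup>2 \<partial>lborel)
     \<le> ennreal C * (\<integral>\<^sup>+l. ennreal ((f l)\<^sup>2) \<partial>?L)" for f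
  proof -
    have pw: "(\<integral>\<^sup>+l. ennreal (f l * exp (- e * (norm (l - z))\<^sup>2)) \<partial>?L)\<^sup>2
        \<le> (\<integral>\<^sup>+l. ennreal ((f l)\<^sup>2 * exp (- e * (norm (l - z))\<^sup>2)) \<partial>?L) * ennreal K" for z
    proof -
      have le: "(\<integral>\<^sup>+l. ennreal (f l * exp (- e * (norm (l - z))\<^sup>2)) \<partial>?L)
        \<le> (\<integral>\<^sup>+l. ennreal (\<bar>f l\<bar> * exp (- (e / 2) * (norm (l - z))\<^sup>2)) * ennreal (exp (- (e / 2) * (norm (l - z))\<^sup>2)) \<partial>?L)"
      proof (rule nn_integral_mono)
        fix l
        have "f l * exp (- e * (norm (l - z))\<^sup>2) \<le> \<bar>f l\<bar> * (exp (- (e / 2) * (norm (l - z))\<^sup>2) * exp (- (e / 2) * (norm (l - z))\<^sup>2))"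
          unfolding mult_exp_exp by (simp add: mult_right_mono)
        then show "ennreal (f l * exp (- e * (norm (l - z))\<^sup>2)) \<le> ennreal (\<bar>f l\<bar> * exp (- (e / 2) * (norm (l - z))\<^sup>2)) * ennreal (exp (- (e / 2) * (norm (l - z))\<^sup>2))"
          by (subst ennreal_mult[symmetric]) (auto intro!: ennreal_leI simp: mult.assoc)
      qed
      have e2: "(ennreal (exp (- (e / 2) * (norm (l - z))\<^sup>2)))\<^sup>2 = ennreal (exp (- e * (norm (l - z))\<^sup>2))"
        "(ennreal (\<bar>f l\<bar> * exp (- (e / 2) * (norm (l - z))\<^sup>2)))\<^sup>2 = ennreal ((f l)\<^sup>2 * exp (- e * (norm (l - z))\<^sup>2))" for l
        by (simp_all add: ennreal_power power_mult_distrib exp_double[symmetric])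
      have "(\<integral>\<^sup>+l. ennreal (f l * exp (- e * (norm (l - z))\<^sup>2)) \<partial>?L)\<^sup>2
        \<le> (\<integral>\<^sup>+l. ennreal (\<bar>f l\<bar> * exp (- (e / 2) * (norm (l - z))\<^sup>2)) * ennreal (exp (- (e / 2) * (norm (l - z))\<^sup>2)) \<partial>?L)\<^sup>2"
        using le by (rule power_mono) simp
      also have "\<dots> \<le> (\<integral>\<^sup>+l. (ennreal (\<bar>f l\<bar> * exp (- (e / 2) * (norm (l - z))\<^sup>2)))\<^sup>2 \<partial>?L) * (\<integral>\<^sup>+l. (ennreal (exp (- (e / 2) * (norm (l - z))\<^sup>2)))\<^sup>2 \<partial>?L)"
        by (rule Cauchy_Schwarz_nn_integral) auto
      also have "\<dots> \<le> (\<integral>\<^sup>+l. ennreal ((f l)\<^sup>2 * exp (- e * (norm (l - z))\<^sup>2)) \<partial>?L) * ennreal K"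
        unfolding e2 by (intro mult_left_mono K(2)) simp
      finally show ?thesis .
    qed
    have "(\<integral>\<^sup>+z. (\<integral>\<^sup>+l. ennreal (f l * exp (- e * (norm (l - z))\<^sup>2)) \<partial>?L)\<^sup>2 \<partial>lborel)
      \<le> (\<integral>\<^sup>+z. (\<integral>\<^sup>+l. ennreal ((f l)\<^sup>2 * exp (- e * (norm (l - z))\<^sup>2)) * ennreal K \<partial>?L) \<partial>lborel)"
      by (intro nn_integral_mono order_trans[OF pw]) (simp add: nn_integral_multc)
    also have "\<dots> = (\<integral>\<^sup>+l. (\<integral>\<^sup>+z. ennreal ((f l)\<^sup>2 * exp (- e * (norm (l - z))\<^sup>2)) * ennreal K \<partial>lborel) \<partial>?L)"
      by (rule nn_integral_count_space_nn_integral[OF lat_countable]) measurable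
    also have "\<dots> = (\<integral>\<^sup>+l. ennreal C * ennreal ((f l)\<^sup>2) \<partial>?L)"
    proof (rule nn_integral_cong)
      fix l
      have "(\<integral>\<^sup>+z. ennreal ((f l)\<^sup>2 * exp (- e * (norm (l - z))\<^sup>2)) * ennreal K \<partial>lborel)
        = (\<integral>\<^sup>+z. (ennreal K * ennreal ((f l)\<^sup>2)) * ennreal (exp (- e * (norm (z - l))\<^sup>2)) \<partial>lborel)"
        by (intro nn_integral_cong) (simp add: ennreal_mult norm_minus_commute mult_ac)
      also have "\<dots> = (ennreal K * ennreal ((f l)\<^sup>2)) * (\<integral>\<^sup>+z. ennreal (exp (- e * (norm (z - l))\<^sup>2)) \<partial>lborel)"
        by (rule nn_integral_cmult) measurable
      also have "\<dots> = (ennreal K * ennreal ((f l)\<^sup>2)) * (ennreal P * ennreal G)"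
        unfolding nn_integral_gauss[OF e] G(1) P_def ..
      also have "\<dots> = ennreal C * ennreal ((f l)\<^sup>2)"
        unfolding C_def using K P G(2) by (simp add: ennreal_mult mult_ac)
      finally show "(\<integral>\<^sup>+z. ennreal ((f l)\<^sup>2 * exp (- e * (norm (l - z))\<^sup>2)) * ennreal K \<partial>lborel) = ennreal C * ennreal ((f l)\<^sup>2)" .
    qed
    also have "\<dots> = ennreal C * (\<integral>\<^sup>+l. ennreal ((f l)\<^sup>2) \<partial>?L)" by (rule nn_integral_cmult) simp
    finally show ?thesis .
  qed
  show ?thesis by (rule exI[of _ C]) (use C main in auto)
qed

lemma fmod_diff_sq: "(fmod (\<lambda>z. F z - E z) z)\<^sup>2 \<le> 2 * (fmod F z)\<^sup>2 + 2 * (fmod E z)\<^sup>2"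
  and fmod_sum_sq: "(fmod F z)\<^sup>2 \<le> 2 * (fmod (\<lambda>z. F z - E z) z)\<^sup>2 + 2 * (fmod E z)\<^sup>2"
proof -
  have s: "(fmod H z)\<^sup>2 = (norm (H z))\<^sup>2 * (exp (- pi * (norm z)\<^sup>2 / 2))\<^sup>2" for H
    by (simp add: fmod_def power_mult_distrib)
  have "(norm (F z - E z))\<^sup>2 \<le> 2 * (norm (F z))\<^sup>2 + 2 * (norm (E z))\<^sup>2"
    using norm_add_sq_le[of "F z" "- E z"] by simp
  then have "(norm (F z - E z))\<^sup>2 * (exp (- pi * (norm z)\<^sup>2 / 2))\<^sup>2 \<le> (2 * (norm (F z))\<^sup>2 + 2 * (norm (E z))\<^sup>2) * (exp (- pi * (norm z)\<^sup>2 / 2))\<^sup>2"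
    by (rule mult_right_mono) simp
  then show "(fmod (\<lambda>z. F z - E z) z)\<^sup>2 \<le> 2 * (fmod F z)\<^sup>2 + 2 * (fmod E z)\<^sup>2"
    unfolding s by (simp add: distrib_right)
  have "(norm (F z))\<^sup>2 \<le> 2 * (norm (F z - E z))\<^sup>2 + 2 * (norm (E z))\<^sup>2"
    using norm_add_sq_le[of "F z - E z" "E z"] by simp
  then have "(norm (F z))\<^sup>2 * (exp (- pi * (norm z)\<^sup>2 / 2))\<^sup>2 \<le> (2 * (norm (F z - E z))\<^sup>2 + 2 * (norm (E z))\<^sup>2) * (exp (- pi * (norm z)\<^sup>2 / 2))\<^sup>2"
    by (rule mult_right_mono) simp
  then show "(fmod F z)\<^sup>2 \<le> 2 * (fmod (\<lambda>z. F z - E z) z)\<^sup>2 + 2 * (fmod E z)\<^sup>2"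
    unfolding s by (simp add: distrib_right)
qed

lemma nn_integral_sq_le_double:
  assumes "\<And>x. (f x)\<^sup>2 \<le> 2 * (g x)\<^sup>2 + 2 * (h x)\<^sup>2" "(\<lambda>x. ennreal ((g x)\<^sup>2)) \<in> borel_measurable M" "(\<lambda>x. ennreal ((h x)\<^sup>2)) \<in> borel_measurable M"
  shows "(\<integral>\<^sup>+x. ennreal ((f x)\<^sup>2) \<partial>M) \<le> 2 * (\<integral>\<^sup>+x. ennreal ((g x)\<^sup>2) \<partial>M) + 2 * (\<integral>\<^sup>+x. ennreal ((h x)\<^sup>2) \<partial>M)"
proof -
  have "(\<integral>\<^sup>+x. ennreal ((f x)\<^sup>2) \<partial>M) \<le> (\<integral>\<^sup>+x. 2 * ennreal ((g x)\<^sup>2) + 2 * ennreal ((h x)\<^sup>2) \<partial>M)"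
  proof (rule nn_integral_mono)
    fix x
    have "ennreal ((f x)\<^sup>2) \<le> ennreal (2 * (g x)\<^sup>2 + 2 * (h x)\<^sup>2)" using assms(1) by (rule ennreal_leI)
    also have "\<dots> = 2 * ennreal ((g x)\<^sup>2) + 2 * ennreal ((h x)\<^sup>2)" by (simp add: ennreal_mult)
    finally show "ennreal ((f x)\<^sup>2) \<le> 2 * ennreal ((g x)\<^sup>2) + 2 * ennreal ((h x)\<^sup>2)" .
  qed
  also have "\<dots> = 2 * (\<integral>\<^sup>+x. ennreal ((g x)\<^sup>2) \<partial>M) + 2 * (\<integral>\<^sup>+x. ennreal ((h x)\<^sup>2) \<partial>M)"
    using assms(2,3) by (subst nn_integral_add) (auto simp: nn_integral_cmult)
  finally show ?thesis .
qed

text \<open>Raising costs derivatives, so the pointwise bound on the top coefficient is used on the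
  unit circle around z; this displacement halves the rate of the Gaussian kernel. Schur's test then
  passes to square norms.\<close>

lemma raised_top_coefficient_bound:
  assumes nd: "Im (cnj a * b) \<noteq> 0" and nD: "real (Suc m) * \<bar>Im (cnj a * b)\<bar> < 1"
  shows "\<exists>C>0. \<forall>F \<phi>. polyrep (Suc m) \<phi> F \<longrightarrow> fock_norm2 F < \<infinity> \<longrightarrow>
     fock_norm2 (cocr m (\<phi> m)) \<le> ennreal C * (\<integral>\<^sup>+l. ennreal ((fmod F l)\<^sup>2) \<partial>count_space (lat a b))"
proof -
  let ?L = "count_space (lat a b)"
  define \<kappa> where "\<kappa> = real (Suc m) * \<bar>Im (cnj a * b)\<bar>"
  have \<kappa>: "\<kappa> < 1" using nD by (simp only: \<kappa>_def)
  have "Suc m \<ge> 1" by simp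
  from exists_multiplicity_interpolant[OF nd this]
  obtain g q0 Cg where g: "g holomorphic_on UNIV" "q0 holomorphic_on UNIV" "q0 0 \<noteq> 0" "\<forall>w. g w = w ^ (Suc m - 1) * q0 w"
     "\<forall>w. norm (g w) \<le> Cg * exp (pi / 2 * \<kappa> * (norm w)\<^sup>2)"
     "\<forall>\<mu>\<in>adj_lat a b. \<mu> \<noteq> 0 \<longrightarrow> (\<exists>q. q holomorphic_on UNIV \<and> (\<forall>u. g (u + \<mu>) = u ^ Suc m * q u))"
    unfolding \<kappa>_def[symmetric] by (elim exE conjE) (rule that; assumption)
  define \<epsilon> where "\<epsilon> = pi / 2 * (1 - \<kappa>)"
  have \<epsilon>: "\<epsilon> > 0" using \<kappa> by (simp add: \<epsilon>_def)
  have "\<exists>C>0. \<forall>F \<phi> z. polyrep (Suc m) \<phi> F \<longrightarrow> fock_norm2 F < \<infinity> \<longrightarrow>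
     ennreal (fmod (\<phi> (Suc m - 1)) z) \<le> ennreal C * (\<integral>\<^sup>+l. ennreal (fmod F l * exp (- \<epsilon> * (norm (l - z))\<^sup>2)) \<partial>?L)"
    unfolding \<epsilon>_def
    by (rule top_coefficient_bound[OF nd \<open>Suc m \<ge> 1\<close> \<kappa> g(1) g(5)[rule_format] g(2,3) g(4)[rule_format]]) (use g(6) in blast)
  then obtain C1 where C1': "C1 > 0 \<and> (\<forall>F \<phi> z. polyrep (Suc m) \<phi> F \<longrightarrow> fock_norm2 F < \<infinity> \<longrightarrow>
     ennreal (fmod (\<phi> (Suc m - 1)) z) \<le> ennreal C1 * (\<integral>\<^sup>+l. ennreal (fmod F l * exp (- \<epsilon> * (norm (l - z))\<^sup>2)) \<partial>?L))"
    by (rule exE)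
  note C1 = conjunct1[OF C1'] and top = conjunct2[OF C1', rule_format, unfolded diff_Suc_1]
  have e2: "\<epsilon> / 2 > 0" using \<epsilon> by simp
  from lattice_schur_bound[OF nd e2] obtain C2 where C2': "C2 > 0 \<and> (\<forall>f. (\<integral>\<^sup>+z. (\<integral>\<^sup>+l. ennreal (f l * exp (- (\<epsilon> / 2) * (norm (l - z))\<^sup>2)) \<partial>?L)\<^sup>2 \<partial>lborel)
     \<le> ennreal C2 * (\<integral>\<^sup>+l. ennreal ((f l)\<^sup>2) \<partial>?L))" by (rule exE)
  note C2 = conjunct1[OF C2'] and schur = conjunct2[OF C2', rule_format]
  define c where "c = fact m * exp (pi / 2) * (C1 * exp \<epsilon>)"
  have c: "c > 0" using C1 by (simp add: c_def)
  have main: "fock_norm2 (cocr m (\<phi> m)) \<le> ennreal (c\<^sup>2 * C2) * (\<integral>\<^sup>+l. ennreal ((fmod F l)\<^sup>2) \<partial>?L)"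
    if F: "polyrep (Suc m) \<phi> F" and fin: "fock_norm2 F < \<infinity>" for F \<phi>
  proof -
    have hol: "\<phi> m holomorphic_on UNIV" using F by (simp add: polyrep_def)
    define X where "X z = (\<integral>\<^sup>+l. ennreal (fmod F l * exp (- (\<epsilon> / 2) * (norm (l - z))\<^sup>2)) \<partial>?L)" for z
    have Em: "ennreal (fmod (cocr m (\<phi> m)) z) \<le> ennreal c * X z" for z
    proof (cases "X z")
      case (real x)
      have "fmod (\<phi> m) (z + u) \<le> C1 * exp \<epsilon> * x" if u: "norm u = 1" for u
      proof -
        have "ennreal (fmod (\<phi> m) (z + u)) \<le> ennreal C1 * (\<integral>\<^sup>+l. ennreal (fmod F l * exp (- \<epsilon> * (norm (l - (z + u)))\<^sup>2)) \<partial>?L)"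
          by (rule top[OF F fin])
        also have "\<dots> \<le> ennreal C1 * (\<integral>\<^sup>+l. ennreal (exp \<epsilon>) * ennreal (fmod F l * exp (- (\<epsilon> / 2) * (norm (l - z))\<^sup>2)) \<partial>?L)"
        proof (intro mult_left_mono nn_integral_mono)
          fix l
          have "exp (- \<epsilon> * (norm (- u + (l - z)))\<^sup>2) \<le> exp (\<epsilon> * (norm (- u))\<^sup>2) * exp (- (\<epsilon> / 2) * (norm (l - z))\<^sup>2)"
            by (rule gauss_split_bound[OF \<epsilon>])
          then have "exp (- \<epsilon> * (norm (l - (z + u)))\<^sup>2) \<le> exp \<epsilon> * exp (- (\<epsilon> / 2) * (norm (l - z))\<^sup>2)"
            using u by (simp add: algebra_simps)
          then have "fmod F l * exp (- \<epsilon> * (norm (l - (z + u)))\<^sup>2) \<le> fmod F l * (exp \<epsilon> * exp (- (\<epsilon> / 2) * (norm (l - z))\<^sup>2))"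
            by (rule mult_left_mono) simp
          then show "ennreal (fmod F l * exp (- \<epsilon> * (norm (l - (z + u)))\<^sup>2)) \<le> ennreal (exp \<epsilon>) * ennreal (fmod F l * exp (- (\<epsilon> / 2) * (norm (l - z))\<^sup>2))"
            by (subst ennreal_mult[symmetric]) (auto intro!: ennreal_leI simp: mult_ac)
        qed simp
        also have "(\<integral>\<^sup>+l. ennreal (exp \<epsilon>) * ennreal (fmod F l * exp (- (\<epsilon> / 2) * (norm (l - z))\<^sup>2)) \<partial>?L) = ennreal (exp \<epsilon>) * X z"
          unfolding X_def by (rule nn_integral_cmult) simp
        also have "ennreal C1 * (ennreal (exp \<epsilon>) * X z) = ennreal (C1 * exp \<epsilon> * x)"
          using real C1 by (simp add: ennreal_mult mult.assoc)
        finally show ?thesis using C1 real(1) by (simp add: ennreal_le_iff)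
      qed
      from fmod_cocr_le[OF hol this] have "fmod (cocr m (\<phi> m)) z \<le> c * x" by (simp add: c_def mult.assoc)
      then have "ennreal (fmod (cocr m (\<phi> m)) z) \<le> ennreal (c * x)" by (rule ennreal_leI)
      then show ?thesis using real c by (simp add: ennreal_mult)
    next
      case top
      then show ?thesis using c by (simp add: ennreal_mult_top)
    qed
    have cX: "ennreal c * X z = (\<integral>\<^sup>+l. ennreal ((c * fmod F l) * exp (- (\<epsilon> / 2) * (norm (l - z))\<^sup>2)) \<partial>?L)" for z
      unfolding X_def using c by (subst nn_integral_cmult[symmetric]) (auto simp: ennreal_mult[symmetric] mult.assoc)
    have "fock_norm2 (cocr m (\<phi> m)) \<le> (\<integral>\<^sup>+z. (ennreal c * X z)\<^sup>2 \<partial>lborel)"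
      unfolding fock_norm2_fmod
    proof (rule nn_integral_mono)
      fix z
      have "ennreal ((fmod (cocr m (\<phi> m)) z)\<^sup>2) = (ennreal (fmod (cocr m (\<phi> m)) z))\<^sup>2" by (simp add: ennreal_power)
      also have "\<dots> \<le> (ennreal c * X z)\<^sup>2" by (rule power_mono[OF Em]) simp
      finally show "ennreal ((fmod (cocr m (\<phi> m)) z)\<^sup>2) \<le> (ennreal c * X z)\<^sup>2" .
    qed
    also have "\<dots> \<le> ennreal C2 * (\<integral>\<^sup>+l. ennreal ((c * fmod F l)\<^sup>2) \<partial>?L)"
      unfolding cX by (rule schur)
    also have "(\<integral>\<^sup>+l. ennreal ((c * fmod F l)\<^sup>2) \<partial>?L) = ennreal (c\<^sup>2) * (\<integral>\<^sup>+l. ennreal ((fmod F l)\<^sup>2) \<partial>?L)"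
      by (subst nn_integral_cmult[symmetric]) (auto simp: ennreal_mult power_mult_distrib)
    also have "ennreal C2 * (ennreal (c\<^sup>2) * (\<integral>\<^sup>+l. ennreal ((fmod F l)\<^sup>2) \<partial>?L)) = ennreal (c\<^sup>2 * C2) * (\<integral>\<^sup>+l. ennreal ((fmod F l)\<^sup>2) \<partial>?L)"
      using C2 by (simp add: ennreal_mult mult_ac)
    finally show ?thesis .
  qed
  have "c\<^sup>2 * C2 > 0" using c C2 by simp
  then show ?thesis by (intro exI[of _ "c\<^sup>2 * C2"] conjI allI impI main)
qed

text \<open>Induction on the order: the top coefficient of \<open>F\<close> is recovered from the samples, and subtracting
  the function it raises to the top Landau level leaves a polyanalytic function of lower order.\<close>

lemma sampling_lower_bound:
  assumes nd: "Im (cnj a * b) \<noteq> 0"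
  shows "real n * \<bar>Im (cnj a * b)\<bar> < 1 \<Longrightarrow> \<exists>C>0. \<forall>F \<phi>. polyrep n \<phi> F \<longrightarrow> fock_norm2 F < \<infinity> \<longrightarrow>
     fock_norm2 F \<le> ennreal C * (\<integral>\<^sup>+l. ennreal ((fmod F l)\<^sup>2) \<partial>count_space (lat a b))"
proof (induction n)
  case 0
  have "fock_norm2 F = 0" if "polyrep 0 \<phi> F" for F \<phi>
    using that by (simp add: polyrep_def fock_norm2_def)
  then show ?case by (intro exI[of _ 1]) auto
next
  case (Suc m)
  let ?L = "count_space (lat a b)"
  have "real m * \<bar>Im (cnj a * b)\<bar> \<le> real (Suc m) * \<bar>Im (cnj a * b)\<bar>" by (intro mult_right_mono) auto
  with Suc.prems have "real m * \<bar>Im (cnj a * b)\<bar> < 1" by linarith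
  from Suc.IH[OF this] obtain A where A': "A > 0 \<and> (\<forall>F \<phi>. polyrep m \<phi> F \<longrightarrow> fock_norm2 F < \<infinity> \<longrightarrow>
     fock_norm2 F \<le> ennreal A * (\<integral>\<^sup>+l. ennreal ((fmod F l)\<^sup>2) \<partial>?L))" by (rule exE)
  note A = conjunct1[OF A'] and IH = conjunct2[OF A', rule_format]
  from raised_top_coefficient_bound[OF nd Suc.prems] obtain C where C': "C > 0 \<and> (\<forall>F \<phi>. polyrep (Suc m) \<phi> F \<longrightarrow> fock_norm2 F < \<infinity> \<longrightarrow>
     fock_norm2 (cocr m (\<phi> m)) \<le> ennreal C * (\<integral>\<^sup>+l. ennreal ((fmod F l)\<^sup>2) \<partial>?L))" by (rule exE)
  note C = conjunct1[OF C'] and top = conjunct2[OF C', rule_format]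
  from lat_bessel[OF nd, of "Suc m"] obtain B where B': "B > 0 \<and> (\<forall>F \<phi>. polyrep (Suc m) \<phi> F \<longrightarrow>
    (\<integral>\<^sup>+x. ennreal ((fmod F x)\<^sup>2) \<partial>?L) \<le> ennreal B * fock_norm2 F)" by (rule exE)
  note B = conjunct1[OF B'] and bessel = conjunct2[OF B', rule_format]
  \<comment> \<open>The factor of \<phi> in the top coefficient of \<open>cocr m \<phi>\<close>;
    division by it gives E the same top coefficient as F.\<close>
  define p where "p = (- complex_of_real pi) ^ m"
  have p0: "p \<noteq> 0" by (simp add: p_def)
  define r where "r = (norm (1 / p))\<^sup>2"
  have r0: "r \<ge> 0" by (simp add: r_def)
  \<comment> \<open>Tracks two uses of |x + y|^2 \<le> 2 * |x|^2 + 2 * |y|^2: for the samples of F -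
    E, and for the norm of F as the sum of F - E and E.\<close>
  define C3 where "C3 = 2 * (A * (2 + 2 * (B * (r * C)))) + 2 * (r * C)"
  have C3: "C3 > 0" unfolding C3_def using A B C r0 by (intro add_pos_nonneg mult_pos_pos add_pos_nonneg mult_nonneg_nonneg) auto
  have main: "fock_norm2 F \<le> ennreal C3 * (\<integral>\<^sup>+l. ennreal ((fmod F l)\<^sup>2) \<partial>?L)"
    if F: "polyrep (Suc m) \<phi> F" and fin: "fock_norm2 F < \<infinity>" for F \<phi>
  proof -
    define S where "S = (\<integral>\<^sup>+l. ennreal ((fmod F l)\<^sup>2) \<partial>?L)"
    have hol: "\<phi> m holomorphic_on UNIV" using F by (simp add: polyrep_def)
    define \<eta> where "\<eta> i z = 1 / p * (of_nat (m choose i) * (- of_real pi) ^ i * (deriv ^^ (m - i)) (\<phi> m) z)" for i z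
    define E where "E z = 1 / p * cocr m (\<phi> m) z" for z
    have E: "polyrep (Suc m) \<eta> E"
      using polyrep_cocr[OF hol, of m] hol unfolding polyrep_def E_def \<eta>_def
      by (auto intro!: holomorphic_intros simp: sum_distrib_left mult_ac simp del: sum.lessThan_Suc)
    have \<eta>m: "\<eta> m z = \<phi> m z" for z using p0 by (simp add: \<eta>_def p_def)
    have fE: "(fmod E z)\<^sup>2 = r * (fmod (cocr m (\<phi> m)) z)\<^sup>2" for z
      by (simp add: fmod_def E_def r_def norm_mult norm_divide power_mult_distrib power_divide)
    have Em: "E \<in> borel_measurable borel" and Fm: "F \<in> borel_measurable borel"
      using polyrep_continuous[OF E] polyrep_continuous[OF F] by (auto intro: borel_measurable_continuous_onI)
    have cm: "cocr m (\<phi> m) \<in> borel_measurable borel"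
      using polyrep_continuous[OF polyrep_cocr[OF hol]] by (rule borel_measurable_continuous_onI)
    have nE: "fock_norm2 E \<le> ennreal (r * C) * S"
    proof -
      have "fock_norm2 E = ennreal r * fock_norm2 (cocr m (\<phi> m))"
        unfolding fock_norm2_fmod fE using cm r0
        by (subst nn_integral_cmult[symmetric]) (auto simp: ennreal_mult)
      also have "\<dots> \<le> ennreal r * (ennreal C * S)" unfolding S_def by (intro mult_left_mono top[OF F fin]) simp
      finally show ?thesis using r0 C by (simp add: ennreal_mult mult.assoc)
    qed
    \<comment> \<open>The Bessel inequality makes the sample sum finite, hence also the norms of E
      and F - E, which the induction hypothesis requires.\<close>
    have Sfin: "S < \<infinity>"
    proof -
      have "S \<le> ennreal B * fock_norm2 F" unfolding S_def by (rule bessel[OF F])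
      also have "\<dots> < \<infinity>" using fin by (simp add: ennreal_mult_less_top)
      finally show ?thesis .
    qed
    define F' where "F' z = F z - E z" for z
    have F': "polyrep m (\<lambda>k z. \<phi> k z - \<eta> k z) F'"
      unfolding polyrep_def
    proof (intro conjI allI impI)
      show "(\<lambda>z. \<phi> k z - \<eta> k z) holomorphic_on UNIV" if "k < m" for k
        using F E that by (intro holomorphic_intros) (auto simp: polyrep_def)
      fix z
      have "F' z = (\<Sum>k<Suc m. cnj z ^ k * (\<phi> k z - \<eta> k z))"
        using F E by (simp add: F'_def polyrep_def sum_subtractf right_diff_distrib del: sum.lessThan_Suc)
      then show "F' z = (\<Sum>k<m. cnj z ^ k * (\<phi> k z - \<eta> k z))" by (simp add: \<eta>m)
    qed
    have Fm': "F' \<in> borel_measurable borel"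
      using polyrep_continuous[OF F'] by (rule borel_measurable_continuous_onI)
    have nF': "fock_norm2 F' \<le> 2 * fock_norm2 F + 2 * fock_norm2 E"
      unfolding fock_norm2_fmod
    proof (rule nn_integral_sq_le_double)
      show "(fmod F' x)\<^sup>2 \<le> 2 * (fmod F x)\<^sup>2 + 2 * (fmod E x)\<^sup>2" for x
        unfolding F'_def[abs_def] by (rule fmod_diff_sq)
    qed (use Em Fm in measurable)
    have "fock_norm2 E < \<infinity>" using nE Sfin by (auto intro: le_less_trans simp: ennreal_mult_less_top)
    then have "2 * fock_norm2 F + 2 * fock_norm2 E < \<infinity>" using fin by (simp add: ennreal_mult_less_top)
    with nF' have finF': "fock_norm2 F' < \<infinity>" by (rule le_less_trans)
    have "(\<integral>\<^sup>+l. ennreal ((fmod F' l)\<^sup>2) \<partial>?L) \<le> 2 * S + 2 * (\<integral>\<^sup>+l. ennreal ((fmod E l)\<^sup>2) \<partial>?L)"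
      unfolding S_def
    proof (rule nn_integral_sq_le_double)
      show "(fmod F' x)\<^sup>2 \<le> 2 * (fmod F x)\<^sup>2 + 2 * (fmod E x)\<^sup>2" for x
        unfolding F'_def[abs_def] by (rule fmod_diff_sq)
    qed auto
    also have "\<dots> \<le> 2 * S + 2 * (ennreal B * (ennreal (r * C) * S))"
      by (intro add_left_mono mult_left_mono order_trans[OF bessel[OF E]] nE) auto
    also have "\<dots> = ennreal (2 + 2 * (B * (r * C))) * S"
      using B C r0 by (simp add: ennreal_mult ennreal_plus distrib_left distrib_right mult_ac)
    finally have SF': "(\<integral>\<^sup>+l. ennreal ((fmod F' l)\<^sup>2) \<partial>?L) \<le> ennreal (2 + 2 * (B * (r * C))) * S" .
    have "fock_norm2 F \<le> 2 * fock_norm2 F' + 2 * fock_norm2 E"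
      unfolding fock_norm2_fmod
    proof (rule nn_integral_sq_le_double)
      show "(fmod F x)\<^sup>2 \<le> 2 * (fmod F' x)\<^sup>2 + 2 * (fmod E x)\<^sup>2" for x
        unfolding F'_def[abs_def] by (rule fmod_sum_sq)
    qed (use Em Fm' in measurable)
    also have "\<dots> \<le> 2 * (ennreal A * (ennreal (2 + 2 * (B * (r * C))) * S)) + 2 * (ennreal (r * C) * S)"
      by (intro add_mono mult_left_mono order_trans[OF IH[OF F' finF']] SF' nE) auto
    also have "\<dots> = ennreal C3 * S"
    proof -
      have n1: "2 + 2 * (B * (r * C)) \<ge> 0" "r * C \<ge> 0" using B C r0 by auto
      have "ennreal C3 = 2 * (ennreal A * ennreal (2 + 2 * (B * (r * C)))) + 2 * ennreal (r * C)"
        unfolding C3_def using A n1 by (simp add: ennreal_plus[symmetric] ennreal_mult[symmetric] ennreal_numeral[symmetric] del: ennreal_plus ennreal_numeral)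
      then show ?thesis by (simp add: distrib_right mult.assoc)
    qed
    finally show ?thesis by (simp only: S_def)
  qed
  show ?case by (rule exI[of _ C3]) (use C3 main in auto)
qed

subsection \<open>Failure of sampling up to the critical density\<close>

definition lower_sampling :: "complex \<Rightarrow> complex \<Rightarrow> nat \<Rightarrow> bool" where
  "lower_sampling a b n \<longleftrightarrow> (\<exists>A>0. \<forall>F \<phi>. polyrep n \<phi> F \<longrightarrow> fock_norm2 F < \<infinity> \<longrightarrow>
     ennreal A * fock_norm2 F \<le> (\<integral>\<^sup>+l. ennreal ((fmod F l)\<^sup>2) \<partial>count_space (lat a b)))"

lemma polyrep_dilate:
  assumes F: "polyrep n \<phi> F" and e: "e holomorphic_on UNIV"
  shows "polyrep n (\<lambda>k z. of_real t ^ k * \<phi> k (of_real t * z) * e z) (\<lambda>z. F (of_real t * z) * e z)"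
  unfolding polyrep_def
proof (intro conjI allI impI)
  fix k assume k: "k < n"
  have "(\<phi> k \<circ> (\<lambda>z. of_real t * z)) holomorphic_on UNIV"
    by (rule holomorphic_on_compose_gen[where t=UNIV]) (use F k in \<open>auto simp: polyrep_def intro!: holomorphic_intros\<close>)
  then show "(\<lambda>z. of_real t ^ k * \<phi> k (of_real t * z) * e z) holomorphic_on UNIV"
    using e by (intro holomorphic_intros) (simp_all add: o_def)
next
  fix z
  show "F (of_real t * z) * e z = (\<Sum>k<n. cnj z ^ k * (of_real t ^ k * \<phi> k (of_real t * z) * e z))"
  proof -
    have "F (of_real t * z) * e z = (\<Sum>k<n. cnj (of_real t * z) ^ k * \<phi> k (of_real t * z)) * e z"
      using F by (simp only: polyrep_def)
    also have "\<dots> = (\<Sum>k<n. cnj z ^ k * (of_real t ^ k * \<phi> k (of_real t * z) * e z))"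
      unfolding sum_distrib_right by (rule sum.cong[OF refl]) (simp add: power_mult_distrib mult_ac)
    finally show ?thesis .
  qed
qed

text \<open>The inequality is applied to \<open>F (t * z) * exp (c * cnj x * z)\<close> with \<open>c = pi * (1 - t\<^sup>2)\<close>: the second
  factor turns the excess weight into a Gaussian centred at \<open>x\<close>, and integrating over \<open>x\<close> removes it.\<close>

lemma lower_sampling_dilate:
  assumes low: "lower_sampling a b n" and t: "0 < t" "t < 1"
  shows "lower_sampling (of_real t * a) (of_real t * b) n"
proof -
  from low obtain A where A': "A > 0 \<and> (\<forall>F \<phi>. polyrep n \<phi> F \<longrightarrow> fock_norm2 F < \<infinity> \<longrightarrow>
     ennreal A * fock_norm2 F \<le> (\<integral>\<^sup>+l. ennreal ((fmod F l)\<^sup>2) \<partial>count_space (lat a b)))"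
    unfolding lower_sampling_def by (rule exE)
  note A = conjunct1[OF A'] and low = conjunct2[OF A', rule_format]
  let ?L = "count_space (lat a b)"
  define c where "c = pi * (1 - t\<^sup>2)"
  have c: "c > 0" using t by (simp add: c_def abs_square_less_1)
  define P where "P = pi / c"
  have P: "P > 0" using c by (simp add: P_def)
  define G where "G = enn2real gauss_mass"
  have G: "gauss_mass = ennreal G" "G > 0" using gauss_mass_finite gauss_mass_pos
    by (auto simp: G_def enn2real_positive_iff less_top)
  define k where "k = P * G"
  have k: "k > 0" using P G by (simp add: k_def)
  have gint: "(\<integral>\<^sup>+x. ennreal (exp (- c * (norm (z - x))\<^sup>2)) \<partial>lborel) = ennreal k" for z :: complex
    using nn_integral_gauss[OF c, of z] P G(2) by (simp add: norm_minus_commute P_def[symmetric] G(1) k_def ennreal_mult)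
  have main: "ennreal (A / t\<^sup>2) * fock_norm2 F \<le> (\<integral>\<^sup>+l. ennreal ((fmod F l)\<^sup>2) \<partial>count_space (lat (of_real t * a) (of_real t * b)))"
    if F: "polyrep n \<phi> F" and fin: "fock_norm2 F < \<infinity>" for F \<phi>
  proof -
    define W where "W z = (fmod F (of_real t * z))\<^sup>2" for z
    have W0: "W z \<ge> 0" for z by (simp add: W_def)
    have Fc: "continuous_on UNIV F" by (rule polyrep_continuous[OF F])
    have Fm[measurable]: "F \<in> borel_measurable borel" using Fc by (rule borel_measurable_continuous_onI)
    have Wc: "continuous_on S W" for S
    proof -
      have "continuous_on UNIV (\<lambda>z. fmod F (of_real t * z))"
        by (rule continuous_on_compose2[OF continuous_fmod[OF Fc]]) (auto intro!: continuous_intros)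
      then have "continuous_on UNIV W" unfolding W_def by (intro continuous_intros)
      then show ?thesis by (rule continuous_on_subset) simp
    qed
    have Wm[measurable]: "W \<in> borel_measurable borel" by (rule borel_measurable_continuous_onI[OF Wc])
    have Wint: "(\<integral>\<^sup>+z. ennreal (W z) \<partial>lborel) = ennreal (1 / t\<^sup>2) * fock_norm2 F"
    proof -
      have "fock_norm2 F = ennreal (t\<^sup>2) * (\<integral>\<^sup>+z. ennreal (W z) \<partial>lborel)"
        unfolding fock_norm2_fmod W_def by (rule nn_integral_dilate[OF _ t(1)]) measurable
      then have "ennreal (1 / t\<^sup>2) * fock_norm2 F = (ennreal (1 / t\<^sup>2) * ennreal (t\<^sup>2)) * (\<integral>\<^sup>+z. ennreal (W z) \<partial>lborel)"
        by (simp only: mult.assoc)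
      also have "ennreal (1 / t\<^sup>2) * ennreal (t\<^sup>2) = 1" using t by (simp add: ennreal_mult[symmetric])
      finally show ?thesis by simp
    qed
    \<comment> \<open>The assumed inequality for the localised function, with the common factor exp
      (c * |x|^2) divided out.\<close>
    have px: "ennreal A * (\<integral>\<^sup>+z. ennreal (W z * exp (- c * (norm (z - x))\<^sup>2)) \<partial>lborel)
      \<le> (\<integral>\<^sup>+l. ennreal (W l * exp (- c * (norm (l - x))\<^sup>2)) \<partial>?L)" for x
    proof -
      define H where "H z = F (of_real t * z) * exp (of_real c * cnj x * z)" for z
      have H: "polyrep n (\<lambda>k z. of_real t ^ k * \<phi> k (of_real t * z) * exp (of_real c * cnj x * z)) H"
        unfolding H_def[abs_def] by (rule polyrep_dilate[OF F]) (auto intro!: holomorphic_intros)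
      define q where "q = exp (c * (norm x)\<^sup>2)"
      have q: "q > 0" by (simp add: q_def)
      have fH: "(fmod H z)\<^sup>2 = q * (W z * exp (- c * (norm (z - x))\<^sup>2))" for z
      proof -
        have n1: "(norm (z - x))\<^sup>2 = (norm z)\<^sup>2 + (norm x)\<^sup>2 - 2 * Re (cnj x * z)"
          using norm_add_sq_complex[of z "- x"] by simp
        have "(fmod H z)\<^sup>2 = (norm (F (of_real t * z)))\<^sup>2 * (exp (2 * (c * Re (cnj x * z))) * exp (- pi * (norm z)\<^sup>2))"
          unfolding fmod_sq[symmetric] H_def by (simp add: norm_mult power_mult_distrib exp_double[symmetric] algebra_simps)
        also have "exp (2 * (c * Re (cnj x * z))) * exp (- pi * (norm z)\<^sup>2) = exp (- pi * (norm (of_real t * z))\<^sup>2) * (q * exp (- c * (norm (z - x))\<^sup>2))"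
          unfolding q_def mult_exp_exp n1 norm_mult power_mult_distrib c_def
          by (rule arg_cong[where f=exp]) (simp add: algebra_simps)
        finally show ?thesis unfolding W_def fmod_sq[symmetric] by (simp only: mult_ac)
      qed
      have nH: "fock_norm2 H = ennreal q * (\<integral>\<^sup>+z. ennreal (W z * exp (- c * (norm (z - x))\<^sup>2)) \<partial>lborel)"
        unfolding fock_norm2_fmod fH using q W0 by (subst nn_integral_cmult[symmetric]) (auto simp: ennreal_mult)
      have "(\<integral>\<^sup>+z. ennreal (W z * exp (- c * (norm (z - x))\<^sup>2)) \<partial>lborel) \<le> (\<integral>\<^sup>+z. ennreal (W z) \<partial>lborel)"
        using W0 c by (intro nn_integral_mono ennreal_leI) (auto intro!: mult_left_le)
      also have "\<dots> < \<infinity>" unfolding Wint using fin by (simp add: ennreal_mult_less_top)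
      finally have finH: "fock_norm2 H < \<infinity>" unfolding nH by (simp add: ennreal_mult_less_top)
      have "ennreal A * fock_norm2 H \<le> (\<integral>\<^sup>+l. ennreal ((fmod H l)\<^sup>2) \<partial>?L)" by (rule low[OF H finH])
      also have "\<dots> = ennreal q * (\<integral>\<^sup>+l. ennreal (W l * exp (- c * (norm (l - x))\<^sup>2)) \<partial>?L)"
        unfolding fH using q W0 by (subst nn_integral_cmult[symmetric]) (auto simp: ennreal_mult)
      finally have *: "ennreal q * (ennreal A * (\<integral>\<^sup>+z. ennreal (W z * exp (- c * (norm (z - x))\<^sup>2)) \<partial>lborel))
          \<le> ennreal q * (\<integral>\<^sup>+l. ennreal (W l * exp (- c * (norm (l - x))\<^sup>2)) \<partial>?L)"
        unfolding nH by (simp only: mult.left_commute)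
      have "ennreal (1 / q) * (ennreal q * y) = y" for y
      proof -
        have "ennreal (1 / q) * ennreal q = 1" using q by (simp add: ennreal_mult[symmetric])
        then show ?thesis by (simp only: mult.assoc[symmetric] mult_1_left)
      qed
      with mult_left_mono[OF *, of "ennreal (1 / q)"] show ?thesis by simp
    qed
    \<comment> \<open>Integration over the centre x: by Tonelli every Gaussian contributes the same
      constant k on both sides, which then cancels.\<close>
    have "ennreal A * (\<integral>\<^sup>+x. (\<integral>\<^sup>+z. ennreal (W z * exp (- c * (norm (z - x))\<^sup>2)) \<partial>lborel) \<partial>lborel)
      \<le> (\<integral>\<^sup>+x. ennreal A * (\<integral>\<^sup>+z. ennreal (W z * exp (- c * (norm (z - x))\<^sup>2)) \<partial>lborel) \<partial>lborel)"
    proof -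
      have "(\<lambda>(x, z). W z * exp (- c * (norm (z - x))\<^sup>2)) \<in> borel_measurable (borel :: (complex \<times> complex) measure)"
        unfolding case_prod_unfold
        by (intro borel_measurable_continuous_onI continuous_intros continuous_on_compose2[OF Wc[of UNIV]]) auto
      then have m: "(\<lambda>(x, z). ennreal (W z * exp (- c * (norm (z - x))\<^sup>2))) \<in> borel_measurable (lborel \<Otimes>\<^sub>M lborel)"
        unfolding lborel_prod by (simp add: case_prod_unfold)
      have "(\<lambda>x. \<integral>\<^sup>+z. ennreal (W z * exp (- c * (norm (z - x))\<^sup>2)) \<partial>lborel) \<in> borel_measurable lborel"
        using lborel.borel_measurable_nn_integral[OF m] by simp
      from nn_integral_cmult[OF this, of "ennreal A"] show ?thesis by simp
    qed
    also have "\<dots> \<le> (\<integral>\<^sup>+x. (\<integral>\<^sup>+l. ennreal (W l * exp (- c * (norm (l - x))\<^sup>2)) \<partial>?L) \<partial>lborel)"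
      by (intro nn_integral_mono px)
    also have "\<dots> = (\<integral>\<^sup>+l. (\<integral>\<^sup>+x. ennreal (W l * exp (- c * (norm (l - x))\<^sup>2)) \<partial>lborel) \<partial>?L)"
      by (rule nn_integral_count_space_nn_integral[OF lat_countable]) measurable
    also have "\<dots> = (\<integral>\<^sup>+l. ennreal k * ennreal (W l) \<partial>?L)"
    proof (rule nn_integral_cong)
      fix l
      have "(\<integral>\<^sup>+x. ennreal (W l * exp (- c * (norm (l - x))\<^sup>2)) \<partial>lborel) = ennreal (W l) * (\<integral>\<^sup>+x. ennreal (exp (- c * (norm (l - x))\<^sup>2)) \<partial>lborel)"
        using W0 by (subst nn_integral_cmult[symmetric]) (auto simp: ennreal_mult)
      then show "(\<integral>\<^sup>+x. ennreal (W l * exp (- c * (norm (l - x))\<^sup>2)) \<partial>lborel) = ennreal k * ennreal (W l)"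
        unfolding gint by (simp only: mult.commute)
    qed
    also have "\<dots> = ennreal k * (\<integral>\<^sup>+l. ennreal (W l) \<partial>?L)" by (rule nn_integral_cmult) simp
    also have "(\<integral>\<^sup>+x. (\<integral>\<^sup>+z. ennreal (W z * exp (- c * (norm (z - x))\<^sup>2)) \<partial>lborel) \<partial>lborel) = ennreal k * (\<integral>\<^sup>+z. ennreal (W z) \<partial>lborel)"
    proof -
      have "(\<lambda>(z, x). W z * exp (- c * (norm (z - x))\<^sup>2)) \<in> borel_measurable (borel :: (complex \<times> complex) measure)"
        unfolding case_prod_unfold
        by (intro borel_measurable_continuous_onI continuous_intros continuous_on_compose2[OF Wc[of UNIV]]) auto
      then have m: "(\<lambda>(z, x). ennreal (W z * exp (- c * (norm (z - x))\<^sup>2))) \<in> borel_measurable (lborel \<Otimes>\<^sub>M lborel)"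
        unfolding lborel_prod by (simp add: case_prod_unfold)
      have "(\<integral>\<^sup>+x. (\<integral>\<^sup>+z. ennreal (W z * exp (- c * (norm (z - x))\<^sup>2)) \<partial>lborel) \<partial>lborel) = (\<integral>\<^sup>+z. (\<integral>\<^sup>+x. ennreal (W z * exp (- c * (norm (z - x))\<^sup>2)) \<partial>lborel) \<partial>lborel)"
        using lborel_pair.Fubini'[OF m] by simp
      also have "\<dots> = (\<integral>\<^sup>+z. ennreal k * ennreal (W z) \<partial>lborel)"
      proof (rule nn_integral_cong)
        fix z
        have "(\<integral>\<^sup>+x. ennreal (W z * exp (- c * (norm (z - x))\<^sup>2)) \<partial>lborel) = ennreal (W z) * (\<integral>\<^sup>+x. ennreal (exp (- c * (norm (z - x))\<^sup>2)) \<partial>lborel)"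
          using W0 by (subst nn_integral_cmult[symmetric]) (auto simp: ennreal_mult)
        then show "(\<integral>\<^sup>+x. ennreal (W z * exp (- c * (norm (z - x))\<^sup>2)) \<partial>lborel) = ennreal k * ennreal (W z)"
          unfolding gint by (simp only: mult.commute)
      qed
      also have "\<dots> = ennreal k * (\<integral>\<^sup>+z. ennreal (W z) \<partial>lborel)" by (rule nn_integral_cmult) measurable
      finally show ?thesis .
    qed
    finally have *: "ennreal A * (ennreal k * (\<integral>\<^sup>+z. ennreal (W z) \<partial>lborel)) \<le> ennreal k * (\<integral>\<^sup>+l. ennreal (W l) \<partial>?L)" .
    have "ennreal (1 / k) * (ennreal k * y) = y" for y
    proof -
      have "ennreal (1 / k) * ennreal k = 1" using k by (simp add: ennreal_mult[symmetric])
      then show ?thesis by (simp only: mult.assoc[symmetric] mult_1_left)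
    qed
    with mult_left_mono[OF *, of "ennreal (1 / k)"] have "ennreal A * (\<integral>\<^sup>+z. ennreal (W z) \<partial>lborel) \<le> (\<integral>\<^sup>+l. ennreal (W l) \<partial>?L)"
      by (simp add: mult.left_commute[of "ennreal A"])
    also have "(\<integral>\<^sup>+l. ennreal (W l) \<partial>?L) = (\<integral>\<^sup>+l. ennreal ((fmod F l)\<^sup>2) \<partial>count_space (lat (of_real t * a) (of_real t * b)))"
      unfolding W_def
    proof (rule nn_integral_bij_count_space)
      show "bij_betw (\<lambda>l. of_real t * l) (lat a b) (lat (of_real t * a) (of_real t * b))"
      proof (rule bij_betwI')
        show "x \<in> lat a b \<Longrightarrow> y \<in> lat a b \<Longrightarrow> (of_real t * x = of_real t * y) = (x = y)" for x y using t by simp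
        show "x \<in> lat a b \<Longrightarrow> of_real t * x \<in> lat (of_real t * a) (of_real t * b)" for x
          by (elim latE) (use latI in \<open>simp add: distrib_left mult.left_commute[of "of_real t"]\<close>)
        fix y assume "y \<in> lat (of_real t * a) (of_real t * b)"
        then obtain p q where "y = of_int p * (of_real t * a) + of_int q * (of_real t * b)" by (elim latE) simp
        then have "y = of_real t * (of_int p * a + of_int q * b)" by (simp add: algebra_simps)
        then show "\<exists>x\<in>lat a b. y = of_real t * x" using latI by blast
      qed
    qed
    finally show ?thesis unfolding Wint using A t by (simp add: mult.assoc[symmetric] ennreal_mult[symmetric])
  qed
  have "A / t\<^sup>2 > 0" using A t by simp
  then show ?thesis unfolding lower_sampling_def by (intro exI[of _ "A / t\<^sup>2"] conjI allI impI main)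
qed

text \<open>Uniqueness of the top coefficient. After moving z to the origin and multiplying by u ^
  (n - 1), the Gaussian integral would detect a nonzero value.\<close>

lemma polyrep_zero_imp_top_zero:
  assumes F: "polyrep n \<phi> F" and n: "n \<ge> 1" and z: "\<And>z. F z = 0"
  shows "\<phi> (n - 1) z = 0"
proof -
  obtain \<psi> where \<psi>: "polyrep n \<psi> (fshift z F)" "\<psi> (n - 1) = fshift z (\<phi> (n - 1))"
    using polyrep_fshift[OF F, of z] n by auto
  from gaussian_polyrep_integral[OF n, THEN exE] obtain N where N': "N > 0 \<and> (\<forall>\<theta> H. (\<forall>l<n. \<theta> l holomorphic_on UNIV) \<longrightarrow> (\<forall>u. H u = (\<Sum>l<n. cnj u ^ l * (u ^ (n - 1) * \<theta> l u)))
     \<longrightarrow> integrable lborel (\<lambda>u. of_real (exp (- pi * (norm u)\<^sup>2)) * H u)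
     \<longrightarrow> norm (\<theta> (n - 1) 0) * N \<le> norm (LINT u|lborel. of_real (exp (- pi * (norm u)\<^sup>2)) * H u)
       \<and> (\<theta> (n - 1) 0 = 0 \<longrightarrow> (LINT u|lborel. of_real (exp (- pi * (norm u)\<^sup>2)) * H u) = 0))" .
  note N = conjunct1[OF N'] and gp = conjunct2[OF N', THEN spec, THEN spec, THEN mp, THEN mp, THEN mp, THEN conjunct1]
  have z': "fshift z F u = 0" for u by (simp add: fshift_def z)
  have 1: "\<forall>l<n. \<psi> l holomorphic_on UNIV" using \<psi> by (simp add: polyrep_def)
  have 2: "\<forall>u. 0 = (\<Sum>l<n. cnj u ^ l * (u ^ (n - 1) * \<psi> l u))"
  proof
    fix u
    have "0 = u ^ (n - 1) * fshift z F u" by (simp add: z')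
    also have "\<dots> = u ^ (n - 1) * (\<Sum>l<n. cnj u ^ l * \<psi> l u)" using \<psi>(1) by (simp only: polyrep_def)
    also have "\<dots> = (\<Sum>l<n. cnj u ^ l * (u ^ (n - 1) * \<psi> l u))"
      unfolding sum_distrib_left by (rule sum.cong[OF refl]) (simp only: mult.left_commute)
    finally show "0 = (\<Sum>l<n. cnj u ^ l * (u ^ (n - 1) * \<psi> l u))" .
  qed
  have "norm (\<psi> (n - 1) 0) * N \<le> norm (LINT u|lborel. of_real (exp (- pi * (norm (u::complex))\<^sup>2)) * (0::complex))"
    by (rule gp[OF 1 2]) simp
  then have "norm (\<psi> (n - 1) 0) * N \<le> 0" by simp
  then have "\<psi> (n - 1) 0 = 0" using N by (simp add: mult_le_0_iff)
  then show ?thesis unfolding \<psi>(2) by (simp add: fshift_def)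
qed

section \<open>Determinants and quasi-periodic Landau levels\<close>

lemma det_row_scale:
  fixes m :: "nat \<Rightarrow> nat \<Rightarrow> complex"
  shows "Determinant.det (mat n n (\<lambda>(i, j). c i * m i j)) = (\<Prod>i=0..<n. c i) * Determinant.det (mat n n (\<lambda>(i, j). m i j))"
proof -
  have p: "(\<Prod>i=0..<n. mat n n (\<lambda>(i, j). f i j) $$ (i, p i)) = (\<Prod>i=0..<n. f i (p i))"
    if "p permutes {0..<n}" for p and f :: "nat \<Rightarrow> nat \<Rightarrow> complex"
    using permutes_in_image[OF that] by (intro prod.cong) auto
  have D: "Determinant.det (mat n n (\<lambda>(i, j). f i j)) = (\<Sum>p\<in>{p. p permutes {0..<n}}. signof p * (\<Prod>i=0..<n. f i (p i)))"
    for f :: "nat \<Rightarrow> nat \<Rightarrow> complex"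
    by (subst det_def'[where n=n], simp, rule sum.cong[OF refl], subst p) simp_all
  show ?thesis
    unfolding D sum_distrib_left by (rule sum.cong[OF refl]) (simp add: prod.distrib mult_ac)
qed

lemma det_zero_imp_kernel:
  fixes m :: "nat \<Rightarrow> nat \<Rightarrow> complex"
  assumes "Determinant.det (mat n n (\<lambda>(i, j). m i j)) = 0"
  shows "\<exists>c. (\<exists>j<n. c j \<noteq> 0) \<and> (\<forall>i<n. (\<Sum>j<n. c j * m i j) = 0)"
proof -
  define M where "M = mat n n (\<lambda>(i, j). m i j)"
  have M: "M \<in> carrier_mat n n" by (simp add: M_def)
  have "Determinant.det M = 0" using assms by (simp only: M_def)
  then obtain v where v: "v \<in> carrier_vec n" "v \<noteq> 0\<^sub>v n" "M *\<^sub>v v = 0\<^sub>v n"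
    using det_0_iff_vec_prod_zero_field[OF M] by blast
  have dv: "dim_vec v = n" using v(1) by simp
  have "\<exists>j<n. vec_index v j \<noteq> 0"
  proof (rule ccontr)
    assume "\<not> ?thesis"
    then have "v = 0\<^sub>v n" using dv by (intro eq_vecI) auto
    with v(2) show False by simp
  qed
  moreover have "(\<Sum>j<n. vec_index v j * m i j) = 0" if i: "i < n" for i
  proof -
    have "0 = vec_index (M *\<^sub>v v) i" using v(3) i by simp
    also have "\<dots> = (\<Sum>j = 0..<n. m i j * vec_index v j)"
      using i dv by (simp add: M_def scalar_prod_def)
    finally show ?thesis by (simp add: atLeast0LessThan mult.commute)
  qed
  ultimately show ?thesis by (intro exI[of _ "vec_index v"]) auto
qed

text \<open>The factor exp (- pi * cnj (z + v) * u) inside \<open>cocr\<close> cancels the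
  u-dependence of the multiplier of s. All Landau levels raised from s thus share its multiplier,
  and their combinations stay quasi-periodic.\<close>

lemma cocr_quasi_periodic:
  assumes s: "s holomorphic_on UNIV" and q: "\<And>z. s (z + v) = c * exp (of_real pi * cnj v * z) * s z"
  shows "cocr m s (z + v) = c * exp (of_real pi * cnj v * z) * cocr m s z"
proof -
  define C where "C = c * exp (of_real pi * cnj v * z)"
  have "exp (- of_real pi * cnj (z + v) * u) * s (z + v + u) = C * (exp (- of_real pi * cnj z * u) * s (z + u))" for u
  proof -
    have "s (z + v + u) = c * exp (of_real pi * cnj v * (z + u)) * s (z + u)"
      using q[of "z + u"] by (simp add: add_ac)
    moreover have "exp (- of_real pi * cnj (z + v) * u) * exp (of_real pi * cnj v * (z + u)) = exp (of_real pi * cnj v * z) * exp (- of_real pi * cnj z * u)"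
      unfolding mult_exp_exp by (rule arg_cong[where f=exp]) (simp add: algebra_simps)
    ultimately show ?thesis unfolding C_def by (simp only: mult_ac)
  qed
  moreover have "(deriv ^^ m) (\<lambda>u. C * (exp (- of_real pi * cnj z * u) * s (z + u))) 0 = C * cocr m s z"
    unfolding cocr_def by (rule higher_deriv_cmult[of _ UNIV]) (auto intro!: holomorphic_intros holomorphic_shift s)
  ultimately show ?thesis by (simp only: cocr_def[of m s "z + v"] C_def)
qed

text \<open>The system is triangular: level j contributes powers of cnj z only up to j, so the top
  coefficient comes from level n - 1 alone.\<close>

lemma polyrep_sum_cocr:
  assumes s: "s holomorphic_on UNIV"
  shows "\<exists>\<phi>. polyrep n \<phi> (\<lambda>z. \<Sum>j<n. c j * cocr j s z) \<and> (n > 0 \<longrightarrow> \<phi> (n - 1) = (\<lambda>z. c (n - 1) * (- of_real pi) ^ (n - 1) * s z))"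
proof -
  define \<eta> where "\<eta> j i z = of_nat (j choose i) * (- of_real pi) ^ i * (deriv ^^ (j - i)) s z" for j i z
  have E: "cocr j s z = (\<Sum>i<n. cnj z ^ i * \<eta> j i z)" if "j < n" for j z
  proof -
    have "cocr j s z = (\<Sum>i<Suc j. cnj z ^ i * \<eta> j i z)" using cocr_expand[OF s, of j z] by (simp only: \<eta>_def)
    also have "\<dots> = (\<Sum>i<n. cnj z ^ i * \<eta> j i z)"
      using that by (intro sum.mono_neutral_left) (auto simp: \<eta>_def)
    finally show ?thesis .
  qed
  have h: "\<eta> j i holomorphic_on UNIV" for j i
    unfolding \<eta>_def[abs_def] using s by (auto intro!: holomorphic_intros)
  define \<phi> where "\<phi> i z = (\<Sum>j<n. c j * \<eta> j i z)" for i z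
  have "polyrep n \<phi> (\<lambda>z. \<Sum>j<n. c j * cocr j s z)"
    unfolding polyrep_def
  proof (intro conjI allI impI)
    show "\<phi> k holomorphic_on UNIV" for k unfolding \<phi>_def[abs_def] using h by (auto intro!: holomorphic_intros)
    fix z
    have "(\<Sum>j<n. c j * cocr j s z) = (\<Sum>j<n. \<Sum>i<n. cnj z ^ i * (c j * \<eta> j i z))"
    proof (rule sum.cong[OF refl])
      fix j assume "j \<in> {..<n}"
      then have "c j * cocr j s z = (\<Sum>i<n. c j * (cnj z ^ i * \<eta> j i z))" by (simp add: E sum_distrib_left)
      then show "c j * cocr j s z = (\<Sum>i<n. cnj z ^ i * (c j * \<eta> j i z))" by (simp only: mult.left_commute)
    qed
    also have "\<dots> = (\<Sum>i<n. \<Sum>j<n. cnj z ^ i * (c j * \<eta> j i z))" by (rule sum.swap)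
    finally show "(\<Sum>j<n. c j * cocr j s z) = (\<Sum>k<n. cnj z ^ k * \<phi> k z)" by (simp only: \<phi>_def sum_distrib_left)
  qed
  moreover have "\<phi> (n - 1) = (\<lambda>z. c (n - 1) * (- of_real pi) ^ (n - 1) * s z)" if n: "n > 0"
  proof
    fix z
    have "\<phi> (n - 1) z = (\<Sum>j\<in>{n - 1}. c j * \<eta> j (n - 1) z)"
      unfolding \<phi>_def using n by (intro sum.mono_neutral_right) (auto simp: \<eta>_def)
    then show "\<phi> (n - 1) z = c (n - 1) * (- of_real pi) ^ (n - 1) * s z" by (simp add: \<eta>_def)
  qed
  ultimately show ?thesis by (intro exI[of _ \<phi>] conjI impI)
qed

text \<open>Lower levels cannot cancel the highest level with nonzero weight, which alone determines
  the top coefficient, a nonzero multiple of s.\<close>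

lemma sum_cocr_nonzero:
  assumes s: "s holomorphic_on UNIV" and nz: "s z1 \<noteq> 0" and c: "\<exists>j<n. c j \<noteq> 0"
  shows "\<exists>z. (\<Sum>j<n. c j * cocr j s z) \<noteq> 0"
  using c
proof (induction n)
  case 0
  then show ?case by simp
next
  case (Suc n)
  show ?case
  proof (cases "c n = 0")
    case True
    then have "\<exists>j<n. c j \<noteq> 0" using Suc.prems less_Suc_eq by metis
    from Suc.IH[OF this] show ?thesis by (simp add: True)
  next
    case False
    show ?thesis
    proof (rule ccontr)
      assume "\<not> ?thesis"
      then have z: "(\<Sum>j<Suc n. c j * cocr j s z) = 0" for z by metis
      obtain \<phi> where \<phi>: "polyrep (Suc n) \<phi> (\<lambda>z. \<Sum>j<Suc n. c j * cocr j s z)"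
        "\<phi> n = (\<lambda>z. c n * (- of_real pi) ^ n * s z)"
        using polyrep_sum_cocr[OF s, of "Suc n" c] by auto
      have "\<phi> (Suc n - 1) z1 = 0" by (rule polyrep_zero_imp_top_zero[OF \<phi>(1)]) (simp, rule z)
      then show False using \<phi>(2) False nz by simp
    qed
  qed
qed

text \<open>At the critical density the determinant of the sampling conditions on the quasi-periodic
  functions of all \<open>n\<close> Landau levels has a zero, for topological reasons.\<close>

lemma exists_vanishing_quasi_periodic:
  assumes n: "n \<ge> 1" and ab: "\<bar>Im (cnj a * b)\<bar> = 1 / real n"
  shows "\<exists>\<phi> H. polyrep n \<phi> H \<and> (\<exists>z. H z \<noteq> 0) \<and> (\<forall>l\<in>lat a b. H l = 0)
     \<and> (\<forall>l\<in>lat (of_nat n * a) b. \<forall>z. fmod H (z + l) = fmod H z)"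
proof -
  \<comment> \<open>The sublattice generated by n * a and b has unit area, as the theta construction
    requires, and index n in the given lattice, with representatives i * a for i < n.\<close>
  define a' where "a' = of_nat n * a"
  have "Im (cnj a' * b) = real n * Im (cnj a * b)" by (simp add: a'_def algebra_simps)
  then have a'b: "\<bar>Im (cnj a' * b)\<bar> = 1" using ab n by (simp add: abs_mult)
  have nd: "Im (cnj a' * b) \<noteq> 0" using a'b by auto
  obtain s z1 where s: "s holomorphic_on UNIV" "s z1 \<noteq> 0" "quasi_periodic a' s" "quasi_periodic b s"
    using exists_quasi_periodic_entire[OF a'b] by (elim exE conjE) metis
  \<comment> \<open>Rows are the cosets of the sublattice, columns the Landau levels. A kernel
    vector of this matrix is a combination of levels vanishing at one translate of each coset
    representative.\<close>
  define M where "M z i j = cocr j s (z + of_nat i * a)" for z i j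
  define d where "d z = Determinant.det (mat n n (\<lambda>(i, j). M z i j))" for z
  have Mc: "continuous_on UNIV (\<lambda>z. M z i j)" for i j
    unfolding M_def
    by (rule continuous_on_compose2[OF polyrep_continuous[OF polyrep_cocr[OF s(1)]]]) (auto intro!: continuous_intros)
  have dc: "continuous_on UNIV d"
  proof -
    have "d = (\<lambda>z. \<Sum>p\<in>{p. p permutes {0..<n}}. signof p * (\<Prod>i=0..<n. M z i (p i)))"
    proof
      fix z
      have p: "(\<Prod>i=0..<n. mat n n (\<lambda>(i, j). M z i j) $$ (i, p i)) = (\<Prod>i=0..<n. M z i (p i))"
        if "p permutes {0..<n}" for p
        using permutes_in_image[OF that] by (intro prod.cong) auto
      show "d z = (\<Sum>p\<in>{p. p permutes {0..<n}}. signof p * (\<Prod>i=0..<n. M z i (p i)))"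
        unfolding d_def by (subst det_def'[where n=n], simp, rule sum.cong[OF refl], subst p) simp_all
    qed
    moreover have "continuous_on UNIV (\<lambda>z. \<Sum>p\<in>{p. p permutes {0..<n}}. signof p * (\<Prod>i=0..<n. M z i (p i)))"
      by (intro continuous_intros Mc)
    ultimately show ?thesis by simp
  qed
  \<comment> \<open>Row i acquires a constant of its own times the common factor exp (pi * cnj v *
    z), so the determinant is multiplied by the n-th power of that factor; hence the parameter pi *
    n in the zero criterion.\<close>
  have dq: "\<exists>C. \<forall>z. d (z + v) = C * exp (of_real (pi * real n) * cnj v * z) * d z" if qv: "quasi_periodic v s" for v
  proof -
    obtain c where c: "\<And>z. s (z + v) = c * exp (of_real pi * cnj v * z) * s z"
      using qv unfolding quasi_periodic_def by blast
    define r where "r i = c * exp (of_real pi * cnj v * (of_nat i * a))" for i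
    define C where "C = (\<Prod>i=0..<n. r i)"
    have "d (z + v) = C * exp (of_real (pi * real n) * cnj v * z) * d z" for z
    proof -
      have M1: "M (z + v) i j = (r i * exp (of_real pi * cnj v * z)) * M z i j" for i j
      proof -
        have "M (z + v) i j = cocr j s ((z + of_nat i * a) + v)" by (simp add: M_def add_ac)
        also have "\<dots> = c * exp (of_real pi * cnj v * (z + of_nat i * a)) * cocr j s (z + of_nat i * a)"
          by (rule cocr_quasi_periodic[OF s(1) c])
        also have "exp (of_real pi * cnj v * (z + of_nat i * a)) = exp (of_real pi * cnj v * z) * exp (of_real pi * cnj v * (of_nat i * a))"
          by (simp add: distrib_left exp_add)
        finally show ?thesis by (simp add: r_def M_def mult_ac)
      qed
      have "d (z + v) = (\<Prod>i=0..<n. r i * exp (of_real pi * cnj v * z)) * d z"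
        unfolding d_def M1 by (rule det_row_scale)
      also have "(\<Prod>i=0..<n. r i * exp (of_real pi * cnj v * z)) = C * exp (of_real pi * cnj v * z) ^ n"
        by (simp add: prod.distrib C_def)
      also have "exp (of_real pi * cnj v * z) ^ n = exp (of_real (pi * real n) * cnj v * z)"
        unfolding exp_of_nat_mult[symmetric] by (simp add: mult_ac)
      finally show ?thesis .
    qed
    then show ?thesis by (intro exI[of _ C] allI)
  qed
  from dq[OF s(3)] obtain C1 where C1: "\<forall>z. d (z + a') = C1 * exp (of_real (pi * real n) * cnj a' * z) * d z" by (rule exE)
  from dq[OF s(4)] obtain C2 where C2: "\<forall>z. d (z + b) = C2 * exp (of_real (pi * real n) * cnj b * z) * d z" by (rule exE)
  have "pi * real n \<noteq> 0" using n by simp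
  from quasi_periodic_has_zero[OF dc C1[rule_format] C2[rule_format] this nd]
  obtain z0 where z0: "d z0 = 0" by (rule exE)
  from det_zero_imp_kernel[OF z0[unfolded d_def]]
  obtain c where c': "(\<exists>j<n. c j \<noteq> 0) \<and> (\<forall>i<n. (\<Sum>j<n. c j * M z0 i j) = 0)" by (rule exE)
  note c = conjunct1[OF c'] conjunct2[OF c']
  \<comment> \<open>It vanishes at the points z0 + i * a, and periodicity of its weighted modulus
    along the sublattice extends this to all of z0 + lattice.\<close>
  define H0 where "H0 z = (\<Sum>j<n. c j * cocr j s z)" for z
  have per1: "fmod H0 (z + v) = fmod H0 z" if qv: "quasi_periodic v s" for v z
  proof (rule fmod_quasi_periodic)
    obtain k where k: "norm k = exp (pi * (norm v)\<^sup>2 / 2)" "\<And>z. s (z + v) = k * exp (of_real pi * cnj v * z) * s z"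
      using qv unfolding quasi_periodic_def by blast
    have "H0 (z + v) = k * exp (of_real pi * cnj v * z) * H0 z" for z
      unfolding H0_def cocr_quasi_periodic[OF s(1) k(2)] sum_distrib_left by (rule sum.cong[OF refl]) simp
    then show "quasi_periodic v H0" unfolding quasi_periodic_def using k(1) by (intro exI[of _ k] conjI allI)
  qed
  have per: "fmod H0 (z + l) = fmod H0 z" if "l \<in> lat a' b" for l z
    by (rule periodic_lat[OF _ _ that]) (rule per1[OF s(3)], rule per1[OF s(4)])
  have zer: "fmod H0 (z0 + l) = 0" if l: "l \<in> lat a b" for l
  proof -
    obtain p q where pq: "l = of_int p * a + of_int q * b" using l by (rule latE)
    define i where "i = nat (p mod int n)"
    have i: "i < n" using n by (simp add: i_def nat_less_iff)
    have "p = int n * (p div int n) + int i" using n by (simp add: i_def)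
    then have "of_int p = (of_nat n * of_int (p div int n) + of_nat i :: complex)"
      by (metis of_int_add of_int_mult of_int_of_nat_eq)
    then have eq: "z0 + l = (z0 + of_nat i * a) + (of_int (p div int n) * a' + of_int q * b)"
      by (simp add: pq a'_def algebra_simps)
    have "fmod H0 (z0 + l) = fmod H0 (z0 + of_nat i * a)" unfolding eq by (rule per[OF latI])
    also have "H0 (z0 + of_nat i * a) = 0" using c(2) i by (simp add: H0_def M_def)
    then have "fmod H0 (z0 + of_nat i * a) = 0" by (simp add: fmod_def)
    finally show ?thesis .
  qed
  obtain \<phi>0 where "polyrep n \<phi>0 H0" using polyrep_sum_cocr[OF s(1), of n c] unfolding H0_def by blast
  from polyrep_fshift[OF this, of z0] obtain \<phi> where \<phi>: "polyrep n \<phi> (fshift z0 H0)" by blast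
  obtain z2 where z2: "H0 z2 \<noteq> 0" using sum_cocr_nonzero[OF s(1,2) c(1)] unfolding H0_def by blast
  have "fshift z0 H0 (z2 - z0) \<noteq> 0" using z2 by (simp add: fshift_def)
  moreover have "fshift z0 H0 l = 0" if "l \<in> lat a b" for l
  proof -
    have "fmod (fshift z0 H0) l = 0" using zer[OF that] by (simp add: fmod_fshift add.commute)
    then show ?thesis by (simp add: fmod_def)
  qed
  moreover have "fmod (fshift z0 H0) (z + l) = fmod (fshift z0 H0) z" if "l \<in> lat a' b" for l z
    unfolding fmod_fshift using per[OF that, of "z + z0"] by (simp add: add_ac)
  ultimately show ?thesis unfolding a'_def[symmetric]
    by (intro exI[of _ \<phi>] exI[of _ "fshift z0 H0"] conjI \<phi> ballI allI exI[of _ "z2 - z0"])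
qed

text \<open>F is real differentiable, so near a zero it is controlled by the operator norm of its
  derivative plus 1; the Gaussian weight is at most 1.\<close>

lemma polyrep_locally_lipschitz_at_zero:
  assumes F: "polyrep n \<phi> F" and z: "F p = 0"
  shows "\<exists>C>0. \<exists>\<delta>>0. \<forall>u. norm u < \<delta> \<longrightarrow> fmod F (p + u) \<le> C * norm u"
proof -
  have d: "(\<phi> k) differentiable (at p)" if "k < n" for k
  proof -
    have "\<phi> k field_differentiable (at p)"
      using F that by (auto simp: polyrep_def intro: holomorphic_on_imp_differentiable_at)
    then show ?thesis by (rule field_differentiable_imp_differentiable)
  qed
  have "cnj differentiable (at p)"
    using bounded_linear_imp_differentiable[OF bounded_linear_cnj] by simp
  then have "(\<lambda>z. \<Sum>k<n. cnj z ^ k * \<phi> k z) differentiable (at p)"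
    using d by (intro differentiable_sum differentiable_mult differentiable_power) auto
  moreover have "(\<lambda>z. \<Sum>k<n. cnj z ^ k * \<phi> k z) = F" using F by (auto simp: polyrep_def)
  ultimately obtain F' where F': "(F has_derivative F') (at p)" unfolding differentiable_def by auto
  have "\<exists>d>0. \<forall>y. norm (y - p) < d \<longrightarrow> norm (F y - F p - F' (y - p)) \<le> 1 * norm (y - p)"
    by (rule mp[OF spec[OF conjunct2[OF F'[unfolded has_derivative_at_alt]], of "1::real"]]) simp
  then obtain \<delta> where \<delta>': "\<delta> > 0 \<and> (\<forall>y. norm (y - p) < \<delta> \<longrightarrow> norm (F y - F p - F' (y - p)) \<le> 1 * norm (y - p))"
    by (rule exE)
  note \<delta> = conjunct1[OF \<delta>'] conjunct2[OF \<delta>', rule_format]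
  have bl: "bounded_linear F'" using F' by (rule has_derivative_bounded_linear)
  define C where "C = 1 + onorm F'"
  have C: "C > 0" using onorm_pos_le[OF bl] by (simp add: C_def)
  have "fmod F (p + u) \<le> C * norm u" if u: "norm u < \<delta>" for u
  proof -
    have "norm (F (p + u) - F' u) \<le> norm u" using \<delta>(2)[of "p + u"] u by (simp add: z)
    then have "norm (F (p + u)) \<le> norm u + norm (F' u)" using norm_triangle_ineq2[of "F (p + u)" "F' u"] by linarith
    also have "\<dots> \<le> C * norm u" using onorm[OF bl, of u] by (simp add: C_def algebra_simps)
    finally have 1: "norm (F (p + u)) \<le> C * norm u" .
    have "fmod F (p + u) \<le> norm (F (p + u)) * 1" unfolding fmod_def by (intro mult_left_mono) auto
    with 1 show ?thesis by simp
  qed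
  with C \<delta>(1) show ?thesis by blast
qed

text \<open>With e = 1 - r^2, the dilate at a lattice point l is at most C * e * |l| times a
  Gaussian, because H vanishes at l and r * l is close to l. Squaring and giving up half of the
  Gaussian rate leaves e times a lattice sum of order 1 / e, so the sample sums stay bounded as r
  tends to 1.\<close>

lemma not_lower_sampling_critical:
  assumes n: "n \<ge> 1" and ab: "\<bar>Im (cnj a * b)\<bar> = 1 / real n"
  shows "\<not> lower_sampling a b n"
proof
  assume "lower_sampling a b n"
  then obtain A where A': "A > 0 \<and> (\<forall>F \<phi>. polyrep n \<phi> F \<longrightarrow> fock_norm2 F < \<infinity> \<longrightarrow>
     ennreal A * fock_norm2 F \<le> (\<integral>\<^sup>+l. ennreal ((fmod F l)\<^sup>2) \<partial>count_space (lat a b)))"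
    unfolding lower_sampling_def by (rule exE)
  note A = conjunct1[OF A'] and low = conjunct2[OF A', rule_format]
  let ?L = "count_space (lat a b)"
  have nd: "Im (cnj a * b) \<noteq> 0" using ab n by auto
  define a' where "a' = of_nat n * a"
  have "Im (cnj a' * b) = real n * Im (cnj a * b)" by (simp add: a'_def algebra_simps)
  then have nd': "Im (cnj a' * b) \<noteq> 0" using nd n by simp
  obtain \<phi> H zH where H: "polyrep n \<phi> H" "H zH \<noteq> 0" "\<And>l. l \<in> lat a b \<Longrightarrow> H l = 0"
     "\<And>l z. l \<in> lat a' b \<Longrightarrow> fmod H (z + l) = fmod H z"
    using exists_vanishing_quasi_periodic[OF n ab] unfolding a'_def[symmetric] by (elim exE conjE) metis
  have Hc: "continuous_on UNIV H" by (rule polyrep_continuous[OF H(1)])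
  have Hm[measurable]: "H \<in> borel_measurable borel" by (rule borel_measurable_continuous_onI[OF Hc])
  obtain B where B: "B > 0" "\<And>z. norm (fmod H z) \<le> B"
    using periodic_bounded[OF nd' continuous_fmod[OF Hc] H(4)] by metis
  have lip: "\<exists>C>0. \<forall>u. fmod H (p + u) \<le> C * norm u" if p: "p \<in> lat a b" for p
  proof -
    obtain C \<delta> where C: "C > 0" "\<delta> > 0" "\<And>u. norm u < \<delta> \<Longrightarrow> fmod H (p + u) \<le> C * norm u"
      using polyrep_locally_lipschitz_at_zero[OF H(1) H(3)[OF p]] by blast
    have "fmod H (p + u) \<le> (C + B / \<delta>) * norm u" for u
    proof (cases "norm u < \<delta>")
      case True
      have "C * norm u \<le> (C + B / \<delta>) * norm u" using B C by (intro mult_right_mono) auto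
      then show ?thesis using C(3)[OF True] by linarith
    next
      \<comment> \<open>Beyond \<delta> the global bound B takes over from the derivative, giving
        one linear bound on the whole plane.\<close>
      case False
      have "fmod H (p + u) \<le> B" using B(2)[of "p + u"] by simp
      also have "\<dots> = B / \<delta> * \<delta>" using C by simp
      also have "\<dots> \<le> (C + B / \<delta>) * norm u" using False B C by (intro mult_mono) auto
      finally show ?thesis .
    qed
    moreover have "C + B / \<delta> > 0" using B C by (intro add_pos_pos divide_pos_pos)
    ultimately show ?thesis by blast
  qed
  have "\<forall>i. \<exists>C>0. \<forall>u. fmod H (of_nat i * a + u) \<le> C * norm u"
  proof
    fix i
    show "\<exists>C>0. \<forall>u. fmod H (of_nat i * a + u) \<le> C * norm u"
      by (rule lip) (use latI[of "int i" a 0 b] in simp)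
  qed
  then obtain Ci where Ci: "\<And>i::nat. Ci i > 0" "\<And>i u. fmod H (of_nat i * a + u) \<le> Ci i * norm u" by metis
  \<comment> \<open>Modulo the periods of the weighted modulus there are only n classes of lattice
    points, so a single Lipschitz constant serves all of them.\<close>
  define C where "C = (\<Sum>i<n. Ci i)"
  have C0: "C \<ge> 0" unfolding C_def by (rule sum_nonneg) (rule less_imp_le[OF Ci(1)])
  have LIP: "fmod H (l + u) \<le> C * norm u" if l: "l \<in> lat a b" for l u
  proof -
    obtain p q where pq: "l = of_int p * a + of_int q * b" using l by (rule latE)
    define i where "i = nat (p mod int n)"
    have i: "i < n" using n by (simp add: i_def nat_less_iff)
    have "p = int n * (p div int n) + int i" using n by (simp add: i_def)
    then have "of_int p = (of_nat n * of_int (p div int n) + of_nat i :: complex)"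
      by (metis of_int_add of_int_mult of_int_of_nat_eq)
    then have eq: "l + u = (of_nat i * a + u) + (of_int (p div int n) * a' + of_int q * b)"
      by (simp add: pq a'_def algebra_simps)
    have "fmod H (l + u) = fmod H (of_nat i * a + u)" unfolding eq by (rule H(4)[OF latI])
    also have "\<dots> \<le> Ci i * norm u" by (rule Ci(2))
    also have "\<dots> \<le> C * norm u"
      unfolding C_def using i Ci(1) by (intro mult_right_mono member_le_sum) (auto intro: less_imp_le)
    finally show ?thesis .
  qed
  obtain C1 d where C1: "C1 > 0" "\<forall>t>0. \<forall>z. (\<integral>\<^sup>+x. ennreal (exp (- t * (norm (x - z))\<^sup>2)) \<partial>?L) \<le> ennreal (C1 * exp (t * d) / t)"
    using lat_gauss_sum[OF nd] by blast
  define K where "K = C\<^sup>2 * (C1 * exp (pi / 2 * \<bar>d\<bar>) / (pi / 2))"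
  have K0: "K \<ge> 0" using C1 by (simp add: K_def)
  define Hr where "Hr r z = H (of_real r * z) * 1" for r z
  have Hr: "\<exists>\<psi>. polyrep n \<psi> (Hr r)" for r
    using polyrep_dilate[OF H(1), of "\<lambda>_. 1" r] unfolding Hr_def by (intro exI) auto
  have fHr: "(fmod (Hr r) z)\<^sup>2 = (fmod H (of_real r * z))\<^sup>2 * exp (- (pi * (1 - r\<^sup>2)) * (norm z)\<^sup>2)" for r z
  proof -
    have "exp (- pi * (norm z)\<^sup>2) = exp (- pi * (norm (of_real r * z))\<^sup>2) * exp (- (pi * (1 - r\<^sup>2)) * (norm z)\<^sup>2)"
      unfolding mult_exp_exp norm_mult power_mult_distrib by (rule arg_cong[where f=exp]) (simp add: algebra_simps)
    then show ?thesis by (simp add: fmod_sq[symmetric] Hr_def)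
  qed
  have bound: "fock_norm2 (Hr r) \<le> ennreal (K / A)" if r: "0 < r" "r < 1" for r
  proof -
    define e where "e = 1 - r\<^sup>2"
    have e: "e > 0" "e \<le> 1" "1 - r \<le> e"
    proof -
      have "r\<^sup>2 \<le> r" using r by (simp add: power2_eq_square mult_left_le)
      then show "e > 0" "e \<le> 1" "1 - r \<le> e" using r by (simp_all add: e_def)
    qed
    have pe: "pi * e > 0" "pi * e / 2 > 0" using e by simp_all
    \<comment> \<open>This bound is of order 1 / e and serves only to place the dilate in the space,
      so that the assumed inequality applies.\<close>
    have "fock_norm2 (Hr r) \<le> (\<integral>\<^sup>+(z::complex). ennreal (B\<^sup>2) * ennreal (exp (- (pi * e) * (norm (z - 0))\<^sup>2)) \<partial>lborel)"
      unfolding fock_norm2_fmod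
    proof (rule nn_integral_mono)
      fix z :: complex
      have "(fmod H (of_real r * z))\<^sup>2 \<le> B\<^sup>2" using B(2)[of "of_real r * z"] by (intro power_mono) auto
      then have "(fmod (Hr r) z)\<^sup>2 \<le> B\<^sup>2 * exp (- (pi * e) * (norm z)\<^sup>2)"
        unfolding fHr e_def[symmetric] by (rule mult_right_mono) simp
      then show "ennreal ((fmod (Hr r) z)\<^sup>2) \<le> ennreal (B\<^sup>2) * ennreal (exp (- (pi * e) * (norm (z - 0))\<^sup>2))"
        by (simp add: ennreal_mult[symmetric] ennreal_leI)
    qed
    also have "\<dots> = ennreal (B\<^sup>2) * (ennreal (pi / (pi * e)) * gauss_mass)"
      using nn_integral_gauss[OF pe(1), of 0] by (subst nn_integral_cmult) auto
    also have "\<dots> < \<infinity>" using gauss_mass_finite by (simp add: ennreal_mult_less_top)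
    finally have fin: "fock_norm2 (Hr r) < \<infinity>" .
    obtain \<psi> where \<psi>: "polyrep n \<psi> (Hr r)" using Hr by blast
    have "ennreal A * fock_norm2 (Hr r) \<le> (\<integral>\<^sup>+l. ennreal ((fmod (Hr r) l)\<^sup>2) \<partial>?L)" by (rule low[OF \<psi> fin])
    also have "\<dots> \<le> (\<integral>\<^sup>+l. ennreal (C\<^sup>2 * e) * ennreal (exp (- (pi * e / 2) * (norm (l - 0))\<^sup>2)) \<partial>?L)"
    proof (rule nn_integral_mono)
      fix l assume "l \<in> space ?L"
      then have l: "l \<in> lat a b" by simp
      have "fmod H (of_real r * l) \<le> C * norm (of_real r * l - l)" using LIP[OF l, of "of_real r * l - l"] by simp
      also have "norm (of_real r * l - l) = (1 - r) * norm l"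
      proof -
        have "of_real r * l - l = of_real (r - 1) * l" by (simp add: algebra_simps)
        then show ?thesis using r by (simp only: norm_mult norm_of_real) simp
      qed
      also have "C * ((1 - r) * norm l) \<le> C * (e * norm l)" using e C0 by (intro mult_left_mono mult_right_mono) auto
      finally have "(fmod H (of_real r * l))\<^sup>2 \<le> (C * (e * norm l))\<^sup>2" by (rule power_mono) simp
      also have "\<dots> = C\<^sup>2 * e * (e * (norm l)\<^sup>2)" by (simp add: power_mult_distrib power2_eq_square)
      \<comment> \<open>Half of the Gaussian rate pays for the quadratic factor; one power of e is
        kept outside to cancel the 1 / e of the lattice sum.\<close>
      also have "e * (norm l)\<^sup>2 \<le> exp (pi * e / 2 * (norm l)\<^sup>2)"
      proof -
        have "1 * (e * (norm l)\<^sup>2) \<le> (pi / 2) * (e * (norm l)\<^sup>2)" using e pi_ge_two by (intro mult_right_mono) auto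
        also have "\<dots> \<le> exp ((pi / 2) * (e * (norm l)\<^sup>2))" using exp_ge_add_one_self[of "(pi / 2) * (e * (norm l)\<^sup>2)"] by linarith
        finally show ?thesis by (simp add: mult_ac)
      qed
      finally have "(fmod H (of_real r * l))\<^sup>2 \<le> C\<^sup>2 * e * exp (pi * e / 2 * (norm l)\<^sup>2)" using e by (simp add: mult_left_mono)
      then have "(fmod (Hr r) l)\<^sup>2 \<le> C\<^sup>2 * e * exp (pi * e / 2 * (norm l)\<^sup>2) * exp (- (pi * e) * (norm l)\<^sup>2)"
        unfolding fHr e_def[symmetric] by (rule mult_right_mono) simp
      also have "\<dots> = C\<^sup>2 * e * exp (- (pi * e / 2) * (norm l)\<^sup>2)"
        unfolding mult.assoc mult_exp_exp by (simp add: field_simps)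
      finally show "ennreal ((fmod (Hr r) l)\<^sup>2) \<le> ennreal (C\<^sup>2 * e) * ennreal (exp (- (pi * e / 2) * (norm (l - 0))\<^sup>2))"
        using e by (simp add: ennreal_mult[symmetric] ennreal_leI)
    qed
    also have "\<dots> = ennreal (C\<^sup>2 * e) * (\<integral>\<^sup>+l. ennreal (exp (- (pi * e / 2) * (norm (l - 0))\<^sup>2)) \<partial>?L)"
      by (rule nn_integral_cmult) simp
    also have "\<dots> \<le> ennreal (C\<^sup>2 * e) * ennreal (C1 * exp (pi * e / 2 * d) / (pi * e / 2))"
      by (rule mult_left_mono[OF C1(2)[rule_format, OF pe(2), of 0]]) simp
    also have "\<dots> = ennreal (C\<^sup>2 * (C1 * exp (pi * e / 2 * d) / (pi / 2)))"
      using e C1 by (subst ennreal_mult[symmetric]) (auto simp: field_simps)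
    also have "\<dots> \<le> ennreal K"
    proof (rule ennreal_leI)
      have "pi * e / 2 * d \<le> pi / 2 * \<bar>d\<bar>"
      proof -
        have "e * d \<le> e * \<bar>d\<bar>" using e by (intro mult_left_mono) auto
        also have "\<dots> \<le> 1 * \<bar>d\<bar>" using e by (intro mult_right_mono) auto
        finally have "e * d \<le> 1 * \<bar>d\<bar>" .
        from mult_left_mono[OF this, of "pi / 2"] show ?thesis by (simp add: mult_ac)
      qed
      then show "C\<^sup>2 * (C1 * exp (pi * e / 2 * d) / (pi / 2)) \<le> K"
        unfolding K_def using C1 by (intro mult_left_mono divide_right_mono) auto
    qed
    finally have "ennreal A * fock_norm2 (Hr r) \<le> ennreal K" .
    then have "ennreal (1 / A) * (ennreal A * fock_norm2 (Hr r)) \<le> ennreal (1 / A) * ennreal K" by (rule mult_left_mono) simp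
    moreover have "ennreal (1 / A) * (ennreal A * fock_norm2 (Hr r)) = fock_norm2 (Hr r)"
    proof -
      have "ennreal (1 / A) * ennreal A = 1" using A by (simp add: ennreal_mult[symmetric])
      then show ?thesis by (simp only: mult.assoc[symmetric] mult_1_left)
    qed
    moreover have "ennreal (1 / A) * ennreal K = ennreal (K / A)" using A K0 by (simp add: ennreal_mult[symmetric])
    ultimately show ?thesis by simp
  qed
  \<comment> \<open>The offset 2 keeps every ratio strictly between 0 and 1, also for k = 0.\<close>
  define rk where "rk k = 1 - 1 / real (k + 2)" for k :: nat
  have rk: "0 < rk k" "rk k < 1" for k by (simp_all add: rk_def)
  have rk1: "rk \<longlonglongrightarrow> 1"
  proof -
    have "(\<lambda>k. 1 - 1 / real (k + 2)) \<longlonglongrightarrow> 1 - 0"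
      by (intro tendsto_diff tendsto_const LIMSEQ_ignore_initial_segment[OF lim_1_over_n])
    then show ?thesis by (simp add: rk_def[abs_def])
  qed
  have conv: "(\<lambda>k. ennreal ((fmod (Hr (rk k)) z)\<^sup>2)) \<longlonglongrightarrow> ennreal ((fmod H z)\<^sup>2)" for z
  proof -
    have "(\<lambda>k. of_real (rk k) * z) \<longlonglongrightarrow> of_real 1 * z" by (intro tendsto_intros rk1)
    then have "(\<lambda>k. H (of_real (rk k) * z)) \<longlonglongrightarrow> H (of_real 1 * z)"
      using Hc by (intro continuous_on_tendsto_compose[of UNIV H]) auto
    then show ?thesis unfolding fmod_def Hr_def by (intro tendsto_ennrealI tendsto_intros) simp
  qed
  have "fock_norm2 H \<le> ennreal (K / A)"
  proof -
    \<comment> \<open>Fatou's lemma carries the bound, uniform over the dilates, to H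
      itself.\<close>
    have "fock_norm2 H = (\<integral>\<^sup>+z. liminf (\<lambda>k. ennreal ((fmod (Hr (rk k)) z)\<^sup>2)) \<partial>lborel)"
      unfolding fock_norm2_fmod using lim_imp_Liminf[OF _ conv] by (intro nn_integral_cong) simp
    also have "\<dots> \<le> liminf (\<lambda>k. \<integral>\<^sup>+z. ennreal ((fmod (Hr (rk k)) z)\<^sup>2) \<partial>lborel)"
    proof (rule nn_integral_liminf)
      fix k
      obtain \<psi> where "polyrep n \<psi> (Hr (rk k))" using Hr by blast
      from polyrep_continuous[OF this] have "Hr (rk k) \<in> borel_measurable borel" by (rule borel_measurable_continuous_onI)
      then show "(\<lambda>z. ennreal ((fmod (Hr (rk k)) z)\<^sup>2)) \<in> borel_measurable lborel" by measurable
    qed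
    also have "\<dots> \<le> ennreal (K / A)"
      unfolding fock_norm2_fmod[symmetric] by (rule Liminf_le) (use bound[OF rk] in auto)
    finally show ?thesis .
  qed
  then have fin: "fock_norm2 H < \<infinity>" by (rule le_less_trans) simp
  have "ennreal A * fock_norm2 H \<le> (\<integral>\<^sup>+l. ennreal ((fmod H l)\<^sup>2) \<partial>?L)" by (rule low[OF H(1) fin])
  also have "\<dots> = (\<integral>\<^sup>+l. 0 \<partial>?L)" by (rule nn_integral_cong) (simp add: fmod_def H(3))
  finally have "fock_norm2 H = 0" using A by (simp add: ennreal_eq_0_iff not_le)
  then have "AE z in lborel. ennreal ((fmod H z)\<^sup>2) = 0"
    unfolding fock_norm2_fmod by (subst (asm) nn_integral_0_iff_AE) auto
  then have "AE z in lborel. fmod H z = 0"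
    by (rule eventually_mono) (simp add: ennreal_eq_0_iff)
  then have "fmod H zH = 0" by (rule continuous_AE_zero[OF continuous_fmod[OF Hc]])
  then show False using H(2) by (simp add: fmod_def)
qed

lemma lower_sampling_imp_density:
  assumes nd: "Im (cnj a * b) \<noteq> 0" and n: "n \<ge> 1" and low: "lower_sampling a b n"
  shows "real n * \<bar>Im (cnj a * b)\<bar> < 1"
proof (rule ccontr)
  assume "\<not> ?thesis"
  then have ge: "real n * \<bar>Im (cnj a * b)\<bar> \<ge> 1" by simp
  define D where "D = \<bar>Im (cnj a * b)\<bar>"
  have D: "D > 0" "real n * D \<ge> 1" using nd ge by (simp_all add: D_def)
  show False
  proof (cases "real n * D = 1")
    case True
    then have "\<bar>Im (cnj a * b)\<bar> = 1 / real n" using n by (simp add: D_def field_simps)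
    from not_lower_sampling_critical[OF n this] low show False by contradiction
  next
    case False
    \<comment> \<open>The contraction that brings the cell area exactly to the critical value 1 /
      n.\<close>
    define t where "t = sqrt (1 / (real n * D))"
    have nD: "real n * D > 1" using D(2) False by simp
    have t: "0 < t" "t < 1" "t\<^sup>2 = 1 / (real n * D)"
      using nD by (simp_all add: t_def real_sqrt_lt_1_iff)
    have "Im (cnj (of_real t * a) * (of_real t * b)) = t\<^sup>2 * Im (cnj a * b)"
      by (simp add: power2_eq_square algebra_simps)
    then have "\<bar>Im (cnj (of_real t * a) * (of_real t * b))\<bar> = t\<^sup>2 * D" by (simp add: abs_mult D_def)
    also have "\<dots> = 1 / real n" using D n by (simp add: t(3))
    finally have "\<not> lower_sampling (of_real t * a) (of_real t * b) n" by (rule not_lower_sampling_critical[OF n])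
    with lower_sampling_dilate[OF low t(1,2)] show False by contradiction
  qed
qed

section \<open>Lattices given by real matrices\<close>

no_notation vec_index (infixl "$" 100) and fps_nth (infixl "$" 75)
hide_const (open) Determinant.det

text \<open>The generators are the columns of A read as complex numbers, since A maps the unit
  vectors to its columns.\<close>

lemma Gamma_of_lattice_of:
  fixes A :: "real^2^2"
  shows "Gamma_of (lattice_of A) = lat (Complex (A $ 1 $ 1) (A $ 2 $ 1)) (Complex (A $ 1 $ 2) (A $ 2 $ 2))"
    (is "_ = lat ?a ?b")
proof -
  have A: "Complex ((A *v v) $ 1) ((A *v v) $ 2) = of_real (v $ 1) * ?a + of_real (v $ 2) * ?b" for v
    by (simp add: complex_eq_iff matrix_vector_mult_def sum_2 mult.commute)
  show ?thesis
  proof (rule subset_antisym; rule subsetI)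
    fix z assume "z \<in> Gamma_of (lattice_of A)"
    then obtain v where v: "\<forall>i. v $ i \<in> \<int>" "z = Complex ((A *v v) $ 1) ((A *v v) $ 2)"
      unfolding Gamma_of_def lattice_of_def by blast
    obtain p q where "v $ 1 = of_int p" "v $ 2 = of_int q" using spec[OF v(1), of 1] spec[OF v(1), of 2] by (elim Ints_cases)
    then have "z = of_int p * ?a + of_int q * ?b" by (simp add: v(2) A)
    then show "z \<in> lat ?a ?b" by (simp add: latI)
  next
    fix z assume "z \<in> lat ?a ?b"
    then obtain p q where z: "z = of_int p * ?a + of_int q * ?b" by (rule latE)
    define v :: "real^2" where "v = vector [of_int p, of_int q]"
    have "v $ i \<in> \<int>" for i using exhaust_2[of i] by (auto simp: v_def vector_2)
    moreover have "z = Complex ((A *v v) $ 1) ((A *v v) $ 2)" unfolding A z by (simp add: v_def vector_2)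
    ultimately show "z \<in> Gamma_of (lattice_of A)" unfolding Gamma_of_def lattice_of_def by blast
  qed
qed

lemma sampling_sequence_lat_iff:
  assumes nd: "Im (cnj a * b) \<noteq> 0" and n: "n \<ge> 1"
  shows "sampling_sequence (lat a b) n \<longleftrightarrow> real n * \<bar>Im (cnj a * b)\<bar> < 1"
proof -
  have S: "(\<Sum>\<^sub>\<infinity>z\<in>lat a b. ennreal ((norm (F z))\<^sup>2 * exp (- pi * (norm z)\<^sup>2)))
      = (\<integral>\<^sup>+l. ennreal ((fmod F l)\<^sup>2) \<partial>count_space (lat a b))" for F
    unfolding fmod_sq by (rule infsum_ennreal_eq_nn_integral[OF lat_countable])
  show ?thesis
  proof
    assume "sampling_sequence (lat a b) n"
    then obtain A where "\<exists>B. A > 0 \<and> B > 0 \<and> (\<forall>F\<in>polyFock n.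
        ennreal A * fock_norm2 F \<le> (\<integral>\<^sup>+l. ennreal ((fmod F l)\<^sup>2) \<partial>count_space (lat a b))
      \<and> (\<integral>\<^sup>+l. ennreal ((fmod F l)\<^sup>2) \<partial>count_space (lat a b)) \<le> ennreal B * fock_norm2 F)"
      unfolding sampling_sequence_def S by (rule exE)
    then obtain B where AB: "A > 0 \<and> B > 0 \<and> (\<forall>F\<in>polyFock n.
        ennreal A * fock_norm2 F \<le> (\<integral>\<^sup>+l. ennreal ((fmod F l)\<^sup>2) \<partial>count_space (lat a b))
      \<and> (\<integral>\<^sup>+l. ennreal ((fmod F l)\<^sup>2) \<partial>count_space (lat a b)) \<le> ennreal B * fock_norm2 F)"
      by (rule exE)
    have "lower_sampling a b n"
      unfolding lower_sampling_def
    proof (rule exI[of _ A], intro conjI allI impI)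
      show "A > 0" by (rule conjunct1[OF AB])
      fix F \<phi> assume F: "polyrep n \<phi> F" "fock_norm2 F < \<infinity>"
      have "\<exists>\<phi>. polyrep n \<phi> F" by (rule exI[of _ \<phi>], rule F(1))
      then have "F \<in> polyFock n" using F(2) by (simp only: polyFock_iff simp_thms)
      from bspec[OF conjunct2[OF conjunct2[OF AB]] this]
      show "ennreal A * fock_norm2 F \<le> (\<integral>\<^sup>+l. ennreal ((fmod F l)\<^sup>2) \<partial>count_space (lat a b))"
        by (rule conjunct1)
    qed
    then show "real n * \<bar>Im (cnj a * b)\<bar> < 1" by (rule lower_sampling_imp_density[OF nd n])
  next
    assume d: "real n * \<bar>Im (cnj a * b)\<bar> < 1"
    obtain C where C': "C > 0 \<and> (\<forall>F \<phi>. polyrep n \<phi> F \<longrightarrow> fock_norm2 F < \<infinity> \<longrightarrow>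
        fock_norm2 F \<le> ennreal C * (\<integral>\<^sup>+l. ennreal ((fmod F l)\<^sup>2) \<partial>count_space (lat a b)))"
      using sampling_lower_bound[OF nd d] by (rule exE)
    note C = conjunct1[OF C'] and lower = conjunct2[OF C', rule_format]
    obtain D where D': "D > 0 \<and> (\<forall>F \<phi>. polyrep n \<phi> F \<longrightarrow>
        (\<integral>\<^sup>+l. ennreal ((fmod F l)\<^sup>2) \<partial>count_space (lat a b)) \<le> ennreal D * fock_norm2 F)"
      using lat_bessel[OF nd] by (rule exE)
    note D = conjunct1[OF D'] and upper = conjunct2[OF D', rule_format]
    show "sampling_sequence (lat a b) n"
      unfolding sampling_sequence_def S
    proof (rule exI[of _ "1 / C"], rule exI[of _ D], intro conjI ballI)
      show "1 / C > 0" "D > 0" using C D by simp_all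
    next
      fix F :: "complex \<Rightarrow> complex" assume "F \<in> polyFock n"
      then have F: "(\<exists>\<phi>. polyrep n \<phi> F) \<and> fock_norm2 F < \<infinity>" by (simp only: polyFock_iff)
      obtain \<phi> where \<phi>: "polyrep n \<phi> F" using conjunct1[OF F] by (rule exE)
      show "(\<integral>\<^sup>+l. ennreal ((fmod F l)\<^sup>2) \<partial>count_space (lat a b)) \<le> ennreal D * fock_norm2 F" by (rule upper[OF \<phi>])
      have "ennreal (1 / C) * fock_norm2 F
          \<le> ennreal (1 / C) * (ennreal C * (\<integral>\<^sup>+l. ennreal ((fmod F l)\<^sup>2) \<partial>count_space (lat a b)))"
        by (rule mult_left_mono[OF lower[OF \<phi> conjunct2[OF F]]]) simp
      also have "\<dots> = (\<integral>\<^sup>+l. ennreal ((fmod F l)\<^sup>2) \<partial>count_space (lat a b))"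
      proof -
        have "ennreal (1 / C) * ennreal C = 1" using C by (simp add: ennreal_mult[symmetric])
        then show ?thesis by (simp only: mult.assoc[symmetric] mult_1_left)
      qed
      finally show "ennreal (1 / C) * fock_norm2 F \<le> (\<integral>\<^sup>+l. ennreal ((fmod F l)\<^sup>2) \<partial>count_space (lat a b))" .
    qed
  qed
qed

theorem theorem4:
  fixes n :: nat and A :: "real^2^2"
  assumes "n \<ge> 1" and "det A \<noteq> 0"
  shows "sampling_sequence (Gamma_of (lattice_of A)) n \<longleftrightarrow> lattice_density A > real n"
proof -
  let ?a = "Complex (A $ 1 $ 1) (A $ 2 $ 1)" and ?b = "Complex (A $ 1 $ 2) (A $ 2 $ 2)"
  have det: "Im (cnj ?a * ?b) = det A" by (simp add: det_2 mult.commute)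
  have "sampling_sequence (Gamma_of (lattice_of A)) n \<longleftrightarrow> real n * \<bar>det A\<bar> < 1"
    unfolding Gamma_of_lattice_of
    by (rule sampling_sequence_lat_iff[of ?a ?b n, unfolded det]) (rule assms)+
  also have "\<dots> \<longleftrightarrow> lattice_density A > real n"
    using assms(2) by (simp add: lattice_density_def field_simps)
  finally show ?thesis .
qed

end
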